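(* If $K\subseteq\mathbb{R}^{n+m}$ is a compact regular partially convex set in $x$, then $\mathcal{C}_{\mathrm{aff}}(K)$ is a free order unit module of type $(n,m)$ over $C(Y)$, where $Y=\pi_2(K)$.
   Context: **Partially convex sets.** Write elements of $\mathbb{R}^{n+m}$ as $(x,y)$, $x\in\mathbb{R}^n$, $y\in\mathbb{R}^m$. For $K\subseteq\mathbb{R}^{n+m}$ let $\pi_2(K)=\{y\in\mathbb{R}^m : \exists x\in\mathbb{R}^n,\ (x,y)\in K\}$ and $K_y=\{x\in\mathbb{R}^n : (x,y)\in K\}$. A closed set $K$ is a *regular partially convex set* in $x$ if $K_y$ is convex with nonempty interior in $\mathbb{R}^n$ for all $y\in\pi_2(K)$, and the set-valued map $y\mapsto\operatorname{int}(K_y)$ on $\pi_2(K)$ is lower hemicontinuous: for every $y\in\pi_2(K)$, every sequence $y_k\to y$ in $\pi_2(K)$ and every $x\in\operatorname{int}(K_y)$ there are $x_k\in\operatorname{int}(K_{y_k})$ with $x_k\to x$. $\mathcal{C}_{\mathrm{aff}}(K)$ denotes the space of continuous functions $f:K\to\mathbb{R}$ such that $x\mapsto f(x,y)$ is affine on $K_y$ for each fixed $y$, with supremum norm; it is ordered pointwise with order unit the constant function $1$. **AOU spaces.** An Archimedean order unit (AOU) space is a real vector space $A$ with a cone $A^+$, $A^+\cap(-A^+)=\{0\}$ (write $a\le b$ if $b-a\in A^+$), and an order unit $u$ (for each $a\in A$ there is $r>0$ with $-ru\le a\le ru$) such that $a\in A^+$ whenever $a+ru\in A^+$ for all $r>0$.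 Its norm is $\|a\|=\inf\{r>0: -ru\le a\le ru\}$. A state is a positive linear functional $\varphi:A\to\mathbb{R}$ with $\varphi(u)=1$; $\mathcal{S}(A)$ is the set of states with the weak-* topology, and $A$ embeds (Kadison embedding) in $C(\mathcal{S}(A))$ (real-valued functions) by $a\mapsto(\varphi\mapsto\varphi(a))$. An order ideal is a linear subspace $J$ such that $0\le a\le j$, $j\in J$ imply $a\in J$. **Free order unit modules.** A *free order unit module of type $(n,m)$* is a set $A$ with the following structure. 1. $A$ is an AOU space with order unit $u$ and cone $A^+$. 2. $A$ is a module over its multiplicative domain $\mathcal{M}_A=\{z\in A: z\cdot a\in A\ \forall a\in A\}$, the product being the pointwise product in $C(\mathcal{S}(A))$ via the Kadison embedding. It is assumed that $\mathcal{M}_A$, with the norm inherited from $A$, is a unital commutative real $C^*$-algebra with unit $1_A$, generated as a unital $C^*$-algebra by $m$ elements $g_1,\dots,g_m$. The map $\chi\mapsto(\chi(g_1),\dots,\chi(g_m))$ embeds the character space of $\mathcal{M}_A$ homeomorphically onto a compact set $Y\subseteq\mathbb{R}^m$, giving an isometric $*$-isomorphism $\mathcal{M}_A\cong C(Y)$ (real-valued functions), used as an identification. "Over $C(Y)$" refers to this identification of $\mathcal{M}_A$; for $A=\mathcal{C}_{\mathrm{aff}}(K)$, $C(Y)$ with $Y=\pi_2(K)$ is embedded as the functions on $K$ depending only on $y$. 3. $A$ is a free $\mathcal{M}_A$-module of rank $n+1$: there is a basis $\{e_0,\dots,e_n\}$ such that each $a\in A$ is uniquely $a=\sum_{i=0}^n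 c_ie_i$ with $c_i\in\mathcal{M}_A$. 4. $u=e_0$. 5. For $y\in Y$ let $J_y$ be the closed order ideal of $A$ generated by $I_y=\{f\in\mathcal{M}_A\cong C(Y): f(y)=0\}$, $A_y=A/J_y$ with classes $[a]_y$, and $A_y^+=\{[a]_y: a\in A^+\}$. With this cone and the order unit $u_y=[u]_y$, $A_y$ is an AOU space of dimension $n+1$ (its order unit norm is denoted $\|\cdot\|_y$). Moreover $a\in A^+\iff[a]_y\in A_y^+$ for all $y\in Y$. 6. For every sequence $y_k\to y_0$ in $Y$ and $v_k\in A_{y_k}^+$ with $\sup_k\|v_k\|_{y_k}<\infty$, there are a subsequence $(v_{k_j})$, $v_0\in A_{y_0}^+$ and $a\in A$ with $[a]_{y_0}=v_0$ and $\lim_j\|v_{k_j}-[a]_{y_{k_j}}\|_{y_{k_j}}=0$. 7. For some (hence any) module basis with $e_0=u$, the linear isomorphism $A\to C(Y)^{n+1}$, $\sum c_ie_i\mapsto(c_0,\dots,c_n)$, is a homeomorphism from $A$ with the order unit norm onto $C(Y)^{n+1}$ with the product supremum norm topology.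
   Formalization: The product defining M_A is taken pointwise on the evaluations at points of K, not on all of S(A): elements of A are affine on S(A), so there M_A would be only the multiples of u (e.g. K=[0,1]^2) and the claim would fail. Also n, m are at least 1. *)

theory Defs
  imports "HOL-Analysis.Analysis" "HOL-Algebra.Module" "HOL-Algebra.QuotRing" "HOL-Algebra.Subrings"
begin

section \<open>Archimedean order unit spaces\<close>

text \<open>
  Real vector spaces with an explicit carrier are modules over the following ring. The fields
  \<open>mult\<close> and \<open>one\<close> of a module record play no role in \<^locale>\<open>Module.module\<close>; they are
  \<^term>\<open>undefined\<close> below unless the module is an algebra.
\<close>

definition real_ring :: "real ring" where
  "real_ring = \<lparr>carrier = UNIV, mult = (*), one = 1, zero = 0, add = (+)\<rparr>"

locale aou_space = Module.module real_ring V
  for V :: "(real, 'a) module" (structure) +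
  fixes P :: "'a set" and u :: 'a
  assumes pos_subset: "P \<subseteq> carrier V"
    and pos_zero: "\<zero> \<in> P"
    and pos_add: "\<lbrakk>a \<in> P; b \<in> P\<rbrakk> \<Longrightarrow> a \<oplus> b \<in> P"
    and pos_smult: "\<lbrakk>0 \<le> r; a \<in> P\<rbrakk> \<Longrightarrow> r \<odot> a \<in> P"
    and pos_proper: "\<lbrakk>a \<in> P; \<ominus> a \<in> P\<rbrakk> \<Longrightarrow> a = \<zero>"
    and unit_closed: "u \<in> carrier V"
    and order_unit: "a \<in> carrier V \<Longrightarrow> \<exists>r>0. a \<oplus> r \<odot> u \<in> P \<and> r \<odot> u \<ominus> a \<in> P"
    and archimedean: "\<lbrakk>a \<in> carrier V; \<And>r. 0 < r \<Longrightarrow> a \<oplus> r \<odot> u \<in> P\<rbrakk> \<Longrightarrow> a \<in> P"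

definition ou_norm :: "(real, 'a) module \<Rightarrow> 'a set \<Rightarrow> 'a \<Rightarrow> 'a \<Rightarrow> real" where
  "ou_norm V P u a =
     Inf {r. 0 < r \<and> a \<oplus>\<^bsub>V\<^esub> r \<odot>\<^bsub>V\<^esub> u \<in> P \<and> r \<odot>\<^bsub>V\<^esub> u \<ominus>\<^bsub>V\<^esub> a \<in> P}"

text \<open>
  The metric of a norm. \<^locale>\<open>Metric_space\<close> demands symmetry and nonnegativity also off the
  carrier, hence the guard.
\<close>

definition norm_metric :: "(real, 'a) module \<Rightarrow> ('a \<Rightarrow> real) \<Rightarrow> 'a metric" where
  "norm_metric V N = metric (carrier V,
     \<lambda>a b. if a \<in> carrier V \<and> b \<in> carrier V then N (a \<ominus>\<^bsub>V\<^esub> b) else 0)"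

definition order_ideal :: "(real, 'a) module \<Rightarrow> 'a set \<Rightarrow> 'a set \<Rightarrow> bool" where
  "order_ideal V P J \<longleftrightarrow> submodule J real_ring V \<and>
     (\<forall>a\<in>P. \<forall>j\<in>J. j \<ominus>\<^bsub>V\<^esub> a \<in> P \<longrightarrow> a \<in> J)"

definition closed_order_ideal :: "(real, 'a) module \<Rightarrow> 'a set \<Rightarrow> 'a \<Rightarrow> 'a set \<Rightarrow> 'a set" where
  "closed_order_ideal V P u S = \<Inter>{J. order_ideal V P J \<and>
     closedin (mtopology_of (norm_metric V (ou_norm V P u))) J \<and> S \<subseteq> J}"

definition linear_functionals :: "(real, 'a) module \<Rightarrow> ('a \<Rightarrow> real) set" where
  "linear_functionals V = {\<phi> \<in> extensional (carrier V).
     (\<forall>a\<in>carrier V. \<forall>b\<in>carrier V. \<phi> (a \<oplus>\<^bsub>V\<^esub> b) = \<phi> a + \<phi> b) \<and>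
     (\<forall>r. \<forall>a\<in>carrier V. \<phi> (r \<odot>\<^bsub>V\<^esub> a) = r * \<phi> a)}"

definition states :: "(real, 'a) module \<Rightarrow> 'a set \<Rightarrow> 'a \<Rightarrow> ('a \<Rightarrow> real) set" where
  "states V P u = {\<phi> \<in> linear_functionals V. (\<forall>a\<in>P. 0 \<le> \<phi> a) \<and> \<phi> u = 1}"

text \<open>The topology of pointwise convergence on functionals with domain \<open>carrier V\<close>.\<close>

definition weak_star :: "(real, 'a) module \<Rightarrow> ('a \<Rightarrow> real) topology" where
  "weak_star V = product_topology (\<lambda>_. euclideanreal) (carrier V)"

text \<open>
  The quotient vector space; \<open>J\<close> is added in the scalar multiplication because the pointwise
  multiple of a coset by the scalar 0 is not a coset.
\<close>

definition quotient_space :: "(real, 'a) module \<Rightarrow> 'a set \<Rightarrow> (real, 'a set) module" where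
  "quotient_space V J = \<lparr>carrier = a_rcosets\<^bsub>V\<^esub> J, mult = undefined, one = undefined,
     zero = J, add = (\<lambda>S T. S <+>\<^bsub>V\<^esub> T),
     smult = (\<lambda>r S. J <+>\<^bsub>V\<^esub> ((\<lambda>a. r \<odot>\<^bsub>V\<^esub> a) ` S))\<rparr>"

definition free_basis ::
    "('r, 'k) ring_scheme \<Rightarrow> ('r, 'a) module \<Rightarrow> 'i set \<Rightarrow> ('i \<Rightarrow> 'a) \<Rightarrow> bool" where
  "free_basis R V I e \<longleftrightarrow> e \<in> I \<rightarrow> carrier V \<and>
     (\<forall>a\<in>carrier V. \<exists>!c. c \<in> I \<rightarrow>\<^sub>E carrier R \<and> a = (\<Oplus>\<^bsub>V\<^esub>i\<in>I. c i \<odot>\<^bsub>V\<^esub> e i))"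

definition coordinates ::
    "('r, 'k) ring_scheme \<Rightarrow> ('r, 'a) module \<Rightarrow> 'i set \<Rightarrow> ('i \<Rightarrow> 'a) \<Rightarrow> 'a \<Rightarrow> 'i \<Rightarrow> 'r" where
  "coordinates R V I e a =
     (THE c. c \<in> I \<rightarrow>\<^sub>E carrier R \<and> a = (\<Oplus>\<^bsub>V\<^esub>i\<in>I. c i \<odot>\<^bsub>V\<^esub> e i))"

definition has_dimension :: "(real, 'a) module \<Rightarrow> nat \<Rightarrow> bool" where
  "has_dimension V d \<longleftrightarrow> (\<exists>b. free_basis real_ring V {..<d} b)"


section \<open>Commutative real \<open>C\<^sup>*\<close>-algebras\<close>

locale comm_real_cstar_algebra = Module.algebra real_ring M
  for M :: "(real, 'a) module" (structure) +
  fixes N :: "'a \<Rightarrow> real" and star :: "'a \<Rightarrow> 'a"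
  assumes norm_nonneg: "x \<in> carrier M \<Longrightarrow> 0 \<le> N x"
    and norm_eq_zero: "x \<in> carrier M \<Longrightarrow> N x = 0 \<longleftrightarrow> x = \<zero>\<^bsub>M\<^esub>"
    and norm_triangle: "\<lbrakk>x \<in> carrier M; y \<in> carrier M\<rbrakk> \<Longrightarrow> N (x \<oplus>\<^bsub>M\<^esub> y) \<le> N x + N y"
    and norm_smult: "x \<in> carrier M \<Longrightarrow> N (r \<odot>\<^bsub>M\<^esub> x) = \<bar>r\<bar> * N x"
    and norm_mult: "\<lbrakk>x \<in> carrier M; y \<in> carrier M\<rbrakk> \<Longrightarrow> N (x \<otimes>\<^bsub>M\<^esub> y) \<le> N x * N y"
    and complete: "mcomplete_of (norm_metric M N)"
    and star_closed: "x \<in> carrier M \<Longrightarrow> star x \<in> carrier M"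
    and star_star: "x \<in> carrier M \<Longrightarrow> star (star x) = x"
    and star_add: "\<lbrakk>x \<in> carrier M; y \<in> carrier M\<rbrakk> \<Longrightarrow> star (x \<oplus>\<^bsub>M\<^esub> y) = star x \<oplus>\<^bsub>M\<^esub> star y"
    and star_smult: "x \<in> carrier M \<Longrightarrow> star (r \<odot>\<^bsub>M\<^esub> x) = r \<odot>\<^bsub>M\<^esub> star x"
    and star_mult: "\<lbrakk>x \<in> carrier M; y \<in> carrier M\<rbrakk> \<Longrightarrow> star (x \<otimes>\<^bsub>M\<^esub> y) = star y \<otimes>\<^bsub>M\<^esub> star x"
    and cstar_identity: "x \<in> carrier M \<Longrightarrow> N (star x \<otimes>\<^bsub>M\<^esub> x) = (N x)\<^sup>2"
    and one_plus_unit: "x \<in> carrier M \<Longrightarrow> \<one>\<^bsub>M\<^esub> \<oplus>\<^bsub>M\<^esub> star x \<otimes>\<^bsub>M\<^esub> x \<in> Units M"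

definition cstar_generated ::
    "(real, 'a) module \<Rightarrow> ('a \<Rightarrow> real) \<Rightarrow> ('a \<Rightarrow> 'a) \<Rightarrow> 'a set \<Rightarrow> 'a set" where
  "cstar_generated M N star G = \<Inter>{B. submodule B real_ring M \<and> subring B M \<and>
     star ` B \<subseteq> B \<and> closedin (mtopology_of (norm_metric M N)) B \<and> G \<subseteq> B}"

definition characters :: "(real, 'a) module \<Rightarrow> ('a \<Rightarrow> real) set" where
  "characters M = {h \<in> linear_functionals M. h \<in> ring_hom M real_ring}"

abbreviation cont_metric :: "'y::topological_space set \<Rightarrow> ('y \<Rightarrow> real) metric" where
  "cont_metric Y \<equiv> cfunspace (top_of_set Y) euclidean_metric"

text \<open>The real algebra of bounded continuous functions; these are all continuous ones when \<open>Y\<close> is compact.\<close>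

definition cont_alg :: "'y::topological_space set \<Rightarrow> (real, 'y \<Rightarrow> real) module" where
  "cont_alg Y = \<lparr>carrier = mspace (cont_metric Y),
     mult = (\<lambda>f g. \<lambda>y\<in>Y. f y * g y), one = (\<lambda>y\<in>Y. 1),
     zero = (\<lambda>y\<in>Y. 0), add = (\<lambda>f g. \<lambda>y\<in>Y. f y + g y),
     smult = (\<lambda>r f. \<lambda>y\<in>Y. r * f y)\<rparr>"

definition sup_norm :: "'y::topological_space set \<Rightarrow> ('y \<Rightarrow> real) \<Rightarrow> real" where
  "sup_norm Y f = mdist (cont_metric Y) f (\<lambda>y\<in>Y. 0)"


section \<open>Free order unit modules\<close>

text \<open>
  The product that defines the multiplicative domain is the pointwise product of the functions
  \<open>\<phi> \<mapsto> \<phi> a\<close> on a compact order determining set \<open>X\<close> of states, which is part of the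
  structure. It cannot be taken on the set of all states: these functions are affine there, and
  the square of an affine function on a convex set is affine only if the function is constant,
  so the multiplicative domain would always consist of the multiples of \<open>u\<close>. Nor can \<open>X\<close> be
  reconstructed from the order unit space: \<open>\<C>\<^sub>a\<^sub>f\<^sub>f([0,1] \<times> [0,1])\<close> is isomorphic to
  \<open>C([0,1] \<uplus> [0,1])\<close>, and its order unit automorphism that reflects one of the two intervals
  does not preserve the functions of \<open>y\<close>.
\<close>

locale order_unit_module_data =
  fixes V :: "(real, 'a) module" (structure)
    and P :: "'a set" and u :: 'a
    and X :: "('a \<Rightarrow> real) set"
    and g :: "'m::finite \<Rightarrow> 'a"
    and Y :: "(real ^ 'm) set"
begin

definition kadison :: "'a \<Rightarrow> ('a \<Rightarrow> real) \<Rightarrow> real" where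
  "kadison a = (\<lambda>\<phi>\<in>X. \<phi> a)"

definition mult_dom :: "'a set" where
  "mult_dom = {z \<in> carrier V. \<forall>a\<in>carrier V.
     (\<lambda>\<phi>\<in>X. kadison z \<phi> * kadison a \<phi>) \<in> kadison ` carrier V}"

definition kprod :: "'a \<Rightarrow> 'a \<Rightarrow> 'a" where
  "kprod z a = inv_into (carrier V) kadison (\<lambda>\<phi>\<in>X. kadison z \<phi> * kadison a \<phi>)"

definition dom_alg :: "(real, 'a) module" where
  "dom_alg = \<lparr>carrier = mult_dom, mult = kprod, one = u, zero = \<zero>, add = (\<oplus>), smult = (\<odot>)\<rparr>"

definition dom_module :: "('a, 'a) module" where
  "dom_module = \<lparr>carrier = carrier V, mult = undefined, one = undefined,
     zero = \<zero>, add = (\<oplus>), smult = kprod\<rparr>"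

definition char_map :: "('a \<Rightarrow> real) \<Rightarrow> real ^ 'm" where
  "char_map h = (\<chi> i. h (g i))"

text \<open>The identification of the multiplicative domain with \<open>C(Y)\<close>.\<close>

definition gelfand :: "'a \<Rightarrow> real ^ 'm \<Rightarrow> real" where
  "gelfand z = (\<lambda>y\<in>Y. inv_into (characters dom_alg) char_map y z)"

definition fibre_ideal :: "real ^ 'm \<Rightarrow> 'a set" where
  "fibre_ideal y = closed_order_ideal V P u {z \<in> mult_dom. gelfand z y = 0}"

definition fibre_class :: "real ^ 'm \<Rightarrow> 'a \<Rightarrow> 'a set" where
  "fibre_class y a = fibre_ideal y +> a"

definition fibre_space :: "real ^ 'm \<Rightarrow> (real, 'a set) module" where
  "fibre_space y = quotient_space V (fibre_ideal y)"

definition fibre_pos :: "real ^ 'm \<Rightarrow> 'a set set" where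
  "fibre_pos y = fibre_class y ` P"

definition fibre_norm :: "real ^ 'm \<Rightarrow> 'a set \<Rightarrow> real" where
  "fibre_norm y = ou_norm (fibre_space y) (fibre_pos y) (fibre_class y u)"

end

locale free_order_unit_module = aou_space V P u + order_unit_module_data V P u X g Y
  for V :: "(real, 'a) module" (structure)
    and P :: "'a set" and u :: 'a
    and X :: "('a \<Rightarrow> real) set"
    and g :: "'m::finite \<Rightarrow> 'a"
    and Y :: "(real ^ 'm) set" +
  fixes n :: nat
  assumes X_states: "X \<subseteq> states V P u"
    and X_compact: "compactin (weak_star V) X"
    and X_order_determining: "\<lbrakk>a \<in> carrier V; \<And>\<phi>. \<phi> \<in> X \<Longrightarrow> 0 \<le> \<phi> a\<rbrakk> \<Longrightarrow> a \<in> P"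
    and dom_module: "Module.module dom_alg dom_module"
    and dom_cstar: "comm_real_cstar_algebra dom_alg (ou_norm V P u) (\<lambda>z. z)"
    and gen_closed: "range g \<subseteq> mult_dom"
    and generated: "cstar_generated dom_alg (ou_norm V P u) (\<lambda>z. z) (range g) = mult_dom"
    and char_embedding:
      "embedding_map (subtopology (weak_star dom_alg) (characters dom_alg)) euclidean char_map"
    and char_image: "char_map ` characters dom_alg = Y"
    and Y_compact: "compact Y"
    and gelfand_iso: "gelfand \<in> ring_iso dom_alg (cont_alg Y)"
    and gelfand_smult: "z \<in> mult_dom \<Longrightarrow> gelfand (r \<odot> z) = r \<odot>\<^bsub>cont_alg Y\<^esub> gelfand z"
    and gelfand_isometric: "z \<in> mult_dom \<Longrightarrow> sup_norm Y (gelfand z) = ou_norm V P u z"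
    and free_of_rank:
      "\<exists>e. free_basis dom_alg dom_module {..n} e \<and> e 0 = u \<and>
         homeomorphic_map (mtopology_of (norm_metric V (ou_norm V P u)))
           (product_topology (\<lambda>_. mtopology_of (cont_metric Y)) {..n})
           (\<lambda>a. \<lambda>i\<in>{..n}. gelfand (coordinates dom_alg dom_module {..n} e a i))"
    and fibre_aou: "y \<in> Y \<Longrightarrow> aou_space (fibre_space y) (fibre_pos y) (fibre_class y u)"
    and fibre_dim: "y \<in> Y \<Longrightarrow> has_dimension (fibre_space y) (n + 1)"
    and pos_iff_fibrewise:
      "a \<in> carrier V \<Longrightarrow> a \<in> P \<longleftrightarrow> (\<forall>y\<in>Y. fibre_class y a \<in> fibre_pos y)"
    and fibre_sequences:
      "\<lbrakk>y0 \<in> Y; \<And>k. ys k \<in> Y; ys \<longlonglongrightarrow> y0; \<And>k. v k \<in> fibre_pos (ys k);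
        \<And>k. fibre_norm (ys k) (v k) \<le> B\<rbrakk> \<Longrightarrow>
       \<exists>\<sigma> :: nat \<Rightarrow> nat. strict_mono \<sigma> \<and>
         (\<exists>v0\<in>fibre_pos y0. \<exists>a\<in>carrier V. fibre_class y0 a = v0 \<and>
           (\<lambda>j. fibre_norm (ys (\<sigma> j))
              (v (\<sigma> j) \<ominus>\<^bsub>fibre_space (ys (\<sigma> j))\<^esub> fibre_class (ys (\<sigma> j)) a)) \<longlonglongrightarrow> 0)"


section \<open>Partially convex sets\<close>

definition fibre :: "('x \<times> 'y) set \<Rightarrow> 'y \<Rightarrow> 'x set" where
  "fibre K y = {x. (x, y) \<in> K}"

definition regular_partially_convex :: "((real ^ 'n) \<times> (real ^ 'm)) set \<Rightarrow> bool" where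
  "regular_partially_convex K \<longleftrightarrow> closed K \<and>
     (\<forall>y\<in>snd ` K. convex (fibre K y) \<and> interior (fibre K y) \<noteq> {}) \<and>
     (\<forall>y\<in>snd ` K. \<forall>ys. (\<forall>k::nat. ys k \<in> snd ` K) \<and> ys \<longlonglongrightarrow> y \<longrightarrow>
        (\<forall>x\<in>interior (fibre K y).
           \<exists>xs. (\<forall>k. xs k \<in> interior (fibre K (ys k))) \<and> xs \<longlonglongrightarrow> x))"

definition affine_fun_on :: "'x::real_vector set \<Rightarrow> ('x \<Rightarrow> real) \<Rightarrow> bool" where
  "affine_fun_on S f \<longleftrightarrow> (\<forall>x\<in>S. \<forall>x'\<in>S. \<forall>t\<in>{0..1}.
     f ((1 - t) *\<^sub>R x + t *\<^sub>R x') = (1 - t) * f x + t * f x')"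

definition Caff :: "((real ^ 'n) \<times> (real ^ 'm)) set
    \<Rightarrow> (real, (real ^ 'n) \<times> (real ^ 'm) \<Rightarrow> real) module" where
  "Caff K = \<lparr>carrier = {f \<in> extensional K. continuous_on K f \<and>
       (\<forall>y\<in>snd ` K. affine_fun_on (fibre K y) (\<lambda>x. f (x, y)))},
     mult = undefined, one = undefined,
     zero = (\<lambda>p\<in>K. 0), add = (\<lambda>f g. \<lambda>p\<in>K. f p + g p),
     smult = (\<lambda>r f. \<lambda>p\<in>K. r * f p)\<rparr>"

definition Caff_pos :: "((real ^ 'n) \<times> (real ^ 'm)) set
    \<Rightarrow> ((real ^ 'n) \<times> (real ^ 'm) \<Rightarrow> real) set" where
  "Caff_pos K = {f \<in> carrier (Caff K). \<forall>p\<in>K. 0 \<le> f p}"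

definition evaluations :: "((real ^ 'n) \<times> (real ^ 'm)) set
    \<Rightarrow> (((real ^ 'n) \<times> (real ^ 'm) \<Rightarrow> real) \<Rightarrow> real) set" where
  "evaluations K = (\<lambda>p. \<lambda>f\<in>carrier (Caff K). f p) ` K"

text \<open>The embedding of \<open>C(\<pi>\<^sub>2(K))\<close> as functions of \<open>y\<close>.\<close>

definition pullback :: "((real ^ 'n) \<times> (real ^ 'm)) set
    \<Rightarrow> (real ^ 'm \<Rightarrow> real) \<Rightarrow> (real ^ 'n) \<times> (real ^ 'm) \<Rightarrow> real" where
  "pullback K f = (\<lambda>p\<in>K. f (snd p))"

definition coordinate_gens :: "((real ^ 'n) \<times> (real ^ 'm)) set
    \<Rightarrow> 'm \<Rightarrow> (real ^ 'n) \<times> (real ^ 'm) \<Rightarrow> real" where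
  "coordinate_gens K i = pullback K (\<lambda>y. y $ i)"

end

theory Submission
  imports Defs
begin

text \<open>
  Let \<open>K\<close> be a compact regular partially convex set and \<open>Y\<close> its projection. The space
  \<open>\<C>\<^sub>a\<^sub>f\<^sub>f(K)\<close> should be thought of as the sections of a bundle over \<open>Y\<close> whose fibre at \<open>y\<close> is the
  \<open>(n + 1)\<close>-dimensional space of affine functions on \<open>K\<^sub>y\<close>. The axioms then say that the bundle is
  trivial, with frame \<open>1, x\<^sub>1, \<dots>, x\<^sub>n\<close>, and that order and norm are compatible with passing to a
  fibre. Two consequences of lower hemicontinuity carry the proof.

  The first is that an interior point \<open>x\<close> of \<open>K\<^sub>y\<close> is the centre of a ball that is contained in all
  nearby fibres (\<open>fibres_contain_common_ball\<close>). The coefficients of an affine function are a fixed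
  linear expression in its values at \<open>n + 1\<close> points of such a ball, so the coefficients of
  \<open>a \<in> \<C>\<^sub>a\<^sub>f\<^sub>f(K)\<close> depend continuously on \<open>y\<close>. By compactness one radius works for all fibres, which
  bounds the coefficients by the norm of \<open>a\<close>. Hence \<open>1, x\<^sub>1, \<dots>, x\<^sub>n\<close> is a basis over \<open>C(Y)\<close>, with
  coordinates that form a homeomorphism onto \<open>C(Y)\<^sup>n\<^sup>+\<^sup>1\<close> (\<open>free_basis_gen\<close>,
  \<open>coordinates_homeomorphism\<close>). The same bound gives convergent subsequences of coefficients for
  bounded positive elements in a sequence of fibres (\<open>fibre_sequence_limit\<close>).

  The second is that the supremum over \<open>K\<^sub>y\<close> of a continuous function on \<open>K\<close> is continuous in \<open>y\<close>
  (\<open>continuous_on_fibre_sup\<close>). If a continuous function vanishes on \<open>K\<^sub>y\<close>, it is therefore dominated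
  by a continuous function on \<open>Y\<close> that vanishes at \<open>y\<close>. Applied to \<open>\<bar>a\<bar>\<close> this identifies the order
  ideal \<open>J\<^sub>y\<close> with the functions vanishing on \<open>K\<^sub>y\<close> (\<open>fibre_ideal_eq\<close>); applied to the negative
  part of \<open>a\<close> it shows that a function that is nonnegative on \<open>K\<^sub>y\<close> has a globally positive
  representative modulo \<open>J\<^sub>y\<close> (\<open>mem_fibre_pos_iff\<close>). So the quotient by \<open>J\<^sub>y\<close> is the space of affine
  functions on \<open>K\<^sub>y\<close> with its pointwise order and supremum norm.

  The multiplicative domain is \<open>C(Y)\<close> because an affine function with affine square is constant
  (\<open>mult_dom_fibrewise_constant\<close>). Its characters are the evaluations at points of \<open>Y\<close>
  (\<open>character_eq_ev_base\<close>), which makes the Gelfand transform inverse to the pullback, and the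
  coordinates of \<open>y\<close> generate it by the Stone--Weierstrass theorem.
\<close>

section \<open>Affine functions on convex bodies\<close>

lemma affine_fun_onD:
  assumes "affine_fun_on S f" "x \<in> S" "y \<in> S" "0 \<le> t" "t \<le> 1"
  shows "f ((1 - t) *\<^sub>R x + t *\<^sub>R y) = (1 - t) * f x + t * f y"
  using assms unfolding affine_fun_on_def by auto

text \<open>
  Affinity is an identity along segments with end points in \<open>S\<close>. It forces the difference quotients at the
  interior point \<open>a\<close> to be constant along rays, which extends \<open>f(a + v) - f(a)\<close> homogeneously
  to all \<open>v\<close>; midpoints of short vectors then give additivity.
\<close>

lemma affine_fun_on_imp_linear:
  fixes f :: "'x::real_normed_vector \<Rightarrow> real"
  assumes "0 < \<epsilon>" and ball: "cball a \<epsilon> \<subseteq> S" and f: "affine_fun_on S f"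
  obtains L where "linear L" "\<And>x. x \<in> S \<Longrightarrow> f x = f a + L (x - a)"
proof -
  have "a \<in> S"
    using \<open>0 < \<epsilon>\<close> ball by auto
  define G where "G v = f (a + v) - f a" for v
  have G_scale: "G (t *\<^sub>R v) = t * G v" if "a + v \<in> S" "0 \<le> t" "t \<le> 1" for t v
  proof -
    have "f ((1 - t) *\<^sub>R a + t *\<^sub>R (a + v)) = (1 - t) * f a + t * f (a + v)"
      using affine_fun_onD[OF f \<open>a \<in> S\<close> that] .
    moreover have "(1 - t) *\<^sub>R a + t *\<^sub>R (a + v) = a + t *\<^sub>R v"
      by (simp add: algebra_simps)
    ultimately show ?thesis
      by (simp add: G_def algebra_simps)
  qed
  have G_mid: "2 * G ((1/2) *\<^sub>R (v + w)) = G v + G w" if "a + v \<in> S" "a + w \<in> S" for v w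
  proof -
    have "f ((1 - 1/2) *\<^sub>R (a + v) + (1/2) *\<^sub>R (a + w)) = (1 - 1/2) * f (a + v) + 1/2 * f (a + w)"
      using affine_fun_onD[OF f that, of "1/2"] by simp
    moreover have "(1 - 1/2) *\<^sub>R (a + v) + (1/2) *\<^sub>R (a + w) = a + (1/2) *\<^sub>R (v + w)"
      using scaleR_half_double[of a] by (simp add: scaleR_add_right)
    ultimately have "f (a + (1/2) *\<^sub>R (v + w)) = (1 - 1/2) * f (a + v) + 1/2 * f (a + w)"
      by (simp only:)
    then show ?thesis
      unfolding G_def by (simp add: field_simps)
  qed
  \<comment> \<open>A step that keeps every direction \<open>v\<close>, however long, inside the ball.\<close>
  define s where "s v = \<epsilon> / (1 + norm v)" for v :: 'x
  have s_pos: "0 < s v" for v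
    using \<open>0 < \<epsilon>\<close> by (simp add: s_def add_pos_nonneg)
  have in_S: "a + t *\<^sub>R v \<in> S" if "0 \<le> t" "t \<le> s v" for t v
  proof -
    have "t * norm v \<le> s v * norm v"
      using that by (simp add: mult_right_mono)
    also have "\<dots> \<le> \<epsilon>"
      using \<open>0 < \<epsilon>\<close> by (simp add: s_def divide_le_eq add_pos_nonneg)
    finally show ?thesis
      using ball that by (auto simp: dist_norm)
  qed
  define L where "L v = G (s v *\<^sub>R v) / s v" for v
  have quot: "G (t *\<^sub>R v) / t = G (r *\<^sub>R v) / r"
    if "0 < t" "t \<le> r" "a + r *\<^sub>R v \<in> S" for t r v
    using G_scale[of "r *\<^sub>R v" "t / r"] that by (simp add: field_simps)
  \<comment> \<open>The difference quotient does not depend on the step, so every admissible step computes \<open>L\<close>.\<close>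
  have L_eq: "G (t *\<^sub>R v) = t * L v" if "0 < t" "a + t *\<^sub>R v \<in> S" for t v
  proof (cases "t \<le> s v")
    case True
    then have "G (t *\<^sub>R v) / t = L v"
      using quot[of t "s v" v] in_S[of "s v" v] s_pos[of v] that by (simp add: L_def)
    then show ?thesis
      using that by (simp add: field_simps)
  next
    case False
    then have "G (t *\<^sub>R v) / t = L v"
      using quot[of "s v" t v] s_pos[of v] that by (simp add: L_def)
    then show ?thesis
      using that by (simp add: field_simps)
  qed
  have L_scale: "L (c *\<^sub>R v) = c * L v" if "0 < c" for c v
  proof -
    have "a + (s (c *\<^sub>R v) * c) *\<^sub>R v \<in> S"
      using in_S[of "s (c *\<^sub>R v)" "c *\<^sub>R v"] s_pos[of "c *\<^sub>R v"] by simp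
    then have "G ((s (c *\<^sub>R v) * c) *\<^sub>R v) = s (c *\<^sub>R v) * c * L v"
      using L_eq[of "s (c *\<^sub>R v) * c" v] s_pos[of "c *\<^sub>R v"] \<open>0 < c\<close> by simp
    then show ?thesis
      using s_pos[of "c *\<^sub>R v"] by (simp add: L_def)
  qed
  have L_add: "L (v + w) = L v + L w" for v w
  proof -
    define r where "r = min (s (v + w)) (min (s v) (s w) / 2)"
    have r: "0 < r" "r \<le> s (v + w)" "2 * r \<le> s v" "2 * r \<le> s w"
      using s_pos[of "v + w"] s_pos[of v] s_pos[of w] by (auto simp: r_def min_def)
    have "2 * G ((1/2) *\<^sub>R ((2 * r) *\<^sub>R v + (2 * r) *\<^sub>R w)) = G ((2 * r) *\<^sub>R v) + G ((2 * r) *\<^sub>R w)"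
      using G_mid r in_S by simp
    also have "(1/2) *\<^sub>R ((2 * r) *\<^sub>R v + (2 * r) *\<^sub>R w) = r *\<^sub>R (v + w)"
      by (simp add: algebra_simps)
    finally have "r * L (v + w) = r * (L v + L w)"
      using L_eq[of r "v + w"] L_eq[of "2 * r" v] L_eq[of "2 * r" w] r in_S
      by (simp add: distrib_left)
    then show ?thesis
      using \<open>0 < r\<close> by simp
  qed
  have L_0: "L 0 = 0"
    using L_add[of 0 0] by simp
  have L_minus: "L (- v) = - L v" for v
    using L_add[of v "- v"] L_0 by simp
  have "linear L"
  proof (rule linearI)
    show "L (c *\<^sub>R v) = c *\<^sub>R L v" for c v
    proof (cases "c = 0 \<or> 0 < c")
      case True
      then show ?thesis
        using L_0 L_scale by auto
    next
      case False
      then show ?thesis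
        using L_scale[of "- c" v] L_minus[of "- c *\<^sub>R v"] by (simp add: L_minus)
    qed
  qed (rule L_add)
  moreover have "f x = f a + L (x - a)" if "x \<in> S" for x
    using L_eq[of 1 "x - a"] that by (simp add: G_def)
  ultimately show ?thesis
    using that by blast
qed

text \<open>
  Affine functions on \<open>\<real>\<^sup>n\<close> are handled by their \<open>n + 1\<close> coefficients with respect to the constant
  function and the coordinate functions, indexed by \<open>{..n}\<close>.
\<close>

definition coord :: "nat \<Rightarrow> 'n::finite" where
  "coord = (SOME h. bij_betw h {..<CARD('n)} UNIV)"

lemma bij_betw_coord: "bij_betw (coord :: nat \<Rightarrow> 'n::finite) {..<CARD('n)} UNIV"
proof -
  have "\<exists>h. bij_betw h {..<CARD('n)} (UNIV :: 'n set)"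
    using ex_bij_betw_nat_finite[of "UNIV :: 'n set"] by (simp add: lessThan_atLeast0)
  then show ?thesis
    unfolding coord_def by (rule someI_ex)
qed

definition affine_gen :: "nat \<Rightarrow> real ^ 'n \<Rightarrow> real" where
  "affine_gen i x = (case i of 0 \<Rightarrow> 1 | Suc j \<Rightarrow> x $ coord j)"

definition affine_comb :: "(nat \<Rightarrow> real) \<Rightarrow> real ^ 'n \<Rightarrow> real" where
  "affine_comb k x = (\<Sum>i\<le>CARD('n). k i * affine_gen i x)"

text \<open>The coefficients are read off from the values at \<open>a\<close> and at the points \<open>a + \<epsilon> e\<^sub>j\<close>.\<close>

definition affine_coeff :: "real ^ 'n \<Rightarrow> real \<Rightarrow> (real ^ 'n \<Rightarrow> real) \<Rightarrow> nat \<Rightarrow> real" where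
  "affine_coeff a \<epsilon> f i = (case i of
     0 \<Rightarrow> f a - (\<Sum>j<CARD('n). (f (a + \<epsilon> *\<^sub>R axis (coord j) 1) - f a) / \<epsilon> * a $ coord j)
   | Suc j \<Rightarrow> (f (a + \<epsilon> *\<^sub>R axis (coord j) 1) - f a) / \<epsilon>)"

lemma affine_comb_altdef:
  "affine_comb k (x :: real ^ 'n) = k 0 + (\<Sum>j<CARD('n). k (Suc j) * x $ coord j)"
proof -
  have "affine_comb k x = (\<Sum>i<Suc CARD('n). k i * affine_gen i x)"
    by (simp add: affine_comb_def lessThan_Suc_atMost)
  also have "\<dots> = k 0 + (\<Sum>j<CARD('n). k (Suc j) * x $ coord j)"
    by (subst sum.lessThan_Suc_shift) (simp add: affine_gen_def)
  finally show ?thesis .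
qed

lemma affine_fun_on_affine_comb: "affine_fun_on S (affine_comb k)"
proof -
  have "affine_comb k ((1 - t) *\<^sub>R x + t *\<^sub>R y) = (1 - t) * affine_comb k x + t * affine_comb k y"
    for x y :: "real ^ 'n" and t
  proof -
    have "affine_comb k ((1 - t) *\<^sub>R x + t *\<^sub>R y) = (1 - t) * k 0 + t * k 0
        + (\<Sum>j<CARD('n). (1 - t) * (k (Suc j) * x $ coord j) + t * (k (Suc j) * y $ coord j))"
      by (simp add: affine_comb_altdef algebra_simps)
    also have "\<dots> = (1 - t) * affine_comb k x + t * affine_comb k y"
      by (simp only: sum.distrib sum_distrib_left[symmetric] affine_comb_altdef distrib_left)
    finally show ?thesis .
  qed
  then show ?thesis
    unfolding affine_fun_on_def by blast
qed

lemma sum_coord: "(\<Sum>j<CARD('n). h (coord j)) = (\<Sum>l\<in>UNIV. h (l :: 'n::finite))"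
  using sum.reindex_bij_betw[OF bij_betw_coord, of h] by simp

text \<open>
  On a set that contains a ball, this and the following lemma say that an affine function has
  exactly one representation by coefficients, computed from its values at finitely many points of
  the ball. The explicit formula is the reason why coefficients are continuous in a parameter as
  long as one ball serves for all nearby parameters.
\<close>

lemma affine_comb_affine_coeff:
  fixes S :: "(real ^ 'n) set"
  assumes "0 < \<epsilon>" "cball a \<epsilon> \<subseteq> S" "affine_fun_on S f" "x \<in> S"
  shows "affine_comb (affine_coeff a \<epsilon> f) x = f x"
proof -
  obtain L where L: "linear L" "\<And>x. x \<in> S \<Longrightarrow> f x = f a + L (x - a)"
    using affine_fun_on_imp_linear[OF assms(1-3)] by blast
  have L_axis: "(f (a + \<epsilon> *\<^sub>R axis l 1) - f a) / \<epsilon> = L (axis l 1)" for l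
  proof -
    have "a + \<epsilon> *\<^sub>R axis l 1 \<in> S"
      using assms(1,2) by (auto simp: dist_norm)
    then show ?thesis
      using L(2)[of "a + \<epsilon> *\<^sub>R axis l 1"] \<open>0 < \<epsilon>\<close> by (simp add: linear_scale[OF L(1)])
  qed
  have "L (x - a) = (\<Sum>l\<in>UNIV. (x - a) $ l * L (axis l 1))"
  proof -
    have "x - a = (\<Sum>l\<in>UNIV. (x - a) $ l *\<^sub>R axis l 1)"
      using basis_expansion[of "x - a"] by (simp add: scalar_mult_eq_scaleR)
    then have "L (x - a) = L (\<Sum>l\<in>UNIV. (x - a) $ l *\<^sub>R axis l 1)"
      by (rule arg_cong)
    then show ?thesis
      by (simp add: linear_sum[OF L(1)] linear_scale[OF L(1)])
  qed
  also have "\<dots> = (\<Sum>l\<in>UNIV. L (axis l 1) * x $ l) - (\<Sum>l\<in>UNIV. L (axis l 1) * a $ l)"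
    by (simp add: algebra_simps sum_subtractf)
  finally show ?thesis
    using L(2)[OF \<open>x \<in> S\<close>]
      sum_coord[of "\<lambda>l. L (axis l 1) * x $ l"] sum_coord[of "\<lambda>l. L (axis l 1) * a $ l"]
    by (simp add: affine_comb_altdef affine_coeff_def L_axis)
qed

lemma affine_coeff_affine_comb:
  fixes a :: "real ^ 'n"
  assumes "0 < \<epsilon>" "cball a \<epsilon> \<subseteq> S" and f: "\<And>x. x \<in> S \<Longrightarrow> f x = affine_comb k x"
    and "i \<le> CARD('n)"
  shows "affine_coeff a \<epsilon> f i = k i"
proof -
  have quot: "(f (a + \<epsilon> *\<^sub>R axis (coord j) 1) - f a) / \<epsilon> = k (Suc j)" if "j < CARD('n)" for j
  proof -
    have mem: "a + \<epsilon> *\<^sub>R axis (coord j) 1 \<in> S" "a \<in> S"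
      using assms(1,2) by (auto simp: dist_norm)
    have ax: "axis (coord j) 1 $ (coord j' :: 'n) = (if j' = j then 1 else (0::real))" if "j' < CARD('n)" for j'
      using bij_betw_coord \<open>j < CARD('n)\<close> that unfolding axis_def bij_betw_def inj_on_def by auto
    have "f (a + \<epsilon> *\<^sub>R axis (coord j) 1) - f a
        = (\<Sum>j'<CARD('n). k (Suc j') * (\<epsilon> * axis (coord j) 1 $ (coord j' :: 'n)))"
      using f[OF mem(1)] f[OF mem(2)]
      by (simp add: affine_comb_altdef algebra_simps sum.distrib)
    also have "\<dots> = (\<Sum>j'<CARD('n). if j' = j then k (Suc j) * \<epsilon> else 0)"
      by (rule sum.cong) (auto simp: ax)
    also have "\<dots> = k (Suc j) * \<epsilon>"
      using that by simp
    finally show ?thesis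
      using \<open>0 < \<epsilon>\<close> by (simp add: field_simps)
  qed
  have "a \<in> S"
    using assms(1,2) by auto
  show ?thesis
  proof (cases i)
    case 0
    then show ?thesis
      using f[OF \<open>a \<in> S\<close>] quot by (simp add: affine_coeff_def affine_comb_altdef)
  next
    case (Suc j)
    then show ?thesis
      using quot[of j] \<open>i \<le> CARD('n)\<close> by (simp add: affine_coeff_def)
  qed
qed

text \<open>
  The constant depends only on the radius of the ball and on a bound for its centre, so it is the
  same for all fibres of a bounded set that contain balls of one radius.
\<close>

lemma abs_affine_coeff_le:
  fixes a :: "real ^ 'n"
  assumes "0 < \<epsilon>" and bd: "\<And>x. x \<in> cball a \<epsilon> \<Longrightarrow> \<bar>f x\<bar> \<le> r" and R: "norm a \<le> R"
  shows "\<bar>affine_coeff a \<epsilon> f i\<bar> \<le> (1 + 2 / \<epsilon> * (1 + real CARD('n) * R)) * r"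
proof -
  have r: "\<bar>f a\<bar> \<le> r" "0 \<le> r" "0 \<le> R"
    using bd[of a] \<open>0 < \<epsilon>\<close> order.trans[OF norm_ge_zero R] by auto
  have quot: "\<bar>(f (a + \<epsilon> *\<^sub>R axis (coord j) 1) - f a) / \<epsilon>\<bar> \<le> 2 / \<epsilon> * r" for j
  proof -
    have "\<bar>f (a + \<epsilon> *\<^sub>R axis (coord j) 1)\<bar> \<le> r"
      using bd[of "a + \<epsilon> *\<^sub>R axis (coord j) 1"] \<open>0 < \<epsilon>\<close> by (simp add: dist_norm)
    then have "\<bar>f (a + \<epsilon> *\<^sub>R axis (coord j) 1) - f a\<bar> \<le> 2 * r"
      using r by linarith
    then show ?thesis
      using \<open>0 < \<epsilon>\<close> by (simp add: abs_divide divide_right_mono)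
  qed
  show ?thesis
  proof (cases i)
    case (Suc j)
    have "2 / \<epsilon> * r \<le> (1 + 2 / \<epsilon> * (1 + real CARD('n) * R)) * r"
      using r \<open>0 < \<epsilon>\<close> by (simp add: algebra_simps)
    then show ?thesis
      using Suc quot[of j] by (simp add: affine_coeff_def)
  next
    case 0
    have "\<bar>(f (a + \<epsilon> *\<^sub>R axis (coord j) 1) - f a) / \<epsilon> * a $ coord j\<bar> \<le> 2 / \<epsilon> * r * R" for j
      using quot[of j] component_le_norm_cart[of a "coord j"] R r \<open>0 < \<epsilon>\<close>
      unfolding abs_mult by (intro mult_mono) auto
    then have "\<bar>\<Sum>j<CARD('n). (f (a + \<epsilon> *\<^sub>R axis (coord j) 1) - f a) / \<epsilon> * a $ coord j\<bar>
        \<le> real CARD('n) * (2 / \<epsilon> * r * R)"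
      by (intro order.trans[OF sum_abs] order.trans[OF sum_bounded_above[where K = "2 / \<epsilon> * r * R"]]) auto
    then have "\<bar>affine_coeff a \<epsilon> f i\<bar> \<le> r + real CARD('n) * (2 / \<epsilon> * r * R)"
      using r(1) unfolding 0 affine_coeff_def by (simp add: abs_le_iff)
    also have "\<dots> \<le> (1 + 2 / \<epsilon> * (1 + real CARD('n) * R)) * r"
      using r \<open>0 < \<epsilon>\<close> by (simp add: algebra_simps)
    finally show ?thesis .
  qed
qed

section \<open>Uniform bounds and convergent subsequences\<close>

text \<open>
  The order unit norm of a space of functions on \<open>S\<close>. As the infimum is taken over positive
  numbers, it is 0 when \<open>S\<close> is empty, in agreement with the supremum metric.
\<close>

definition bound_norm :: "'x set \<Rightarrow> ('x \<Rightarrow> real) \<Rightarrow> real" where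
  "bound_norm S f = Inf {r. 0 < r \<and> (\<forall>p\<in>S. \<bar>f p\<bar> \<le> r)}"

lemma bound_norm_le:
  assumes "0 \<le> r" "\<And>p. p \<in> S \<Longrightarrow> \<bar>f p\<bar> \<le> r"
  shows "bound_norm S f \<le> r"
proof (rule field_le_epsilon)
  fix e :: real assume "0 < e"
  then show "bound_norm S f \<le> r + e"
    unfolding bound_norm_def using assms
    by (intro cInf_lower) (auto intro!: bdd_belowI[of _ 0] add_increasing2)
qed

lemma le_bound_norm:
  assumes "bounded (f ` S)" "p \<in> S"
  shows "\<bar>f p\<bar> \<le> bound_norm S f"
proof -
  obtain r where "0 < r" "\<And>p. p \<in> S \<Longrightarrow> \<bar>f p\<bar> \<le> r"
    using assms(1) unfolding bounded_pos by auto
  then show ?thesis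
    unfolding bound_norm_def using assms(2) by (intro cInf_greatest) auto
qed

lemma bound_norm_nonneg:
  assumes "bounded (f ` S)"
  shows "0 \<le> bound_norm S f"
proof -
  obtain r where "0 < r" "\<And>p. p \<in> S \<Longrightarrow> \<bar>f p\<bar> \<le> r"
    using assms unfolding bounded_pos by auto
  then show ?thesis
    unfolding bound_norm_def by (intro cInf_greatest) auto
qed

lemma bound_norm_le_iff:
  assumes "bounded (f ` S)" "0 \<le> r"
  shows "bound_norm S f \<le> r \<longleftrightarrow> (\<forall>p\<in>S. \<bar>f p\<bar> \<le> r)"
  using assms(2) by (auto intro: bound_norm_le order.trans[OF le_bound_norm[OF assms(1)]])

lemma bound_norm_cong: "(\<And>p. p \<in> S \<Longrightarrow> \<bar>f p\<bar> = \<bar>g p\<bar>) \<Longrightarrow> bound_norm S f = bound_norm S g"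
  by (simp add: bound_norm_def)

lemma cring_real_ring: "cring real_ring"
proof (rule cringI)
  show "abelian_group real_ring"
    by (rule abelian_groupI) (auto simp: real_ring_def intro: exI[of _ "- _"])
  show "comm_monoid real_ring"
    by (rule comm_monoidI) (auto simp: real_ring_def)
qed (auto simp: real_ring_def algebra_simps)

lemma real_ring_simps [simp]:
  "carrier real_ring = UNIV" "x \<oplus>\<^bsub>real_ring\<^esub> y = x + y" "x \<otimes>\<^bsub>real_ring\<^esub> y = x * y"
  "\<one>\<^bsub>real_ring\<^esub> = 1" "\<zero>\<^bsub>real_ring\<^esub> = 0"
  by (simp_all add: real_ring_def)

lemma mspace_cont_metric:
  assumes "compact S"
  shows "mspace (cont_metric S) = {f \<in> extensional S. continuous_on S f}"
proof -
  have "compactin (top_of_set S) (topspace (top_of_set S))"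
    using assms by (simp add: compactin_subtopology compactin_euclidean_iff)
  then show ?thesis
    using compactin_mspace_cfunspace[of "top_of_set S" "euclidean_metric :: real metric"] by auto
qed

lemma bounded_image_of_continuous: "compact S \<Longrightarrow> continuous_on S f \<Longrightarrow> bounded ((f :: _ \<Rightarrow> real) ` S)"
  by (intro compact_imp_bounded compact_continuous_image)

lemma mdist_cont_metric:
  assumes "compact S" "f \<in> mspace (cont_metric S)" "g \<in> mspace (cont_metric S)"
  shows "mdist (cont_metric S) f g = bound_norm S (\<lambda>p. f p - g p)"
proof (rule antisym)
  have "continuous_on S (\<lambda>p. f p - g p)"
    using assms unfolding mspace_cont_metric[OF assms(1)] by (intro continuous_intros) auto
  then have bdd: "bounded ((\<lambda>p. f p - g p) ` S)"
    using assms(1) by (rule bounded_image_of_continuous[rotated])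
  show "mdist (cont_metric S) f g \<le> bound_norm S (\<lambda>p. f p - g p)"
    using bound_norm_nonneg[OF bdd] le_bound_norm[OF bdd]
    by (intro mdist_cfunspace_le) (auto simp: dist_real_def)
  show "bound_norm S (\<lambda>p. f p - g p) \<le> mdist (cont_metric S) f g"
    using mdist_cfunspace_imp_mdist_le[OF assms(2,3) order_refl]
    by (intro bound_norm_le) (auto simp: dist_real_def)
qed

lemma sup_norm_eq_bound_norm:
  assumes "compact S" "f \<in> extensional S" "continuous_on S f"
  shows "sup_norm S f = bound_norm S f"
proof -
  have "f \<in> mspace (cont_metric S)" "(\<lambda>y\<in>S. 0) \<in> mspace (cont_metric S)"
    using assms(2,3) unfolding mspace_cont_metric[OF assms(1)] by auto
  then have "sup_norm S f = bound_norm S (\<lambda>p. f p - (\<lambda>y\<in>S. 0) p)"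
    unfolding sup_norm_def by (rule mdist_cont_metric[OF assms(1)])
  also have "\<dots> = bound_norm S f"
    by (rule bound_norm_cong) simp
  finally show ?thesis .
qed

lemma carrier_cont_alg: "compact S \<Longrightarrow> carrier (cont_alg S) = {f \<in> extensional S. continuous_on S f}"
  by (simp add: cont_alg_def mspace_cont_metric del: mspace_cfunspace)

lemma finite_family_convergent_subsequence:
  fixes x :: "'i \<Rightarrow> nat \<Rightarrow> real"
  assumes "finite I" "\<And>i. i \<in> I \<Longrightarrow> bounded (range (x i))"
  obtains \<sigma> l where "strict_mono \<sigma>" "\<And>i. i \<in> I \<Longrightarrow> (\<lambda>k. x i (\<sigma> k)) \<longlonglongrightarrow> l i"
proof -
  have "\<exists>\<sigma> l. strict_mono \<sigma> \<and> (\<forall>i\<in>I. (\<lambda>k. x i (\<sigma> k)) \<longlonglongrightarrow> l i)"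
    using assms
  proof (induction I rule: finite_induct)
    case empty
    then show ?case
      using strict_mono_id by blast
  next
    case (insert j I)
    have "\<exists>\<sigma> l. strict_mono \<sigma> \<and> (\<forall>i\<in>I. (\<lambda>k. x i (\<sigma> k)) \<longlonglongrightarrow> l i)"
      by (rule insert.IH) (simp add: insert.prems)
    then obtain \<sigma> l where \<sigma>: "strict_mono \<sigma>" and l: "\<forall>i\<in>I. (\<lambda>k. x i (\<sigma> k)) \<longlonglongrightarrow> l i"
      by blast
    have "bounded (range (\<lambda>k. x j (\<sigma> k)))"
      by (rule bounded_subset[OF insert.prems[of j]]) auto
    then obtain c \<tau> where \<tau>: "strict_mono \<tau>" and c: "((\<lambda>k. x j (\<sigma> k)) \<circ> \<tau>) \<longlonglongrightarrow> c"
      using bounded_imp_convergent_subsequence by blast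
    have "(\<lambda>k. x i ((\<sigma> \<circ> \<tau>) k)) \<longlonglongrightarrow> (l(j := c)) i" if "i \<in> insert j I" for i
    proof (cases "i = j")
      case True
      then show ?thesis
        using c by (simp add: o_def)
    next
      case False
      then have "i \<in> I"
        using that by simp
      then have "(\<lambda>k. x i (\<sigma> k)) \<longlonglongrightarrow> l i"
        using l by blast
      from LIMSEQ_subseq_LIMSEQ[OF this \<tau>] show ?thesis
        using False by (simp add: o_def)
    qed
    moreover have "strict_mono (\<sigma> \<circ> \<tau>)"
      using \<sigma> \<tau> by (rule strict_mono_o)
    ultimately show ?case
      by blast
  qed
  then show ?thesis
    using that by blast
qed

section \<open>Fibres of a compact regular partially convex set\<close>

locale compact_regular =
  fixes K :: "((real ^ 'n) \<times> (real ^ 'm)) set"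
  assumes compact_K: "compact K" and regular_K: "regular_partially_convex K"
begin

abbreviation Y :: "(real ^ 'm) set" where
  "Y \<equiv> snd ` K"

lemma mem_fibre_iff: "x \<in> fibre K y \<longleftrightarrow> (x, y) \<in> K"
  by (simp add: fibre_def)

lemma compact_Y: "compact Y"
  using compact_K by (intro compact_continuous_image continuous_intros)

lemma convex_fibre: "y \<in> Y \<Longrightarrow> convex (fibre K y)"
  using regular_K unfolding regular_partially_convex_def by blast

lemma interior_fibre_nonempty: "y \<in> Y \<Longrightarrow> interior (fibre K y) \<noteq> {}"
  using regular_K unfolding regular_partially_convex_def by blast

lemma interior_fibre_lhc:
  assumes "y \<in> Y" "\<And>k::nat. ys k \<in> Y" "ys \<longlonglongrightarrow> y" "x \<in> interior (fibre K y)"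
  obtains xs where "\<And>k. xs k \<in> interior (fibre K (ys k))" "xs \<longlonglongrightarrow> x"
  using regular_K assms unfolding regular_partially_convex_def by blast

lemma closed_fibre: "closed (fibre K y)"
proof -
  have "fibre K y = (\<lambda>x. (x, y)) -` K"
    by (auto simp: fibre_def)
  moreover have "closed ((\<lambda>x. (x, y)) -` K)"
    using compact_imp_closed[OF compact_K] by (intro closed_vimage continuous_intros)
  ultimately show ?thesis
    by simp
qed

lemma fibre_subset_closure_interior:
  assumes "y \<in> Y"
  shows "fibre K y \<subseteq> closure (interior (fibre K y))"
  using convex_closure_interior[OF convex_fibre interior_fibre_nonempty] assms closure_subset by blast

text \<open>
  Lower hemicontinuity moves single points, but convexity upgrades it to balls. If balls around \<open>x\<close>
  were not contained in the fibres over a sequence \<open>y\<^sub>k \<rightarrow> y\<close>, hyperplanes with unit normals \<open>a\<^sub>k\<close>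
  would bound these fibres close to \<open>x\<close>. For a limit \<open>a\<close> of the normals, the interior point
  \<open>x + r a\<close> of the fibre over \<open>y\<close> is a limit of points of the fibres over \<open>y\<^sub>k\<close>, and the bounds
  fail in the limit.
\<close>

lemma fibres_contain_common_ball:
  assumes y: "y \<in> Y" and x: "x \<in> interior (fibre K y)"
  obtains \<epsilon> d where "0 < \<epsilon>" "0 < d" "\<And>y'. y' \<in> Y \<Longrightarrow> dist y' y < d \<Longrightarrow> cball x \<epsilon> \<subseteq> fibre K y'"
proof -
  obtain r where r: "0 < r" "cball x r \<subseteq> interior (fibre K y)"
    using x open_interior open_contains_cball by blast
  \<comment> \<open>Halving the radius leaves the gap \<open>r/2\<close> that yields the contradiction.\<close>
  have "\<exists>d>0. \<forall>y'\<in>Y. dist y' y < d \<longrightarrow> cball x (r/2) \<subseteq> fibre K y'"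
  proof (rule ccontr)
    assume "\<not> ?thesis"
    then have "\<exists>y'\<in>Y. dist y' y < inverse (Suc k) \<and> \<not> cball x (r/2) \<subseteq> fibre K y'" for k
      by (metis inverse_positive_iff_positive of_nat_0_less_iff zero_less_Suc)
    then obtain ys where ys: "\<And>k. ys k \<in> Y" "\<And>k. dist (ys k) y < inverse (Suc k)"
        "\<And>k. \<not> cball x (r/2) \<subseteq> fibre K (ys k)"
      by metis
    have "norm (dist (ys k) y) \<le> inverse (real (Suc k))" for k
      using less_imp_le[OF ys(2)[of k]] by (simp only: real_norm_def abs_of_nonneg zero_le_dist)
    then have ys_lim: "ys \<longlonglongrightarrow> y"
      unfolding tendsto_dist_iff[of ys]
      by (intro Lim_null_comparison[OF _ LIMSEQ_inverse_real_of_nat] always_eventually allI)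
    \<comment> \<open>A point of the ball outside the fibre is cut off by a hyperplane with unit normal.\<close>
    have "\<exists>a. norm a = 1 \<and> (\<forall>x'\<in>fibre K (ys k). inner a x' \<le> inner a x + r/2)" for k
    proof -
      obtain z where z: "z \<in> cball x (r/2)" "z \<notin> fibre K (ys k)"
        using ys(3) by blast
      obtain a b where ab: "inner a z < b" "\<forall>x'\<in>fibre K (ys k). inner a x' > b"
        using separating_hyperplane_closed_point[OF convex_fibre closed_fibre z(2)] ys(1) by blast
      obtain x' where "x' \<in> fibre K (ys k)"
        using interior_fibre_nonempty[OF ys(1)] interior_subset by blast
      with ab have "a \<noteq> 0"
        by force
      define a' where "a' = - a /\<^sub>R norm a"
      have "inner a' x' \<le> inner a' x + r/2" if "x' \<in> fibre K (ys k)" for x'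
      proof -
        have "inner a' x' \<le> inner a' z"
          using ab that \<open>a \<noteq> 0\<close> by (fastforce simp: a'_def intro!: mult_left_mono)
        also have "\<dots> = inner a' x + inner a' (z - x)"
          by (simp add: inner_diff_right)
        also have "inner a' (z - x) \<le> norm a' * norm (z - x)"
          by (rule norm_cauchy_schwarz)
        also have "\<dots> \<le> r/2"
          using z(1) \<open>a \<noteq> 0\<close> by (simp add: a'_def dist_norm norm_minus_commute)
        finally show ?thesis
          by simp
      qed
      moreover have "norm a' = 1"
        using \<open>a \<noteq> 0\<close> by (simp add: a'_def)
      ultimately show ?thesis
        by blast
    qed
    then obtain a where a: "\<And>k. a k \<in> sphere 0 1"
        "\<And>k x'. x' \<in> fibre K (ys k) \<Longrightarrow> inner (a k) x' \<le> inner (a k) x + r/2"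
      by (metis dist_0_norm mem_sphere)
    obtain a0 \<sigma> where a0: "a0 \<in> sphere 0 1" "strict_mono (\<sigma> :: nat \<Rightarrow> nat)" "(a \<circ> \<sigma>) \<longlonglongrightarrow> a0"
      using compact_sphere[of 0 1] a(1) unfolding compact_def by meson
    have "x + r *\<^sub>R a0 \<in> interior (fibre K y)"
      using r a0(1) by (auto simp: dist_norm)
    then obtain xs where xs: "\<And>k. xs k \<in> interior (fibre K ((ys \<circ> \<sigma>) k))" "xs \<longlonglongrightarrow> x + r *\<^sub>R a0"
      using interior_fibre_lhc[OF y _ LIMSEQ_subseq_LIMSEQ[OF ys_lim a0(2)]] ys(1)
      by (metis comp_apply)
    have "inner a0 (x + r *\<^sub>R a0) \<le> inner a0 x + r/2"
    proof (rule LIMSEQ_le)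
      show "(\<lambda>k. inner ((a \<circ> \<sigma>) k) (xs k)) \<longlonglongrightarrow> inner a0 (x + r *\<^sub>R a0)"
        using a0(3) xs(2) by (rule tendsto_inner)
      show "(\<lambda>k. inner ((a \<circ> \<sigma>) k) x + r/2) \<longlonglongrightarrow> inner a0 x + r/2"
        using a0(3) by (intro tendsto_intros)
      have "inner ((a \<circ> \<sigma>) k) (xs k) \<le> inner ((a \<circ> \<sigma>) k) x + r/2" for k
        using a(2)[of "xs k" "\<sigma> k"] xs(1)[of k] interior_subset by fastforce
      then show "\<exists>N. \<forall>n\<ge>N. inner ((a \<circ> \<sigma>) n) (xs n) \<le> inner ((a \<circ> \<sigma>) n) x + r/2"
        by blast
    qed
    then show False
      using a0(1) r(1) by (simp add: inner_add_right dot_square_norm)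
  qed
  then show ?thesis
    using that[of "r/2"] \<open>0 < r\<close> by auto
qed

lemma fibres_contain_uniform_ball:
  obtains \<delta> where "0 < \<delta>" "\<And>y. y \<in> Y \<Longrightarrow> \<exists>x. cball x \<delta> \<subseteq> fibre K y"
proof -
  have "\<exists>\<delta>>0. \<forall>y\<in>Y. \<exists>x. cball x \<delta> \<subseteq> fibre K y"
  proof (rule ccontr)
    assume "\<not> ?thesis"
    then have "\<exists>y\<in>Y. \<forall>x. \<not> cball x (inverse (Suc k)) \<subseteq> fibre K y" for k
      by (metis inverse_positive_iff_positive of_nat_0_less_iff zero_less_Suc)
    then obtain ys where ys: "\<And>k. ys k \<in> Y" "\<And>k x. \<not> cball x (inverse (Suc k)) \<subseteq> fibre K (ys k)"
      by metis
    obtain y \<sigma> where y: "y \<in> Y" "strict_mono (\<sigma> :: nat \<Rightarrow> nat)" "(ys \<circ> \<sigma>) \<longlonglongrightarrow> y"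
      using compact_Y ys(1) unfolding compact_def by meson
    obtain x where x: "x \<in> interior (fibre K y)"
      using interior_fibre_nonempty y(1) by blast
    obtain \<epsilon> d where \<epsilon>: "0 < \<epsilon>" "0 < d"
        and ball: "\<And>y'. y' \<in> Y \<Longrightarrow> dist y' y < d \<Longrightarrow> cball x \<epsilon> \<subseteq> fibre K y'"
      using fibres_contain_common_ball[OF y(1) x] by blast
    have "\<forall>\<^sub>F k in sequentially. dist ((ys \<circ> \<sigma>) k) y < d"
      using y(3) \<epsilon>(2) by (rule tendstoD)
    moreover have "\<forall>\<^sub>F k in sequentially. inverse (real (Suc (\<sigma> k))) < \<epsilon>"
      using order_tendstoD(2)[OF LIMSEQ_subseq_LIMSEQ[OF LIMSEQ_inverse_real_of_nat y(2)] \<epsilon>(1)]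
      by (simp add: o_def)
    ultimately have "\<forall>\<^sub>F k in sequentially. dist ((ys \<circ> \<sigma>) k) y < d \<and> inverse (real (Suc (\<sigma> k))) < \<epsilon>"
      by (rule eventually_conj)
    then obtain k where k: "dist (ys (\<sigma> k)) y < d" "inverse (real (Suc (\<sigma> k))) < \<epsilon>"
      by (auto simp: eventually_sequentially)
    then have "cball x (inverse (real (Suc (\<sigma> k)))) \<subseteq> fibre K (ys (\<sigma> k))"
      using ball[OF ys(1) k(1)] by (auto intro: order_trans)
    then show False
      using ys(2) by blast
  qed
  then show ?thesis
    using that by blast
qed

text \<open>
  Functions of \<open>y\<close> alone that dominate a given function on \<open>K\<close> are the tool for passing from a
  single fibre to all of \<open>K\<close>; the smallest one is the fibrewise supremum.
\<close>

definition fibre_sup :: "((real ^ 'n) \<times> (real ^ 'm) \<Rightarrow> real) \<Rightarrow> real ^ 'm \<Rightarrow> real" where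
  "fibre_sup F y = (SUP x\<in>fibre K y. F (x, y))"

lemma fibre_sup_upper:
  assumes "continuous_on K F" "(x, y) \<in> K"
  shows "F (x, y) \<le> fibre_sup F y"
proof -
  have "bdd_above (F ` K)"
    using assms(1) compact_K by (intro bounded_imp_bdd_above compact_imp_bounded compact_continuous_image)
  then have "bdd_above ((\<lambda>x. F (x, y)) ` fibre K y)"
    by (rule bdd_above_mono) (auto simp: fibre_def)
  then show ?thesis
    unfolding fibre_sup_def using assms(2) by (intro cSUP_upper) (auto simp: fibre_def)
qed

lemma fibre_sup_attained:
  assumes "continuous_on K F" "y \<in> Y"
  obtains x where "(x, y) \<in> K" "fibre_sup F y = F (x, y)"
proof -
  have "bounded (fst ` K)"
    using compact_K by (intro compact_imp_bounded compact_continuous_image continuous_intros)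
  then have "bounded (fibre K y)"
    by (rule bounded_subset) (force simp: fibre_def)
  then have "compact (fibre K y)"
    using closed_fibre compact_eq_bounded_closed by blast
  moreover have "fibre K y \<noteq> {}"
    using assms(2) by (force simp: fibre_def)
  moreover have "continuous_on (fibre K y) (\<lambda>x. F (x, y))"
    by (rule continuous_on_compose2[OF assms(1)]) (auto intro!: continuous_intros simp: fibre_def)
  ultimately obtain x where x: "x \<in> fibre K y" "\<And>x'. x' \<in> fibre K y \<Longrightarrow> F (x', y) \<le> F (x, y)"
    using continuous_attains_sup by metis
  have "fibre_sup F y = F (x, y)"
    unfolding fibre_sup_def using x by (intro cSup_eq_maximum) auto
  then show ?thesis
    using that x(1) by (simp add: fibre_def)
qed

text \<open>
  Upper semicontinuity holds because \<open>K\<close> is compact: the set where the supremum is at least \<open>a\<close> is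
  the projection of a compact set. Lower semicontinuity is where hemicontinuity enters: a point of
  the fibre at which \<open>F\<close> exceeds \<open>a\<close> can be taken in the interior, and then it belongs to all
  nearby fibres.
\<close>

lemma continuous_on_fibre_sup:
  assumes F: "continuous_on K F"
  shows "continuous_on Y (fibre_sup F)"
proof -
  have "openin (top_of_set Y) {y \<in> Y. a < fibre_sup F y}" for a
    unfolding openin_contains_ball
  proof (intro conjI ballI)
    fix y assume "y \<in> {y \<in> Y. a < fibre_sup F y}"
    then have y: "y \<in> Y" "a < fibre_sup F y"
      by auto
    obtain x where x: "(x, y) \<in> K" "a < F (x, y)"
      using fibre_sup_attained[OF F y(1)] y(2) by metis
    have cont_x: "continuous_on (fibre K y) (\<lambda>x. F (x, y))"
      by (rule continuous_on_compose2[OF F]) (auto intro!: continuous_intros simp: fibre_def)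
    \<comment> \<open>Interior points of the fibre are dense in it, so the value is nearly attained in the interior.\<close>
    obtain x' where x': "x' \<in> interior (fibre K y)" "a < F (x', y)"
    proof -
      obtain d where d: "0 < d"
          "\<And>x'. x' \<in> fibre K y \<Longrightarrow> dist x' x < d \<Longrightarrow> dist (F (x', y)) (F (x, y)) < F (x, y) - a"
        using cont_x x unfolding continuous_on_iff by (metis diff_gt_0_iff_gt mem_fibre_iff)
      obtain x' where "x' \<in> interior (fibre K y)" "dist x' x < d"
        using fibre_subset_closure_interior[OF y(1)] x(1) d(1)
        unfolding closure_approachable subset_iff mem_fibre_iff by blast
      with d(2)[of x'] show ?thesis
        using that interior_subset by (fastforce simp: dist_real_def)
    qed
    obtain \<epsilon> d where \<epsilon>: "0 < \<epsilon>" "0 < d"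
        and ball: "\<And>y'. y' \<in> Y \<Longrightarrow> dist y' y < d \<Longrightarrow> cball x' \<epsilon> \<subseteq> fibre K y'"
      using fibres_contain_common_ball[OF y(1) x'(1)] by blast
    have near: "(x', y') \<in> K" if "y' \<in> Y" "dist y' y < d" for y'
    proof -
      have "x' \<in> cball x' \<epsilon>"
        using \<epsilon>(1) by simp
      then show ?thesis
        using ball[OF that] mem_fibre_iff by blast
    qed
    have "(\<lambda>y'. (x', y')) ` (Y \<inter> ball y d) \<subseteq> K"
      by (intro image_subsetI near) (auto simp: dist_commute)
    then have "continuous_on (Y \<inter> ball y d) (\<lambda>y'. F (x', y'))"
      by (intro continuous_on_compose2[OF F] continuous_intros)
    moreover have "y \<in> Y \<inter> ball y d"
      using y(1) \<epsilon>(2) by simp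
    moreover have "0 < F (x', y) - a"
      using x'(2) by simp
    ultimately obtain e where e: "0 < e"
        "\<And>y'. y' \<in> Y \<inter> ball y d \<Longrightarrow> dist y' y < e \<Longrightarrow> dist (F (x', y')) (F (x', y)) < F (x', y) - a"
      unfolding continuous_on_iff by meson
    have "ball y (min d e) \<inter> Y \<subseteq> {y \<in> Y. a < fibre_sup F y}"
    proof
      fix y' assume y': "y' \<in> ball y (min d e) \<inter> Y"
      then have "a < F (x', y')"
        using e(2)[of y'] by (auto simp: dist_commute dist_real_def abs_if split: if_splits)
      also have "\<dots> \<le> fibre_sup F y'"
        using fibre_sup_upper[OF F] near y' by (auto simp: dist_commute)
      finally show "y' \<in> {y \<in> Y. a < fibre_sup F y}"
        using y' by simp
    qed
    then show "\<exists>e>0. ball y e \<inter> Y \<subseteq> {y \<in> Y. a < fibre_sup F y}"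
      using \<epsilon>(2) e(1) by (intro exI[of _ "min d e"]) auto
  qed auto
  moreover have "openin (top_of_set Y) {y \<in> Y. fibre_sup F y < a}" for a
  proof -
    have "closed (K \<inter> F -` {a..})"
      using F compact_imp_closed[OF compact_K] by (intro continuous_closed_preimage) auto
    then have "compact (K \<inter> (K \<inter> F -` {a..}))"
      using compact_K by (rule compact_Int_closed[rotated])
    then have closed_image: "closed (snd ` (K \<inter> F -` {a..}))"
      by (intro compact_imp_closed compact_continuous_image continuous_intros) simp
    have "a \<le> fibre_sup F y \<longleftrightarrow> y \<in> snd ` (K \<inter> F -` {a..})" if y: "y \<in> Y" for y
    proof
      assume "a \<le> fibre_sup F y"
      moreover obtain x where "(x, y) \<in> K" "fibre_sup F y = F (x, y)"
        using fibre_sup_attained[OF F y] by blast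
      ultimately have "(x, y) \<in> K \<inter> F -` {a..}"
        by simp
      then show "y \<in> snd ` (K \<inter> F -` {a..})"
        by (rule rev_image_eqI) simp
    next
      assume "y \<in> snd ` (K \<inter> F -` {a..})"
      then obtain x where "(x, y) \<in> K" "a \<le> F (x, y)"
        by auto
      then show "a \<le> fibre_sup F y"
        using fibre_sup_upper[OF F, of x y] by linarith
    qed
    then have "{y \<in> Y. fibre_sup F y < a} = Y \<inter> - snd ` (K \<inter> F -` {a..})"
      unfolding not_le[symmetric] by blast
    then show ?thesis
      using openin_open_Int[OF open_Compl[OF closed_image]] by (simp only:)
  qed
  ultimately have "continuous_map (top_of_set Y) euclidean (fibre_sup F)"
    unfolding continuous_map_upper_lower_semicontinuous_lt by simp
  then show ?thesis
    by simp
qed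

section \<open>The order unit space of fibrewise affine functions\<close>

abbreviation A :: "(real, (real ^ 'n) \<times> (real ^ 'm) \<Rightarrow> real) module" where
  "A \<equiv> Caff K"

abbreviation P :: "((real ^ 'n) \<times> (real ^ 'm) \<Rightarrow> real) set" where
  "P \<equiv> Caff_pos K"

abbreviation u :: "(real ^ 'n) \<times> (real ^ 'm) \<Rightarrow> real" where
  "u \<equiv> \<lambda>p\<in>K. 1"

lemma Caff_ops:
  "\<zero>\<^bsub>A\<^esub> = (\<lambda>p\<in>K. 0)" "a \<oplus>\<^bsub>A\<^esub> b = (\<lambda>p\<in>K. a p + b p)" "r \<odot>\<^bsub>A\<^esub> a = (\<lambda>p\<in>K. r * a p)"
  by (simp_all add: Caff_def)

lemma carrier_CaffI:
  assumes "continuous_on K f" "\<And>y. y \<in> Y \<Longrightarrow> affine_fun_on (fibre K y) (\<lambda>x. f (x, y))"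
  shows "restrict f K \<in> carrier A"
proof -
  have "continuous_on K (restrict f K)"
    using assms(1) by (rule continuous_on_eq) simp
  moreover have "affine_fun_on (fibre K y) (\<lambda>x. restrict f K (x, y))" if "y \<in> Y" for y
    unfolding affine_fun_on_def
  proof (intro ballI)
    fix x x' :: "real ^ 'n" and t :: real
    assume *: "x \<in> fibre K y" "x' \<in> fibre K y" "t \<in> {0..1}"
    then have "(1 - t) *\<^sub>R x + t *\<^sub>R x' \<in> fibre K y"
      using convex_fibre[OF that] unfolding convex_alt by auto
    then show "restrict f K ((1 - t) *\<^sub>R x + t *\<^sub>R x', y)
        = (1 - t) * restrict f K (x, y) + t * restrict f K (x', y)"
      using affine_fun_onD[OF assms(2)[OF that] *(1,2)] * by (simp add: mem_fibre_iff)
  qed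
  ultimately show ?thesis
    by (simp add: Caff_def)
qed

lemma carrier_CaffD:
  assumes "a \<in> carrier A"
  shows "a \<in> extensional K" "continuous_on K a"
    "y \<in> Y \<Longrightarrow> affine_fun_on (fibre K y) (\<lambda>x. a (x, y))" "bounded (a ` K)"
  using assms bounded_image_of_continuous[OF compact_K] by (auto simp: Caff_def)

lemma restrict_Caff: "a \<in> carrier A \<Longrightarrow> restrict a K = a"
  using carrier_CaffD(1) extensional_restrict by blast

lemma Caff_eqI: "a \<in> carrier A \<Longrightarrow> b \<in> carrier A \<Longrightarrow> (\<And>p. p \<in> K \<Longrightarrow> a p = b p) \<Longrightarrow> a = b"
  using carrier_CaffD(1) extensionalityI by blast

lemma affine_fun_on_lincomb:
  assumes "affine_fun_on S f" "affine_fun_on S g"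
  shows "affine_fun_on S (\<lambda>x. r * f x + s * g x)"
  unfolding affine_fun_on_def
proof (intro ballI)
  fix x x' t assume "x \<in> S" "x' \<in> S" "t \<in> {0..1::real}"
  then have "f ((1 - t) *\<^sub>R x + t *\<^sub>R x') = (1 - t) * f x + t * f x'"
    "g ((1 - t) *\<^sub>R x + t *\<^sub>R x') = (1 - t) * g x + t * g x'"
    using affine_fun_onD[OF assms(1), of x x' t] affine_fun_onD[OF assms(2), of x x' t] by auto
  then show "r * f ((1 - t) *\<^sub>R x + t *\<^sub>R x') + s * g ((1 - t) *\<^sub>R x + t *\<^sub>R x')
      = (1 - t) * (r * f x + s * g x) + t * (r * f x' + s * g x')"
    by (simp only:) (simp add: algebra_simps)
qed

lemma lincomb_closed:
  assumes "a \<in> carrier A" "b \<in> carrier A"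
  shows "(\<lambda>p\<in>K. r * a p + s * b p) \<in> carrier A"
  using carrier_CaffD[OF assms(1)] carrier_CaffD[OF assms(2)]
  by (intro carrier_CaffI continuous_intros affine_fun_on_lincomb) auto

lemma const_closed: "(\<lambda>p\<in>K. c) \<in> carrier A"
  by (intro carrier_CaffI) (auto simp: affine_fun_on_def algebra_simps)

lemma add_closed: "a \<in> carrier A \<Longrightarrow> b \<in> carrier A \<Longrightarrow> (\<lambda>p\<in>K. a p + b p) \<in> carrier A"
  using lincomb_closed[of a b 1 1] by simp

lemma diff_closed: "a \<in> carrier A \<Longrightarrow> b \<in> carrier A \<Longrightarrow> (\<lambda>p\<in>K. a p - b p) \<in> carrier A"
  using lincomb_closed[of a b 1 "- 1"] by simp

lemma smult_closed: "a \<in> carrier A \<Longrightarrow> (\<lambda>p\<in>K. r * a p) \<in> carrier A"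
  using lincomb_closed[of a a r 0] by simp

lemma uminus_closed: "a \<in> carrier A \<Longrightarrow> (\<lambda>p\<in>K. - a p) \<in> carrier A"
  using smult_closed[of a "- 1"] by simp

lemma add_const_closed: "a \<in> carrier A \<Longrightarrow> (\<lambda>p\<in>K. a p + c) \<in> carrier A"
  using add_closed[OF _ const_closed[of c]] by (simp cong: restrict_cong)

lemma const_diff_closed: "a \<in> carrier A \<Longrightarrow> (\<lambda>p\<in>K. c - a p) \<in> carrier A"
  using diff_closed[OF const_closed[of c]] by (simp cong: restrict_cong)

lemma abelian_group_Caff: "abelian_group A"
proof (rule abelian_groupI)
  fix a assume a: "a \<in> carrier A"
  show "\<zero>\<^bsub>A\<^esub> \<oplus>\<^bsub>A\<^esub> a = a"
    by (rule Caff_eqI) (use a in \<open>simp_all add: Caff_ops restrict_Caff cong: restrict_cong\<close>)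
  show "\<exists>b\<in>carrier A. b \<oplus>\<^bsub>A\<^esub> a = \<zero>\<^bsub>A\<^esub>"
    using uminus_closed[OF a] by (intro bexI[of _ "\<lambda>p\<in>K. - a p"]) (auto simp: Caff_ops)
qed (auto simp: Caff_ops const_closed add_closed add_ac)

lemma module_Caff: "Module.module real_ring A"
  by (rule moduleI[OF cring_real_ring abelian_group_Caff])
    (auto simp: Caff_ops smult_closed algebra_simps restrict_Caff cong: restrict_cong)

lemma a_inv_Caff: "a \<in> carrier A \<Longrightarrow> \<ominus>\<^bsub>A\<^esub> a = (\<lambda>p\<in>K. - a p)"
  by (rule abelian_group.minus_equality[OF abelian_group_Caff])
    (auto simp: Caff_ops uminus_closed)

lemma a_minus_Caff: "a \<in> carrier A \<Longrightarrow> b \<in> carrier A \<Longrightarrow> a \<ominus>\<^bsub>A\<^esub> b = (\<lambda>p\<in>K. a p - b p)"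
  by (auto simp: a_minus_def a_inv_Caff Caff_ops)

lemma mem_Caff_pos_iff: "a \<in> P \<longleftrightarrow> a \<in> carrier A \<and> (\<forall>p\<in>K. 0 \<le> a p)"
  by (auto simp: Caff_pos_def)

lemma unit_interval_iff:
  assumes "a \<in> carrier A"
  shows "a \<oplus>\<^bsub>A\<^esub> r \<odot>\<^bsub>A\<^esub> u \<in> P \<and> r \<odot>\<^bsub>A\<^esub> u \<ominus>\<^bsub>A\<^esub> a \<in> P \<longleftrightarrow> (\<forall>p\<in>K. \<bar>a p\<bar> \<le> r)"
  using assms by (auto simp: mem_Caff_pos_iff Caff_ops a_minus_Caff add_const_closed const_diff_closed const_closed abs_le_iff
      cong: restrict_cong)

lemma aou_space_Caff: "aou_space A P u"
proof (intro aou_space.intro aou_space_axioms.intro module_Caff)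
  fix a assume "a \<in> P" "\<ominus>\<^bsub>A\<^esub> a \<in> P"
  then show "a = \<zero>\<^bsub>A\<^esub>"
    by (intro Caff_eqI) (force simp: mem_Caff_pos_iff a_inv_Caff Caff_ops const_closed)+
next
  fix a assume a: "a \<in> carrier A"
  obtain r where "0 < r" "\<forall>p\<in>K. \<bar>a p\<bar> \<le> r"
    using carrier_CaffD(4)[OF a] unfolding bounded_pos by auto
  then show "\<exists>r>0. a \<oplus>\<^bsub>A\<^esub> r \<odot>\<^bsub>A\<^esub> u \<in> P \<and> r \<odot>\<^bsub>A\<^esub> u \<ominus>\<^bsub>A\<^esub> a \<in> P"
    using unit_interval_iff[OF a] by blast
next
  fix a assume a: "a \<in> carrier A" and *: "\<And>r. 0 < r \<Longrightarrow> a \<oplus>\<^bsub>A\<^esub> r \<odot>\<^bsub>A\<^esub> u \<in> P"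
  have "0 \<le> a p" if "p \<in> K" for p
    by (rule field_le_epsilon) (use * that in \<open>force simp: mem_Caff_pos_iff Caff_ops\<close>)
  then show "a \<in> P"
    using a by (simp add: mem_Caff_pos_iff)
qed (auto simp: mem_Caff_pos_iff Caff_ops const_closed add_closed smult_closed)

lemma ou_norm_Caff: "a \<in> carrier A \<Longrightarrow> ou_norm A P u a = bound_norm K a"
  unfolding ou_norm_def bound_norm_def by (simp add: unit_interval_iff)

lemma Metric_space_bound_norm:
  assumes "S \<subseteq> carrier A"
  shows "Metric_space S (\<lambda>a b. if a \<in> S \<and> b \<in> S then bound_norm K (\<lambda>p. a p - b p) else 0)"
proof
  have bdd: "bounded ((\<lambda>p. a p - b p) ` K)" if "a \<in> S" "b \<in> S" for a b
    using that assms carrier_CaffD(2) compact_K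
    by (intro bounded_image_of_continuous continuous_intros) auto
  show "0 \<le> (if a \<in> S \<and> b \<in> S then bound_norm K (\<lambda>p. a p - b p) else 0)" for a b
    using bound_norm_nonneg[OF bdd] by simp
  show "(if a \<in> S \<and> b \<in> S then bound_norm K (\<lambda>p. a p - b p) else 0)
      = (if b \<in> S \<and> a \<in> S then bound_norm K (\<lambda>p. b p - a p) else 0)" for a b
    by (auto intro!: bound_norm_cong)
  show "((if a \<in> S \<and> b \<in> S then bound_norm K (\<lambda>p. a p - b p) else 0) = 0) = (a = b)"
    if "a \<in> S" "b \<in> S" for a b
  proof -
    have "bound_norm K (\<lambda>p. a p - b p) \<le> 0 \<longleftrightarrow> a = b"
      unfolding bound_norm_le_iff[OF bdd[OF that] order_refl]
      using that assms Caff_eqI[of a b] by auto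
    then show ?thesis
      using bound_norm_nonneg[OF bdd[OF that]] that by auto
  qed
  show "(if a \<in> S \<and> c \<in> S then bound_norm K (\<lambda>p. a p - c p) else 0)
      \<le> (if a \<in> S \<and> b \<in> S then bound_norm K (\<lambda>p. a p - b p) else 0)
        + (if b \<in> S \<and> c \<in> S then bound_norm K (\<lambda>p. b p - c p) else 0)"
    if "a \<in> S" "b \<in> S" "c \<in> S" for a b c
  proof -
    have "\<bar>a p - c p\<bar> \<le> bound_norm K (\<lambda>p. a p - b p) + bound_norm K (\<lambda>p. b p - c p)" if "p \<in> K" for p
      using le_bound_norm[OF bdd[OF \<open>a \<in> S\<close> \<open>b \<in> S\<close>] that]
        le_bound_norm[OF bdd[OF \<open>b \<in> S\<close> \<open>c \<in> S\<close>] that] by linarith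
    then show ?thesis
      using that bound_norm_nonneg[OF bdd] by (auto intro!: bound_norm_le)
  qed
qed

text \<open>
  The subset \<open>S\<close> is either the whole space or the multiplicative domain, which carries its own
  record but the same norm.
\<close>

lemma norm_metric_eq:
  assumes "S \<subseteq> carrier A" "carrier M = S"
    and "\<forall>a\<in>S. \<forall>b\<in>S. a \<ominus>\<^bsub>M\<^esub> b = (\<lambda>p\<in>K. a p - b p)"
  shows "mspace (norm_metric M (ou_norm A P u)) = S"
    "\<And>a b. a \<in> S \<Longrightarrow> b \<in> S \<Longrightarrow>
      mdist (norm_metric M (ou_norm A P u)) a b = bound_norm K (\<lambda>p. a p - b p)"
proof -
  have "ou_norm A P u (a \<ominus>\<^bsub>M\<^esub> b) = bound_norm K (\<lambda>p. a p - b p)" if "a \<in> S" "b \<in> S" for a b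
  proof -
    have "ou_norm A P u (a \<ominus>\<^bsub>M\<^esub> b) = bound_norm K (\<lambda>p\<in>K. a p - b p)"
      unfolding bspec[OF bspec[OF assms(3) that(1)] that(2)] using assms(1) that by (intro ou_norm_Caff diff_closed) auto
    also have "\<dots> = bound_norm K (\<lambda>p. a p - b p)"
      by (rule bound_norm_cong) simp
    finally show ?thesis .
  qed
  then have *: "norm_metric M (ou_norm A P u)
      = metric (S, \<lambda>a b. if a \<in> S \<and> b \<in> S then bound_norm K (\<lambda>p. a p - b p) else 0)"
    unfolding norm_metric_def assms(2) by (auto intro!: arg_cong[of _ _ metric] ext)
  show "mspace (norm_metric M (ou_norm A P u)) = S"
    "\<And>a b. a \<in> S \<Longrightarrow> b \<in> S \<Longrightarrow>
      mdist (norm_metric M (ou_norm A P u)) a b = bound_norm K (\<lambda>p. a p - b p)"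
    unfolding * by (simp_all add: Metric_space.mspace_metric Metric_space.mdist_metric
        Metric_space_bound_norm[OF assms(1)])
qed

lemma closedin_norm_metric_iff:
  assumes "S \<subseteq> carrier A" "carrier M = S"
    and "\<forall>a\<in>S. \<forall>b\<in>S. a \<ominus>\<^bsub>M\<^esub> b = (\<lambda>p\<in>K. a p - b p)"
  shows "closedin (mtopology_of (norm_metric M (ou_norm A P u))) J \<longleftrightarrow>
    J \<subseteq> S \<and> (\<forall>a\<in>S - J. \<exists>r>0. \<forall>b\<in>J. r \<le> bound_norm K (\<lambda>p. a p - b p))"
proof -
  interpret N: Metric_space "mspace (norm_metric M (ou_norm A P u))" "mdist (norm_metric M (ou_norm A P u))"
    by simp
  have "disjnt J (N.mball a r) \<longleftrightarrow> (\<forall>b\<in>J. r \<le> bound_norm K (\<lambda>p. a p - b p))"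
    if J: "J \<subseteq> S" and a: "a \<in> S" for a r
  proof -
    have "b \<in> N.mball a r \<longleftrightarrow> bound_norm K (\<lambda>p. a p - b p) < r" if "b \<in> J" for b
    proof -
      have "b \<in> S"
        using that J by blast
      then show ?thesis
        using a unfolding N.in_mball unfolding norm_metric_eq(1)[OF assms] norm_metric_eq(2)[OF assms a \<open>b \<in> S\<close>] by simp
    qed
    then show ?thesis
      unfolding disjnt_iff not_less[symmetric] by blast
  qed
  then have "(\<exists>r>0. disjnt J (N.mball a r)) \<longleftrightarrow> (\<exists>r>0. \<forall>b\<in>J. r \<le> bound_norm K (\<lambda>p. a p - b p))"
    if "J \<subseteq> S" "a \<in> S - J" for a
    using that by simp
  then show ?thesis
    unfolding mtopology_of_def N.closedin_metric unfolding norm_metric_eq(1)[OF assms]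
    by (intro conj_cong refl) (simp add: Ball_def)
qed

section \<open>The multiplicative domain\<close>

sublocale D: order_unit_module_data A P u "evaluations K" "coordinate_gens K" Y .

abbreviation ev :: "(real ^ 'n) \<times> (real ^ 'm) \<Rightarrow> ((real ^ 'n) \<times> (real ^ 'm) \<Rightarrow> real) \<Rightarrow> real" where
  "ev p \<equiv> \<lambda>f\<in>carrier A. f p"

lemma kadison_ev: "p \<in> K \<Longrightarrow> a \<in> carrier A \<Longrightarrow> D.kadison a (ev p) = a p"
  unfolding D.kadison_def by (auto simp: evaluations_def)

text \<open>
  Since the distinguished states are the evaluations at points of \<open>K\<close>, the product that defines
  the multiplicative domain is the pointwise product of functions on \<open>K\<close>.
\<close>

lemma kadison_mult_eq_iff:
  assumes "z \<in> carrier A" "a \<in> carrier A" "c \<in> carrier A"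
  shows "(\<lambda>\<phi>\<in>evaluations K. D.kadison z \<phi> * D.kadison a \<phi>) = D.kadison c
    \<longleftrightarrow> (\<forall>p\<in>K. c p = z p * a p)" (is "?prod = _ \<longleftrightarrow> _")
proof
  assume eq: "?prod = D.kadison c"
  show "\<forall>p\<in>K. c p = z p * a p"
  proof
    fix p assume p: "p \<in> K"
    then have "?prod (ev p) = z p * a p"
      using kadison_ev assms by (simp add: evaluations_def)
    then show "c p = z p * a p"
      unfolding eq using kadison_ev[OF p assms(3)] by simp
  qed
next
  assume eq: "\<forall>p\<in>K. c p = z p * a p"
  show "?prod = D.kadison c"
  proof (rule extensionalityI[of _ "evaluations K"])
    fix \<phi> assume "\<phi> \<in> evaluations K"
    then obtain p where p: "p \<in> K" "\<phi> = ev p"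
      by (auto simp: evaluations_def)
    then show "?prod \<phi> = D.kadison c \<phi>"
      using eq kadison_ev[OF p(1)] assms \<open>\<phi> \<in> evaluations K\<close> by simp
  qed (auto simp: D.kadison_def)
qed

lemma inj_on_kadison: "inj_on D.kadison (carrier A)"
proof (rule inj_onI)
  fix a b assume "a \<in> carrier A" "b \<in> carrier A" "D.kadison a = D.kadison b"
  then show "a = b"
    by (intro Caff_eqI) (auto simp flip: kadison_ev)
qed

lemma mult_dom_iff:
  "z \<in> D.mult_dom \<longleftrightarrow> z \<in> carrier A \<and> (\<forall>a\<in>carrier A. (\<lambda>p\<in>K. z p * a p) \<in> carrier A)"
proof -
  have "(\<lambda>\<phi>\<in>evaluations K. D.kadison z \<phi> * D.kadison a \<phi>) \<in> D.kadison ` carrier A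
      \<longleftrightarrow> (\<lambda>p\<in>K. z p * a p) \<in> carrier A" if za: "z \<in> carrier A" "a \<in> carrier A" for a
  proof
    assume "(\<lambda>\<phi>\<in>evaluations K. D.kadison z \<phi> * D.kadison a \<phi>) \<in> D.kadison ` carrier A"
    then obtain c where c: "c \<in> carrier A" "\<forall>p\<in>K. c p = z p * a p"
      using kadison_mult_eq_iff[OF za] by auto
    then have "(\<lambda>p\<in>K. z p * a p) = c"
      using carrier_CaffD(1)[OF c(1)] by (intro extensionalityI[of _ K]) auto
    with c(1) show "(\<lambda>p\<in>K. z p * a p) \<in> carrier A"
      by (simp only:)
  next
    assume c: "(\<lambda>p\<in>K. z p * a p) \<in> carrier A"
    have "(\<lambda>\<phi>\<in>evaluations K. D.kadison z \<phi> * D.kadison a \<phi>) = D.kadison (\<lambda>p\<in>K. z p * a p)"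
      unfolding kadison_mult_eq_iff[OF za c] by simp
    with c show "(\<lambda>\<phi>\<in>evaluations K. D.kadison z \<phi> * D.kadison a \<phi>) \<in> D.kadison ` carrier A"
      by (simp only: imageI)
  qed
  then show ?thesis
    unfolding D.mult_dom_def by blast
qed

lemma mult_domD:
  assumes "z \<in> D.mult_dom"
  shows "z \<in> carrier A" "a \<in> carrier A \<Longrightarrow> (\<lambda>p\<in>K. z p * a p) \<in> carrier A"
  using assms mult_dom_iff by blast+

lemma mult_dom_subset: "D.mult_dom \<subseteq> carrier A"
  using mult_domD(1) by blast

lemma kprod_eq:
  assumes "z \<in> D.mult_dom" "a \<in> carrier A"
  shows "D.kprod z a = (\<lambda>p\<in>K. z p * a p)"
proof -
  note c = mult_domD(2)[OF assms]
  have "(\<lambda>\<phi>\<in>evaluations K. D.kadison z \<phi> * D.kadison a \<phi>) = D.kadison (\<lambda>p\<in>K. z p * a p)"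
    unfolding kadison_mult_eq_iff[OF mult_domD(1)[OF assms(1)] assms(2) c] by simp
  then show ?thesis
    unfolding D.kprod_def by (simp only: inv_into_f_f[OF inj_on_kadison c])
qed

lemma mult_domI:
  assumes f: "continuous_on Y f" and z: "\<And>p. p \<in> K \<Longrightarrow> z p = f (snd p)"
  shows "restrict z K \<in> D.mult_dom"
proof -
  have cont: "continuous_on K (\<lambda>p. f (snd p))"
    by (rule continuous_on_compose2[OF f]) (auto intro!: continuous_intros)
  have prod: "(\<lambda>p\<in>K. f (snd p) * a p) \<in> carrier A" if "a \<in> carrier A" for a
  proof (rule carrier_CaffI)
    show "continuous_on K (\<lambda>p. f (snd p) * a p)"
      using cont carrier_CaffD(2)[OF that] by (rule continuous_on_mult)
    show "affine_fun_on (fibre K y) (\<lambda>x. f (snd (x, y)) * a (x, y))" if "y \<in> Y" for y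
      using affine_fun_on_lincomb[of _ "\<lambda>x. a (x, y)" "\<lambda>x. a (x, y)" "f y" 0]
        carrier_CaffD(3)[OF \<open>a \<in> carrier A\<close> that] by simp
  qed
  have "restrict z K = (\<lambda>p\<in>K. f (snd p) * u p)"
    using z by auto
  then have "restrict z K \<in> carrier A"
    using prod[OF const_closed] by (simp only:)
  moreover have "(\<lambda>p\<in>K. restrict z K p * a p) = (\<lambda>p\<in>K. f (snd p) * a p)" for a
    using z by auto
  ultimately show ?thesis
    unfolding mult_dom_iff using prod by simp
qed

lemma mult_dom_fibrewise_constant:
  assumes "z \<in> D.mult_dom" "(x, y) \<in> K" "(x', y) \<in> K"
  shows "z (x, y) = z (x', y)"
proof -
  have y: "y \<in> Y"
    using assms(2) by force
  let ?m = "(1 - 1/2) *\<^sub>R x + (1/2::real) *\<^sub>R x'"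
  have m: "?m \<in> fibre K y"
    by (rule convexD_alt[OF convex_fibre[OF y]]) (use assms(2,3) in \<open>auto simp: mem_fibre_iff\<close>)
  have "z (?m, y) = (1 - 1/2) * z (x, y) + 1/2 * z (x', y)"
    using affine_fun_onD[OF carrier_CaffD(3)[OF mult_domD(1)[OF assms(1)] y], of x x' "1/2"] assms(2,3)
    by (simp add: mem_fibre_iff)
  moreover have "z (?m, y) * z (?m, y) = (1 - 1/2) * (z (x, y) * z (x, y)) + 1/2 * (z (x', y) * z (x', y))"
    using affine_fun_onD[OF carrier_CaffD(3)[OF mult_domD(2)[OF assms(1) mult_domD(1)[OF assms(1)]] y],
        of x x' "1/2"] assms(2,3) m
    unfolding mem_fibre_iff by simp
  \<comment> \<open>An affine function with affine square takes equal values: the variance vanishes.\<close>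
  ultimately have "(z (x, y) - z (x', y))\<^sup>2 = 0"
    by (simp only:) (simp add: power2_eq_square field_simps)
  then show ?thesis
    by simp
qed

text \<open>
  Elements of the multiplicative domain are constant on fibres, and \<open>base z\<close> is the function on \<open>Y\<close>
  whose pullback is \<open>z\<close>. Taking the supremum instead of the value at a chosen point of the fibre
  makes its continuity a case of the continuity of fibrewise suprema.
\<close>

definition base :: "((real ^ 'n) \<times> (real ^ 'm) \<Rightarrow> real) \<Rightarrow> real ^ 'm \<Rightarrow> real" where
  "base z = restrict (fibre_sup z) Y"

lemma base_eq:
  assumes "z \<in> D.mult_dom" "p \<in> K"
  shows "base z (snd p) = z p"
proof -
  have y: "snd p \<in> Y"
    using assms(2) by blast
  obtain x where "(x, snd p) \<in> K" "fibre_sup z (snd p) = z (x, snd p)"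
    using fibre_sup_attained[OF carrier_CaffD(2)[OF mult_domD(1)[OF assms(1)]] y] by blast
  then show ?thesis
    using mult_dom_fibrewise_constant[OF assms(1), of x "snd p" "fst p"] assms(2) y
    by (simp add: base_def)
qed

lemma base_continuous: "z \<in> D.mult_dom \<Longrightarrow> continuous_on Y (base z)"
  using continuous_on_fibre_sup[OF carrier_CaffD(2)[OF mult_domD(1)]] unfolding base_def
  by (rule continuous_on_eq) simp_all

lemma mem_cont_alg_iff: "f \<in> carrier (cont_alg Y) \<longleftrightarrow> f \<in> extensional Y \<and> continuous_on Y f"
  using carrier_cont_alg[OF compact_Y] by blast

lemma base_closed: "z \<in> D.mult_dom \<Longrightarrow> base z \<in> carrier (cont_alg Y)"
  using base_continuous by (simp add: mem_cont_alg_iff base_def)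

lemma pullback_closed: "f \<in> carrier (cont_alg Y) \<Longrightarrow> pullback K f \<in> D.mult_dom"
  unfolding pullback_def by (rule mult_domI) (auto simp: mem_cont_alg_iff)

lemma pullback_base: "z \<in> D.mult_dom \<Longrightarrow> pullback K (base z) = z"
  using carrier_CaffD(1)[OF mult_domD(1)]
  by (intro extensionalityI[of _ K]) (auto simp: pullback_def base_eq simp del: split_paired_All)

lemma base_unique:
  assumes "z \<in> D.mult_dom" "y \<in> Y" "\<And>p. p \<in> K \<Longrightarrow> snd p = y \<Longrightarrow> z p = c"
  shows "base z y = c"
  using assms base_eq by blast

lemma base_pullback:
  assumes "f \<in> carrier (cont_alg Y)"
  shows "base (pullback K f) = f"
proof (rule extensionalityI[of _ Y])
  show "base (pullback K f) y = f y" if "y \<in> Y" for y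
    using pullback_closed[OF assms] that by (rule base_unique) (simp add: pullback_def)
qed (use assms in \<open>auto simp: base_def mem_cont_alg_iff\<close>)

lemma mult_dom_closed:
  assumes z: "z \<in> D.mult_dom"
  shows "(\<lambda>p\<in>K. r * z p) \<in> D.mult_dom" "(\<lambda>p\<in>K. - z p) \<in> D.mult_dom"
    "w \<in> D.mult_dom \<Longrightarrow> (\<lambda>p\<in>K. z p + w p) \<in> D.mult_dom"
    "w \<in> D.mult_dom \<Longrightarrow> (\<lambda>p\<in>K. z p * w p) \<in> D.mult_dom"
    "w \<in> D.mult_dom \<Longrightarrow> (\<lambda>p\<in>K. z p - w p) \<in> D.mult_dom"
proof -
  show "(\<lambda>p\<in>K. r * z p) \<in> D.mult_dom"
    by (rule mult_domI[of "\<lambda>y. r * base z y"]) (auto intro!: continuous_intros base_continuous z simp: base_eq[OF z, symmetric])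
  show "(\<lambda>p\<in>K. - z p) \<in> D.mult_dom"
    by (rule mult_domI[of "\<lambda>y. - base z y"]) (auto intro!: continuous_intros base_continuous z simp: base_eq[OF z, symmetric])
  assume w: "w \<in> D.mult_dom"
  show "(\<lambda>p\<in>K. z p + w p) \<in> D.mult_dom"
    by (rule mult_domI[of "\<lambda>y. base z y + base w y"])
      (auto intro!: continuous_intros base_continuous z w simp: base_eq[OF z, symmetric] base_eq[OF w, symmetric])
  show "(\<lambda>p\<in>K. z p * w p) \<in> D.mult_dom"
    by (rule mult_domI[of "\<lambda>y. base z y * base w y"])
      (auto intro!: continuous_intros base_continuous z w simp: base_eq[OF z, symmetric] base_eq[OF w, symmetric])
  show "(\<lambda>p\<in>K. z p - w p) \<in> D.mult_dom"
    by (rule mult_domI[of "\<lambda>y. base z y - base w y"])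
      (auto intro!: continuous_intros base_continuous z w simp: base_eq[OF z, symmetric] base_eq[OF w, symmetric])
qed

lemma const_mult_dom: "(\<lambda>p\<in>K. c) \<in> D.mult_dom"
  by (rule mult_domI[of "\<lambda>_. c"]) auto

lemma mult_dom_eqI: "z \<in> D.mult_dom \<Longrightarrow> w \<in> D.mult_dom \<Longrightarrow> (\<And>p. p \<in> K \<Longrightarrow> z p = w p) \<Longrightarrow> z = w"
  using Caff_eqI mult_domD(1) by blast

lemma dom_alg_ops:
  "carrier D.dom_alg = D.mult_dom" "\<zero>\<^bsub>D.dom_alg\<^esub> = (\<lambda>p\<in>K. 0)" "\<one>\<^bsub>D.dom_alg\<^esub> = u"
  "z \<oplus>\<^bsub>D.dom_alg\<^esub> w = (\<lambda>p\<in>K. z p + w p)" "r \<odot>\<^bsub>D.dom_alg\<^esub> z = (\<lambda>p\<in>K. r * z p)"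
  "z \<in> D.mult_dom \<Longrightarrow> w \<in> D.mult_dom \<Longrightarrow> z \<otimes>\<^bsub>D.dom_alg\<^esub> w = (\<lambda>p\<in>K. z p * w p)"
  by (auto simp: D.dom_alg_def Caff_ops kprod_eq mult_domD(1))

lemma cring_dom_alg: "cring D.dom_alg"
proof (rule cringI)
  show "abelian_group D.dom_alg"
  proof (rule abelian_groupI)
    fix z assume z: "z \<in> carrier D.dom_alg"
    then show "\<zero>\<^bsub>D.dom_alg\<^esub> \<oplus>\<^bsub>D.dom_alg\<^esub> z = z"
      by (simp add: dom_alg_ops restrict_Caff mult_domD(1) cong: restrict_cong)
    show "\<exists>w\<in>carrier D.dom_alg. w \<oplus>\<^bsub>D.dom_alg\<^esub> z = \<zero>\<^bsub>D.dom_alg\<^esub>"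
      using z mult_dom_closed(2)[of z]
      by (intro bexI[of _ "\<lambda>p\<in>K. - z p"]) (auto simp: dom_alg_ops)
  qed (auto simp: dom_alg_ops const_mult_dom mult_dom_closed(3) add_ac)
  show "comm_monoid D.dom_alg"
  proof (rule comm_monoidI)
    fix z assume z: "z \<in> carrier D.dom_alg"
    then show "\<one>\<^bsub>D.dom_alg\<^esub> \<otimes>\<^bsub>D.dom_alg\<^esub> z = z"
      by (simp add: dom_alg_ops const_mult_dom restrict_Caff mult_domD(1) cong: restrict_cong)
  qed (auto simp: dom_alg_ops const_mult_dom mult_dom_closed(4) mult_ac)
qed (auto simp: dom_alg_ops mult_dom_closed algebra_simps)

lemma algebra_dom_alg: "Module.algebra real_ring D.dom_alg"
  by (rule algebraI[OF cring_real_ring cring_dom_alg])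
    (auto simp: dom_alg_ops mult_dom_closed algebra_simps restrict_Caff mult_domD(1) cong: restrict_cong)

lemma abelian_group_dom_alg: "abelian_group D.dom_alg"
  using cring_dom_alg by (intro ring.is_abelian_group cring.axioms(1))

lemma a_inv_dom_alg: "z \<in> D.mult_dom \<Longrightarrow> \<ominus>\<^bsub>D.dom_alg\<^esub> z = (\<lambda>p\<in>K. - z p)"
  by (rule abelian_group.minus_equality[OF abelian_group_dom_alg])
    (auto simp: dom_alg_ops mult_dom_closed)

lemma a_minus_dom_alg:
  "\<forall>z\<in>D.mult_dom. \<forall>w\<in>D.mult_dom. z \<ominus>\<^bsub>D.dom_alg\<^esub> w = (\<lambda>p\<in>K. z p - w p)"
  by (auto simp: a_minus_def a_inv_dom_alg dom_alg_ops)

lemma ou_norm_mult_dom: "z \<in> D.mult_dom \<Longrightarrow> ou_norm A P u z = bound_norm K z"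
  by (rule ou_norm_Caff[OF mult_domD(1)])

lemma bound_norm_comp_snd: "bound_norm K (\<lambda>p. h (snd p)) = bound_norm Y h"
  by (simp add: bound_norm_def)

lemmas dom_norm_metric = norm_metric_eq[OF mult_dom_subset dom_alg_ops(1) a_minus_dom_alg]

lemma mdist_base:
  assumes "z \<in> D.mult_dom" "w \<in> D.mult_dom"
  shows "mdist (cont_metric Y) (base z) (base w) = mdist (norm_metric D.dom_alg (ou_norm A P u)) z w"
proof -
  have "mdist (cont_metric Y) (base z) (base w) = bound_norm Y (\<lambda>y. base z y - base w y)"
    using base_closed[OF assms(1)] base_closed[OF assms(2)] unfolding cont_alg_def
    by (intro mdist_cont_metric[OF compact_Y]) simp_all
  also have "\<dots> = bound_norm K (\<lambda>p. base z (snd p) - base w (snd p))"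
    by (rule bound_norm_comp_snd[symmetric])
  also have "\<dots> = bound_norm K (\<lambda>p. z p - w p)"
    using assms by (intro bound_norm_cong) (simp only: base_eq)
  finally show ?thesis
    using dom_norm_metric(2)[OF assms] by simp
qed

lemma complete_dom_alg: "mcomplete_of (norm_metric D.dom_alg (ou_norm A P u))"
proof -
  let ?m = "norm_metric D.dom_alg (ou_norm A P u)"
  interpret N: Metric_space "mspace ?m" "mdist ?m"
    by (rule Metric_space_mspace_mdist)
  interpret C: Metric_space "mspace (cont_metric Y)" "mdist (cont_metric Y)"
    by (rule Metric_space_mspace_mdist)
  have C_complete: "C.mcomplete"
    using Met_TC.mcomplete_cfunspace[where 'a = real, of "top_of_set Y"] complete_UNIV
    unfolding mcomplete_of_def Met_TC.Self_def euclidean_metric_def[symmetric] by blast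
  have C_carrier: "mspace (cont_metric Y) = carrier (cont_alg Y)"
    by (simp add: cont_alg_def)
  show ?thesis
    unfolding mcomplete_of_def N.mcomplete_def
  proof (intro allI impI)
    fix \<sigma> :: "nat \<Rightarrow> (real ^ 'n) \<times> (real ^ 'm) \<Rightarrow> real"
    assume "N.MCauchy \<sigma>"
    then have \<sigma>: "\<And>k. \<sigma> k \<in> D.mult_dom"
        "\<And>e. 0 < e \<Longrightarrow> \<exists>N. \<forall>k k'. N \<le> k \<longrightarrow> N \<le> k' \<longrightarrow> mdist ?m (\<sigma> k) (\<sigma> k') < e"
      unfolding N.MCauchy_def unfolding dom_norm_metric(1) by auto
    then have "C.MCauchy (\<lambda>k. base (\<sigma> k))"
      unfolding C.MCauchy_def unfolding C_carrier
      by (auto simp: mdist_base base_closed simp del: mdist_cfunspace_eq_mdist_funspace)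
    then obtain f where "limitin C.mtopology (\<lambda>k. base (\<sigma> k)) f sequentially"
      using C_complete unfolding C.mcomplete_def by blast
    then have f: "f \<in> carrier (cont_alg Y)"
        "\<And>e. 0 < e \<Longrightarrow> \<forall>\<^sub>F k in sequentially. mdist (cont_metric Y) (base (\<sigma> k)) f < e"
      unfolding C.limitin_metric unfolding C_carrier by (auto elim!: eventually_mono)
    have "limitin N.mtopology \<sigma> (pullback K f) sequentially"
      unfolding N.limitin_metric unfolding dom_norm_metric(1)
      using f \<sigma>(1) pullback_closed[OF f(1)]
        mdist_base[OF \<sigma>(1) pullback_closed[OF f(1)]] unfolding base_pullback[OF f(1)] by simp
    then show "\<exists>f. limitin N.mtopology \<sigma> f sequentially"
      by blast
  qed
qed

lemma comm_real_cstar_algebra_dom_alg: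
  "comm_real_cstar_algebra D.dom_alg (ou_norm A P u) (\<lambda>z. z)"
proof (intro comm_real_cstar_algebra.intro comm_real_cstar_algebra_axioms.intro algebra_dom_alg complete_dom_alg)
  note bdd = carrier_CaffD(4)[OF mult_domD(1)]
  have norm_prod: "bound_norm K (\<lambda>p\<in>K. z p * w p) \<le> bound_norm K z * bound_norm K w"
    if "z \<in> D.mult_dom" "w \<in> D.mult_dom" for z w
    using that le_bound_norm[OF bdd] bound_norm_nonneg[OF bdd]
    by (intro bound_norm_le) (auto simp: abs_mult intro!: mult_mono)
  fix z assume "z \<in> carrier D.dom_alg"
  then have z: "z \<in> D.mult_dom"
    by (simp add: dom_alg_ops)
  show "0 \<le> ou_norm A P u z"
    using z bound_norm_nonneg[OF bdd] by (simp add: ou_norm_mult_dom)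
  have "bound_norm K z \<le> 0 \<longleftrightarrow> z = \<zero>\<^bsub>D.dom_alg\<^esub>"
    unfolding bound_norm_le_iff[OF bdd[OF z] order_refl]
    using mult_dom_eqI[OF z const_mult_dom[of 0]] by (auto simp: dom_alg_ops)
  then show "ou_norm A P u z = 0 \<longleftrightarrow> z = \<zero>\<^bsub>D.dom_alg\<^esub>"
    using z bound_norm_nonneg[OF bdd[OF z]] by (simp add: ou_norm_mult_dom)
  show "ou_norm A P u (r \<odot>\<^bsub>D.dom_alg\<^esub> z) = \<bar>r\<bar> * ou_norm A P u z" for r
  proof -
    have 1: "bound_norm K (\<lambda>p\<in>K. s * w p) \<le> \<bar>s\<bar> * bound_norm K w" if "w \<in> D.mult_dom" for s w
      using that le_bound_norm[OF bdd] bound_norm_nonneg[OF bdd]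
      by (intro bound_norm_le) (auto simp: abs_mult intro!: mult_left_mono)
    \<comment> \<open>The reverse estimate is the first one for the factor \<open>1/r\<close>.\<close>
    have "\<bar>r\<bar> * bound_norm K z \<le> bound_norm K (\<lambda>p\<in>K. r * z p)"
    proof (cases "r = 0")
      case True
      then show ?thesis
        using bound_norm_nonneg[OF bdd[OF mult_dom_closed(1)[OF z]], of r] by simp
    next
      case False
      have "(\<lambda>p\<in>K. (1/r) * (\<lambda>p\<in>K. r * z p) p) = z"
        using False carrier_CaffD(1)[OF mult_domD(1)[OF z]] by (intro extensionalityI[of _ K]) auto
      then have "bound_norm K z \<le> \<bar>1/r\<bar> * bound_norm K (\<lambda>p\<in>K. r * z p)"
        using 1[OF mult_dom_closed(1)[OF z, of r], of "1/r"] by simp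
      then show ?thesis
        using False by (simp add: field_simps)
    qed
    then show ?thesis
      using 1[OF z, of r] by (simp add: dom_alg_ops ou_norm_mult_dom z mult_dom_closed(1))
  qed
  have "(bound_norm K z)\<^sup>2 \<le> bound_norm K (\<lambda>p\<in>K. z p * z p)"
  proof -
    note zz = mult_dom_closed(4)[OF z z]
    have "bound_norm K z \<le> sqrt (bound_norm K (\<lambda>p\<in>K. z p * z p))"
      using le_bound_norm[OF bdd[OF zz]] bound_norm_nonneg[OF bdd[OF zz]]
      by (intro bound_norm_le real_le_rsqrt) (auto simp: power2_eq_square)
    then show ?thesis
      using bound_norm_nonneg[OF bdd[OF z]] bound_norm_nonneg[OF bdd[OF zz]]
      by (metis power_mono real_sqrt_pow2)
  qed
  then show "ou_norm A P u (z \<otimes>\<^bsub>D.dom_alg\<^esub> z) = (ou_norm A P u z)\<^sup>2"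
    using norm_prod[OF z z] by (simp add: dom_alg_ops ou_norm_mult_dom z mult_dom_closed(4) power2_eq_square)
  have "\<one>\<^bsub>D.dom_alg\<^esub> \<oplus>\<^bsub>D.dom_alg\<^esub> z \<otimes>\<^bsub>D.dom_alg\<^esub> z = (\<lambda>p\<in>K. 1 + z p * z p)"
    by (simp add: dom_alg_ops z cong: restrict_cong)
  moreover have "(\<lambda>p\<in>K. 1 + z p * z p) \<in> D.mult_dom"
    using mult_dom_closed(3)[OF const_mult_dom[of 1] mult_dom_closed(4)[OF z z]] by (simp cong: restrict_cong)
  moreover have "(\<lambda>p\<in>K. inverse (1 + z p * z p)) \<in> D.mult_dom"
  proof (rule mult_domI[of "\<lambda>y. inverse (1 + base z y * base z y)"])
    have "1 + base z y * base z y \<noteq> 0" for y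
      using add_pos_nonneg[OF zero_less_one zero_le_square[of "base z y"]] by simp
    then show "continuous_on Y (\<lambda>y. inverse (1 + base z y * base z y))"
      by (intro continuous_intros base_continuous z) auto
  qed (simp add: base_eq z)
  moreover have "1 + c * c \<noteq> 0" for c :: real
    using add_pos_nonneg[OF zero_less_one zero_le_square[of c]] by simp
  ultimately show "\<one>\<^bsub>D.dom_alg\<^esub> \<oplus>\<^bsub>D.dom_alg\<^esub> z \<otimes>\<^bsub>D.dom_alg\<^esub> z \<in> Units D.dom_alg"
    unfolding Units_def
    by (auto simp: dom_alg_ops intro!: bexI[of _ "\<lambda>p\<in>K. inverse (1 + z p * z p)"] cong: restrict_cong)
  fix w assume "w \<in> carrier D.dom_alg"
  then have w: "w \<in> D.mult_dom"
    by (simp add: dom_alg_ops)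
  show "ou_norm A P u (z \<otimes>\<^bsub>D.dom_alg\<^esub> w) \<le> ou_norm A P u z * ou_norm A P u w"
    using norm_prod[OF z w] by (simp add: dom_alg_ops ou_norm_mult_dom z w mult_dom_closed(4))
  show "z \<otimes>\<^bsub>D.dom_alg\<^esub> w = w \<otimes>\<^bsub>D.dom_alg\<^esub> z"
    by (simp add: dom_alg_ops z w mult.commute)
  have "bound_norm K (\<lambda>p\<in>K. z p + w p) \<le> bound_norm K z + bound_norm K w"
    using le_bound_norm[OF bdd[OF z]] le_bound_norm[OF bdd[OF w]]
      bound_norm_nonneg[OF bdd[OF z]] bound_norm_nonneg[OF bdd[OF w]]
    by (intro bound_norm_le) (auto intro: order.trans[OF abs_triangle_ineq add_mono])
  then show "ou_norm A P u (z \<oplus>\<^bsub>D.dom_alg\<^esub> w) \<le> ou_norm A P u z + ou_norm A P u w"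
    by (simp add: dom_alg_ops ou_norm_mult_dom z w mult_dom_closed(3))
qed auto

section \<open>Characters and generators of the multiplicative domain\<close>

lemma module_dom_alg: "Module.module real_ring D.dom_alg"
  using algebra_dom_alg by (simp add: Module.algebra_def)

lemma coordinate_gens_mult_dom: "coordinate_gens K i \<in> D.mult_dom"
  unfolding coordinate_gens_def pullback_def
  by (rule mult_domI[of "\<lambda>y. y $ i"]) (auto intro!: continuous_intros)

lemma sum_mult_dom:
  assumes "finite I" "\<And>i. i \<in> I \<Longrightarrow> F i \<in> D.mult_dom"
  shows "(\<lambda>p\<in>K. \<Sum>i\<in>I. F i p) \<in> D.mult_dom"
  using assms
proof (induction I rule: finite_induct)
  case empty
  show "(\<lambda>p\<in>K. \<Sum>i\<in>{}. F i p) \<in> D.mult_dom"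
    using const_mult_dom[of 0] by simp
next
  case (insert j I)
  then have "(\<lambda>p\<in>K. F j p + (\<lambda>p\<in>K. \<Sum>i\<in>I. F i p) p) \<in> D.mult_dom"
    by (intro mult_dom_closed(3)) auto
  then show "(\<lambda>p\<in>K. \<Sum>i\<in>insert j I. F i p) \<in> D.mult_dom"
    using insert.hyps by (simp cong: restrict_cong)
qed

abbreviation ev_base :: "real ^ 'm \<Rightarrow> ((real ^ 'n) \<times> (real ^ 'm) \<Rightarrow> real) \<Rightarrow> real" where
  "ev_base y \<equiv> \<lambda>z\<in>D.mult_dom. base z y"

lemma characterD:
  assumes "h \<in> characters D.dom_alg"
  shows "h \<in> extensional D.mult_dom" "h u = 1"
    "z \<in> D.mult_dom \<Longrightarrow> w \<in> D.mult_dom \<Longrightarrow> h (\<lambda>p\<in>K. z p + w p) = h z + h w"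
    "z \<in> D.mult_dom \<Longrightarrow> h (\<lambda>p\<in>K. r * z p) = r * h z"
    "z \<in> D.mult_dom \<Longrightarrow> w \<in> D.mult_dom \<Longrightarrow> h (\<lambda>p\<in>K. z p * w p) = h z * h w"
proof -
  have lin: "h \<in> linear_functionals D.dom_alg" and hom: "h \<in> ring_hom D.dom_alg real_ring"
    using assms by (simp_all add: characters_def)
  show "h \<in> extensional D.mult_dom"
    using lin by (simp add: linear_functionals_def dom_alg_ops(1))
  show "h u = 1"
    using ring_hom_one[OF hom] by (simp add: dom_alg_ops(3))
  show "h (\<lambda>p\<in>K. r * z p) = r * h z" if "z \<in> D.mult_dom"
    using lin that by (simp add: linear_functionals_def dom_alg_ops(1,5))
  assume zw: "z \<in> D.mult_dom" "w \<in> D.mult_dom"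
  show "h (\<lambda>p\<in>K. z p + w p) = h z + h w"
    using ring_hom_add[OF hom, of z w] zw by (simp add: dom_alg_ops)
  show "h (\<lambda>p\<in>K. z p * w p) = h z * h w"
    using ring_hom_mult[OF hom, of z w] zw by (simp add: dom_alg_ops)
qed

lemma character_sum:
  assumes h: "h \<in> characters D.dom_alg" and "finite I" "\<And>i. i \<in> I \<Longrightarrow> F i \<in> D.mult_dom"
  shows "h (\<lambda>p\<in>K. \<Sum>i\<in>I. F i p) = (\<Sum>i\<in>I. h (F i))"
  using assms(2,3)
proof (induction I rule: finite_induct)
  case empty
  show "h (\<lambda>p\<in>K. \<Sum>i\<in>{}. F i p) = (\<Sum>i\<in>{}. h (F i))"
    using characterD(4)[OF h const_mult_dom[of 0], of 0] by (simp cong: restrict_cong)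
next
  case (insert j I)
  have "h (\<lambda>p\<in>K. \<Sum>i\<in>insert j I. F i p) = h (\<lambda>p\<in>K. F j p + (\<lambda>p\<in>K. \<Sum>i\<in>I. F i p) p)"
    using insert.hyps by (simp cong: restrict_cong)
  also have "\<dots> = h (F j) + h (\<lambda>p\<in>K. \<Sum>i\<in>I. F i p)"
    using insert.prems insert.hyps by (intro characterD(3)[OF h] sum_mult_dom) auto
  finally show "h (\<lambda>p\<in>K. \<Sum>i\<in>insert j I. F i p) = (\<Sum>i\<in>insert j I. h (F i))"
    unfolding sum.insert[OF insert.hyps] using insert.IH insert.prems by simp
qed

text \<open>
  A direct substitute for Gelfand theory of real function algebras: a character kills the sum of the
  squares of \<open>F\<^sub>i - h(F\<^sub>i)\<close>, so this sum is not invertible and vanishes at some point of \<open>Y\<close>.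
  There all \<open>F\<^sub>i\<close> take the values prescribed by the character.
\<close>

lemma character_common_zero:
  assumes h: "h \<in> characters D.dom_alg" and "finite I" and F: "\<And>i. i \<in> I \<Longrightarrow> F i \<in> D.mult_dom"
  obtains y where "y \<in> Y" "\<And>i. i \<in> I \<Longrightarrow> base (F i) y = h (F i)"
proof -
  define G where "G i = (\<lambda>p\<in>K. F i p - h (F i))" for i
  have G: "G i \<in> D.mult_dom" if "i \<in> I" for i
    using mult_dom_closed(5)[OF F[OF that] const_mult_dom[of "h (F i)"]]
    by (simp add: G_def cong: restrict_cong)
  have hG: "h (G i) = 0" if "i \<in> I" for i
  proof -
    have "h (G i) = h (\<lambda>p\<in>K. F i p + (\<lambda>p\<in>K. (- h (F i)) * u p) p)"
      by (simp add: G_def cong: restrict_cong)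
    also have "\<dots> = h (F i) + h (\<lambda>p\<in>K. (- h (F i)) * u p)"
      by (intro characterD(3)[OF h] F that mult_dom_closed(1) const_mult_dom)
    also have "h (\<lambda>p\<in>K. (- h (F i)) * u p) = (- h (F i)) * h u"
      by (rule characterD(4)[OF h const_mult_dom])
    finally show ?thesis
      by (simp add: characterD(2)[OF h])
  qed
  define q where "q = (\<lambda>p\<in>K. \<Sum>i\<in>I. (\<lambda>p\<in>K. G i p * G i p) p)"
  have q: "q \<in> D.mult_dom"
    unfolding q_def by (intro sum_mult_dom mult_dom_closed(4) G assms(2))
  have "h q = (\<Sum>i\<in>I. h (\<lambda>p\<in>K. G i p * G i p))"
    unfolding q_def by (intro character_sum[OF h] assms(2) mult_dom_closed(4) G)
  also have "\<dots> = 0"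
    using hG by (simp add: characterD(5)[OF h] G)
  finally have hq: "h q = 0" .
  have q_eq: "q p = (\<Sum>i\<in>I. (F i p - h (F i))\<^sup>2)" if "p \<in> K" for p
    using that by (simp add: q_def G_def power2_eq_square)
  \<comment> \<open>If \<open>q\<close> had no zero it would be invertible, but the character kills it.\<close>
  have "\<exists>p\<in>K. q p = 0"
  proof (rule ccontr)
    assume no_zero: "\<not> (\<exists>p\<in>K. q p = 0)"
    then have nz: "base q y \<noteq> 0" if "y \<in> Y" for y
      using that base_eq[OF q] by fastforce
    have inv: "(\<lambda>p\<in>K. inverse (q p)) \<in> D.mult_dom"
      by (rule mult_domI[of "\<lambda>y. inverse (base q y)"])
        (use nz in \<open>auto intro!: continuous_intros base_continuous q simp: base_eq[OF q, symmetric]\<close>)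
    have "h u = h (\<lambda>p\<in>K. q p * (\<lambda>p\<in>K. inverse (q p)) p)"
      using no_zero by (auto intro!: arg_cong[of _ _ h])
    also have "\<dots> = 0"
      unfolding characterD(5)[OF h q inv] hq by simp
    finally show False
      using characterD(2)[OF h] by simp
  qed
  then obtain p where p: "p \<in> K" "q p = 0"
    by blast
  then have "\<forall>i\<in>I. (F i p - h (F i))\<^sup>2 = 0"
    using q_eq[OF p(1)] sum_nonneg_eq_0_iff[OF assms(2), of "\<lambda>i. (F i p - h (F i))\<^sup>2"] by simp
  then show ?thesis
    using that[of "snd p"] p(1) base_eq[OF F p(1)] by simp
qed

lemma base_coordinate_gens: "y \<in> Y \<Longrightarrow> base (coordinate_gens K i) y = y $ i"
  by (rule base_unique[OF coordinate_gens_mult_dom]) (auto simp: coordinate_gens_def pullback_def)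

lemma base_dom_alg_ops:
  assumes "y \<in> Y"
  shows "base (\<lambda>p\<in>K. c) y = c"
    "z \<in> D.mult_dom \<Longrightarrow> base (\<lambda>p\<in>K. r * z p) y = r * base z y"
    "z \<in> D.mult_dom \<Longrightarrow> w \<in> D.mult_dom \<Longrightarrow> base (\<lambda>p\<in>K. z p + w p) y = base z y + base w y"
    "z \<in> D.mult_dom \<Longrightarrow> w \<in> D.mult_dom \<Longrightarrow> base (\<lambda>p\<in>K. z p * w p) y = base z y * base w y"
proof -
  show "base (\<lambda>p\<in>K. c) y = c"
    by (rule base_unique[OF const_mult_dom assms]) simp
  show "base (\<lambda>p\<in>K. r * z p) y = r * base z y" if "z \<in> D.mult_dom"
    by (rule base_unique[OF mult_dom_closed(1)[OF that] assms]) (use base_eq[OF that] in auto)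
  assume zw: "z \<in> D.mult_dom" "w \<in> D.mult_dom"
  show "base (\<lambda>p\<in>K. z p + w p) y = base z y + base w y"
    by (rule base_unique[OF mult_dom_closed(3)[OF zw] assms]) (use base_eq[OF zw(1)] base_eq[OF zw(2)] in auto)
  show "base (\<lambda>p\<in>K. z p * w p) y = base z y * base w y"
    by (rule base_unique[OF mult_dom_closed(4)[OF zw] assms]) (use base_eq[OF zw(1)] base_eq[OF zw(2)] in auto)
qed

lemma ev_base_character:
  assumes "y \<in> Y"
  shows "ev_base y \<in> characters D.dom_alg"
proof -
  have "ev_base y \<in> ring_hom D.dom_alg real_ring"
    by (rule ring_hom_memI)
      (simp_all add: dom_alg_ops mult_dom_closed const_mult_dom base_dom_alg_ops[OF assms])
  then show ?thesis
    by (simp add: characters_def linear_functionals_def dom_alg_ops mult_dom_closed base_dom_alg_ops[OF assms])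
qed

lemma char_map_ev_base: "y \<in> Y \<Longrightarrow> D.char_map (ev_base y) = y"
  by (simp add: D.char_map_def vec_eq_iff coordinate_gens_mult_dom base_coordinate_gens)

lemma character_eq_ev_base:
  assumes h: "h \<in> characters D.dom_alg"
  shows "D.char_map h \<in> Y" "h = ev_base (D.char_map h)"
proof -
  \<comment> \<open>The coordinates determine the common zero, so one point serves all elements at once.\<close>
  have *: "D.char_map h \<in> Y \<and> base z (D.char_map h) = h z" if "z \<in> D.mult_dom" for z
  proof -
    define F where "F = case_option z (coordinate_gens K)"
    have "F i \<in> D.mult_dom" for i
      using that coordinate_gens_mult_dom by (simp add: F_def split: option.split)
    then obtain y where y: "y \<in> Y" "\<And>i. base (F i) y = h (F i)"
      using character_common_zero[OF h, of UNIV F] by auto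
    have "y $ i = h (coordinate_gens K i)" for i
      using y(2)[of "Some i"] base_coordinate_gens[OF y(1)] by (simp add: F_def)
    then have "D.char_map h = y"
      by (simp add: D.char_map_def vec_eq_iff)
    then show ?thesis
      using y(1) y(2)[of None] by (simp add: F_def)
  qed
  then show "D.char_map h \<in> Y"
    using const_mult_dom by blast
  show "h = ev_base (D.char_map h)"
    using * by (intro extensionalityI[OF characterD(1)[OF h]]) auto
qed

lemma char_map_image: "D.char_map ` characters D.dom_alg = Y"
  using character_eq_ev_base(1) ev_base_character char_map_ev_base by force

lemma gelfand_eq_base: "z \<in> D.mult_dom \<Longrightarrow> D.gelfand z = base z"
proof (rule extensionalityI[of _ Y])
  fix y assume z: "z \<in> D.mult_dom" and y: "y \<in> Y"
  have "inj_on D.char_map (characters D.dom_alg)"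
    by (rule inj_on_inverseI[of _ ev_base]) (use character_eq_ev_base(2) in simp)
  then have "inv_into (characters D.dom_alg) D.char_map y = ev_base y"
    using ev_base_character[OF y] char_map_ev_base[OF y] by (intro inv_into_f_eq)
  then show "D.gelfand z y = base z y"
    using z y by (simp add: D.gelfand_def)
qed (auto simp: D.gelfand_def base_def)

lemma topspace_characters:
  "topspace (subtopology (weak_star D.dom_alg) (characters D.dom_alg)) = characters D.dom_alg"
  using characterD(1) by (auto simp: weak_star_def dom_alg_ops(1) PiE_def)

lemma char_map_embedding:
  "embedding_map (subtopology (weak_star D.dom_alg) (characters D.dom_alg)) euclidean D.char_map"
proof -
  let ?T = "subtopology (weak_star D.dom_alg) (characters D.dom_alg)"
  have "continuous_map ?T euclidean D.char_map"
  proof -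
    have "continuous_map ?T euclideanreal (\<lambda>h. h (coordinate_gens K i))" for i
      unfolding weak_star_def dom_alg_ops(1)
      by (intro continuous_map_from_subtopology continuous_map_product_projection coordinate_gens_mult_dom)
    then show ?thesis
      unfolding continuous_map_atin D.char_map_def by (auto intro: tendsto_vec_lambda)
  qed
  then have 1: "continuous_map ?T (top_of_set Y) D.char_map"
    unfolding continuous_map_in_subtopology topspace_characters using character_eq_ev_base(1) by blast
  have "continuous_map (top_of_set Y) (weak_star D.dom_alg) ev_base"
    unfolding weak_star_def dom_alg_ops(1) continuous_map_componentwise
    using base_continuous by auto
  then have 2: "continuous_map (top_of_set Y) ?T ev_base"
    unfolding continuous_map_in_subtopology using ev_base_character by auto
  have "homeomorphic_maps ?T (top_of_set Y) D.char_map ev_base"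
    unfolding homeomorphic_maps_def topspace_characters
    using 1 2 char_map_ev_base character_eq_ev_base(2) by auto
  then show ?thesis
    unfolding embedding_map_def topspace_characters char_map_image
    by (rule homeomorphic_maps_imp_map)
qed

lemma polynomial_mem_subalgebra:
  assumes "submodule B real_ring D.dom_alg" "subring B D.dom_alg" "range (coordinate_gens K) \<subseteq> B"
    and "real_polynomial_function f"
  shows "pullback K f \<in> B"
  using assms(4)
proof induction
  interpret M: Module.module real_ring D.dom_alg
    by (rule module_dom_alg)
  note sub = M.submoduleE[OF assms(1)]
  have B: "B \<subseteq> D.mult_dom"
    using sub(1) by (simp add: dom_alg_ops(1))
  have B_add: "(\<lambda>p\<in>K. z p + w p) \<in> B" if "z \<in> B" "w \<in> B" for z w
    using sub(5)[OF that] by (simp add: dom_alg_ops(4))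
  have smult: "(\<lambda>p\<in>K. r * z p) \<in> B" if "z \<in> B" for r z
    using sub(4)[of r z] that by (simp add: dom_alg_ops(5))
  have one: "u \<in> B"
    using subringE(3)[OF assms(2)] by (simp add: dom_alg_ops(3))
  {
    case (linear f)
    have sum: "(\<lambda>p\<in>K. \<Sum>i\<in>I. r i * coordinate_gens K i p) \<in> B" if "finite I" for r I
      using that
    proof induction
      case empty
      show "(\<lambda>p\<in>K. \<Sum>i\<in>{}. r i * coordinate_gens K i p) \<in> B"
        using smult[OF one, of 0] by (simp cong: restrict_cong)
    next
      case (insert j I)
      have "(\<lambda>p\<in>K. (\<lambda>p\<in>K. r j * coordinate_gens K j p) p
          + (\<lambda>p\<in>K. \<Sum>i\<in>I. r i * coordinate_gens K i p) p) \<in> B"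
        using insert.IH assms(3) by (intro B_add smult) auto
      then show "(\<lambda>p\<in>K. \<Sum>i\<in>insert j I. r i * coordinate_gens K i p) \<in> B"
        using insert.hyps by (simp cong: restrict_cong)
    qed
    have f_eq: "f y = (\<Sum>i\<in>UNIV. f (axis i 1) * y $ i)" for y
    proof -
      interpret f: bounded_linear f
        by (rule linear)
      have "f y = f (\<Sum>i\<in>UNIV. y $ i *\<^sub>R axis i 1)"
        using arg_cong[OF basis_expansion[of y], of f] by (simp only: scalar_mult_eq_scaleR)
      then show ?thesis
        by (simp only: f.sum f.scale real_scaleR_def mult.commute)
    qed
    have "pullback K f = (\<lambda>p\<in>K. \<Sum>i\<in>UNIV. f (axis i 1) * coordinate_gens K i p)"
      unfolding pullback_def[of K f]
      by (rule restrict_ext) (subst f_eq, simp add: coordinate_gens_def pullback_def)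
    then show ?case
      using sum[OF finite] by (simp only:)
  next
    case (const c)
    have "pullback K (\<lambda>_. c) = (\<lambda>p\<in>K. c * u p)"
      by (auto simp: pullback_def)
    then show ?case
      using smult[OF one, of c] by (simp only:)
  next
    case (add f g)
    have "pullback K (\<lambda>y. f y + g y) = (\<lambda>p\<in>K. pullback K f p + pullback K g p)"
      by (auto simp: pullback_def)
    then show ?case
      using B_add[OF add.IH] by (simp only:)
  next
    case (mult f g)
    then have "pullback K f \<otimes>\<^bsub>D.dom_alg\<^esub> pullback K g = (\<lambda>p\<in>K. pullback K f p * pullback K g p)"
      using B by (intro dom_alg_ops(6)) auto
    also have "\<dots> = pullback K (\<lambda>y. f y * g y)"
      by (auto simp: pullback_def)
    finally show ?case
      using subringE(6)[OF assms(2) mult.IH] by (simp only:)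
  }
qed

text \<open>
  Stone--Weierstrass: a subalgebra that contains the coordinates contains the polynomials, which are
  dense in \<open>C(Y)\<close>.
\<close>

lemma cstar_generated_coordinate_gens:
  "cstar_generated D.dom_alg (ou_norm A P u) (\<lambda>z. z) (range (coordinate_gens K)) = D.mult_dom"
  (is "?G = _")
proof
  interpret M: Module.module real_ring D.dom_alg
    by (rule module_dom_alg)
  interpret R: cring D.dom_alg
    by (rule cring_dom_alg)
  have "subring D.mult_dom D.dom_alg"
    using R.carrier_is_subring by (simp add: dom_alg_ops(1))
  moreover have "submodule D.mult_dom real_ring D.dom_alg"
    using M.carrier_is_submodule by (simp add: dom_alg_ops(1))
  moreover have "closedin (mtopology_of (norm_metric D.dom_alg (ou_norm A P u))) D.mult_dom"
    using closedin_topspace[of "mtopology_of (norm_metric D.dom_alg (ou_norm A P u))"]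
    by (simp add: dom_norm_metric(1))
  ultimately show "?G \<subseteq> D.mult_dom"
    unfolding cstar_generated_def using coordinate_gens_mult_dom by (intro Inter_lower) auto
  show "D.mult_dom \<subseteq> ?G"
    unfolding cstar_generated_def
  proof (intro subsetI InterI)
    fix z B assume z: "z \<in> D.mult_dom"
      and "B \<in> {B. submodule B real_ring D.dom_alg \<and> subring B D.dom_alg \<and> (\<lambda>z. z) ` B \<subseteq> B \<and>
        closedin (mtopology_of (norm_metric D.dom_alg (ou_norm A P u))) B \<and> range (coordinate_gens K) \<subseteq> B}"
    then have B: "submodule B real_ring D.dom_alg" "subring B D.dom_alg" "range (coordinate_gens K) \<subseteq> B"
      and closed: "closedin (mtopology_of (norm_metric D.dom_alg (ou_norm A P u))) B"
      by auto
    show "z \<in> B"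
    proof (rule ccontr)
      assume "z \<notin> B"
      then obtain r where r: "0 < r" "\<And>b. b \<in> B \<Longrightarrow> r \<le> bound_norm K (\<lambda>p. z p - b p)"
        using closed z
        unfolding closedin_norm_metric_iff[OF mult_dom_subset dom_alg_ops(1) a_minus_dom_alg] by blast
      obtain f where f: "real_polynomial_function f" "\<And>y. y \<in> Y \<Longrightarrow> \<bar>base z y - f y\<bar> < r / 2"
        using Stone_Weierstrass_real_polynomial_function[OF compact_Y base_continuous[OF z], of "r/2"] r(1)
        by auto
      have "bound_norm K (\<lambda>p. z p - pullback K f p) \<le> r / 2"
      proof (rule bound_norm_le)
        show "\<bar>z p - pullback K f p\<bar> \<le> r / 2" if "p \<in> K" for p
          using f(2)[of "snd p"] that base_eq[OF z that] by (simp add: pullback_def)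
      qed (use r(1) in simp)
      then show False
        using r(2)[OF polynomial_mem_subalgebra[OF B f(1)]] r(1) by simp
    qed
  qed
qed

lemma gelfand_ring_iso: "D.gelfand \<in> ring_iso D.dom_alg (cont_alg Y)"
proof -
  have base_eq_restrict: "base z = (\<lambda>y\<in>Y. f y)" if "\<And>y. y \<in> Y \<Longrightarrow> base z y = f y" for z f
    using that by (auto simp: base_def restrict_def)
  have "D.gelfand \<in> ring_hom D.dom_alg (cont_alg Y)"
  proof (rule ring_hom_memI)
    fix z w assume "z \<in> carrier D.dom_alg" "w \<in> carrier D.dom_alg"
    then have zw: "z \<in> D.mult_dom" "w \<in> D.mult_dom"
      by (simp_all add: dom_alg_ops)
    show "D.gelfand z \<in> carrier (cont_alg Y)"
      using zw by (simp add: gelfand_eq_base base_closed)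
    show "D.gelfand (z \<otimes>\<^bsub>D.dom_alg\<^esub> w) = D.gelfand z \<otimes>\<^bsub>cont_alg Y\<^esub> D.gelfand w"
      using zw by (simp add: dom_alg_ops gelfand_eq_base mult_dom_closed(4) cont_alg_def) (intro base_eq_restrict, simp add: base_dom_alg_ops zw)
    show "D.gelfand (z \<oplus>\<^bsub>D.dom_alg\<^esub> w) = D.gelfand z \<oplus>\<^bsub>cont_alg Y\<^esub> D.gelfand w"
      using zw by (simp add: dom_alg_ops gelfand_eq_base mult_dom_closed(3) cont_alg_def) (intro base_eq_restrict, simp add: base_dom_alg_ops zw)
  next
    show "D.gelfand \<one>\<^bsub>D.dom_alg\<^esub> = \<one>\<^bsub>cont_alg Y\<^esub>"
      by (simp add: dom_alg_ops gelfand_eq_base const_mult_dom cont_alg_def) (intro base_eq_restrict, simp add: base_dom_alg_ops)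
  qed
  moreover have "bij_betw D.gelfand (carrier D.dom_alg) (carrier (cont_alg Y))"
    by (rule bij_betw_byWitness[of _ "pullback K"])
      (auto simp: dom_alg_ops gelfand_eq_base pullback_base base_pullback base_closed pullback_closed)
  ultimately show ?thesis
    by (simp add: ring_iso_def)
qed

lemma gelfand_smult:
  assumes "z \<in> D.mult_dom"
  shows "D.gelfand (r \<odot>\<^bsub>A\<^esub> z) = r \<odot>\<^bsub>cont_alg Y\<^esub> D.gelfand z"
proof (rule extensionalityI[of _ Y])
  show "D.gelfand (r \<odot>\<^bsub>A\<^esub> z) y = (r \<odot>\<^bsub>cont_alg Y\<^esub> D.gelfand z) y" if "y \<in> Y" for y
    using that assms
    by (simp add: Caff_ops(3) gelfand_eq_base mult_dom_closed(1) base_dom_alg_ops(2) cont_alg_def)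
qed (auto simp: D.gelfand_def cont_alg_def)

lemma gelfand_isometric:
  assumes "z \<in> D.mult_dom"
  shows "sup_norm Y (D.gelfand z) = ou_norm A P u z"
proof -
  have "sup_norm Y (base z) = bound_norm Y (base z)"
    using base_closed[OF assms] by (intro sup_norm_eq_bound_norm compact_Y) (auto simp: mem_cont_alg_iff)
  also have "\<dots> = bound_norm K (\<lambda>p. base z (snd p))"
    by (rule bound_norm_comp_snd[symmetric])
  also have "\<dots> = bound_norm K z"
    using base_eq[OF assms] by (intro bound_norm_cong) simp
  finally show ?thesis
    using assms by (simp add: gelfand_eq_base ou_norm_mult_dom)
qed

section \<open>A module basis\<close>

lemma dom_module_ops:
  "carrier D.dom_module = carrier A" "\<zero>\<^bsub>D.dom_module\<^esub> = (\<lambda>p\<in>K. 0)"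
  "a \<oplus>\<^bsub>D.dom_module\<^esub> b = (\<lambda>p\<in>K. a p + b p)"
  "z \<in> D.mult_dom \<Longrightarrow> a \<in> carrier A \<Longrightarrow> z \<odot>\<^bsub>D.dom_module\<^esub> a = (\<lambda>p\<in>K. z p * a p)"
  by (simp_all add: D.dom_module_def Caff_ops kprod_eq)

lemma module_dom_module: "Module.module D.dom_alg D.dom_module"
proof (rule moduleI[OF cring_dom_alg])
  show "abelian_group D.dom_module"
  proof (rule abelian_groupI)
    fix a assume a: "a \<in> carrier D.dom_module"
    then show "\<zero>\<^bsub>D.dom_module\<^esub> \<oplus>\<^bsub>D.dom_module\<^esub> a = a"
      by (simp add: dom_module_ops restrict_Caff cong: restrict_cong)
    show "\<exists>b\<in>carrier D.dom_module. b \<oplus>\<^bsub>D.dom_module\<^esub> a = \<zero>\<^bsub>D.dom_module\<^esub>"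
      using a uminus_closed[of a] by (intro bexI[of _ "\<lambda>p\<in>K. - a p"]) (auto simp: dom_module_ops)
  qed (auto simp: dom_module_ops const_closed add_closed add_ac)
qed (auto simp: dom_module_ops dom_alg_ops mult_domD mult_dom_closed const_mult_dom add_closed
    algebra_simps restrict_Caff cong: restrict_cong)

lemma finsum_dom_module:
  assumes "finite I" "h \<in> I \<rightarrow> carrier A"
  shows "(\<Oplus>\<^bsub>D.dom_module\<^esub>i\<in>I. h i) = (\<lambda>p\<in>K. \<Sum>i\<in>I. h i p)"
  using assms
proof (induction I rule: finite_induct)
  interpret M: Module.module D.dom_alg D.dom_module
    by (rule module_dom_module)
  {
    case empty
    then show ?case
      by (simp add: dom_module_ops)
  next
    case (insert j I)
    then have "(\<Oplus>\<^bsub>D.dom_module\<^esub>i\<in>insert j I. h i) = h j \<oplus>\<^bsub>D.dom_module\<^esub> (\<Oplus>\<^bsub>D.dom_module\<^esub>i\<in>I. h i)"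
      by (intro M.finsum_insert) (auto simp: dom_module_ops)
    also have "\<dots> = (\<lambda>p\<in>K. \<Sum>i\<in>insert j I. h i p)"
      using insert by (simp add: dom_module_ops cong: restrict_cong)
    finally show "(\<Oplus>\<^bsub>D.dom_module\<^esub>i\<in>insert j I. h i) = (\<lambda>p\<in>K. \<Sum>i\<in>insert j I. h i p)" .
  }
qed

text \<open>
  The choice is unique on the indices up to \<open>n\<close> because fibres have interior points.
\<close>

definition coef :: "((real ^ 'n) \<times> (real ^ 'm) \<Rightarrow> real) \<Rightarrow> real ^ 'm \<Rightarrow> nat \<Rightarrow> real" where
  "coef a y = (SOME k. \<forall>x\<in>fibre K y. a (x, y) = affine_comb k x)"

lemma ball_in_fibre:
  assumes "y \<in> Y"
  obtains x \<epsilon> where "0 < \<epsilon>" "cball x \<epsilon> \<subseteq> fibre K y"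
  using interior_fibre_nonempty[OF assms] mem_interior_cball by blast

lemma coef_spec:
  assumes a: "a \<in> carrier A" and "(x, y) \<in> K"
  shows "a (x, y) = affine_comb (coef a y) x"
proof -
  have y: "y \<in> Y"
    using assms(2) by force
  obtain x0 \<epsilon> where ball: "0 < \<epsilon>" "cball x0 \<epsilon> \<subseteq> fibre K y"
    using ball_in_fibre[OF y] by blast
  have "\<forall>x\<in>fibre K y. a (x, y) = affine_comb (affine_coeff x0 \<epsilon> (\<lambda>x. a (x, y))) x"
    using affine_comb_affine_coeff[OF ball carrier_CaffD(3)[OF a y]] by simp
  then have "\<forall>x\<in>fibre K y. a (x, y) = affine_comb (coef a y) x"
    unfolding coef_def by (rule someI[where P = "\<lambda>k. \<forall>x\<in>fibre K y. a (x, y) = affine_comb k x"])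
  then show ?thesis
    using assms(2) by (simp add: mem_fibre_iff)
qed

lemma coef_eq_affine_coeff:
  assumes "a \<in> carrier A" "0 < \<epsilon>" "cball x \<epsilon> \<subseteq> fibre K y" "i \<le> CARD('n)"
  shows "coef a y i = affine_coeff x \<epsilon> (\<lambda>x. a (x, y)) i"
  by (rule affine_coeff_affine_comb[symmetric, OF assms(2,3) _ assms(4)])
    (use coef_spec[OF assms(1)] in \<open>simp add: mem_fibre_iff\<close>)

lemma coef_unique:
  assumes "a \<in> carrier A" "y \<in> Y" "\<And>x. (x, y) \<in> K \<Longrightarrow> a (x, y) = affine_comb k x" "i \<le> CARD('n)"
  shows "coef a y i = k i"
proof -
  obtain x \<epsilon> where ball: "0 < \<epsilon>" "cball x \<epsilon> \<subseteq> fibre K y"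
    using ball_in_fibre[OF assms(2)] by blast
  have "coef a y i = affine_coeff x \<epsilon> (\<lambda>x. a (x, y)) i"
    using assms(1) ball assms(4) by (rule coef_eq_affine_coeff)
  also have "\<dots> = k i"
    using ball assms(3,4) by (intro affine_coeff_affine_comb) (auto simp: mem_fibre_iff)
  finally show ?thesis .
qed

text \<open>
  Near a given point of \<open>Y\<close> one ball lies in all fibres, so the coefficients are given there by one
  formula in the values of \<open>a\<close> at fixed \<open>x\<close>, each of which is continuous in \<open>y\<close>.
\<close>

lemma continuous_on_coef:
  assumes a: "a \<in> carrier A" and i: "i \<le> CARD('n)"
  shows "continuous_on Y (\<lambda>y. coef a y i)"
  unfolding continuous_on_eq_continuous_within
proof
  fix y assume y: "y \<in> Y"
  obtain x where x: "x \<in> interior (fibre K y)"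
    using interior_fibre_nonempty[OF y] by blast
  obtain \<epsilon> d where \<epsilon>: "0 < \<epsilon>" "0 < d"
    and ball: "\<And>y'. y' \<in> Y \<Longrightarrow> dist y' y < d \<Longrightarrow> cball x \<epsilon> \<subseteq> fibre K y'"
    using fibres_contain_common_ball[OF y x] by blast
  let ?U = "Y \<inter> ball y d"
  have cont: "continuous_on ?U (\<lambda>y'. a (w, y'))" if "w \<in> cball x \<epsilon>" for w
  proof -
    have "(\<lambda>y'. (w, y')) ` ?U \<subseteq> K"
    proof (rule image_subsetI)
      fix y' assume "y' \<in> ?U"
      then have "cball x \<epsilon> \<subseteq> fibre K y'"
        by (intro ball) (auto simp: dist_commute)
      then show "(w, y') \<in> K"
        using that mem_fibre_iff by blast
    qed
    then show ?thesis
      by (intro continuous_on_compose2[OF carrier_CaffD(2)[OF a]] continuous_intros)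
  qed
  have mem: "x \<in> cball x \<epsilon>" "x + \<epsilon> *\<^sub>R axis l 1 \<in> cball x \<epsilon>" for l
    using \<epsilon>(1) by (auto simp: dist_norm)
  have "continuous_on ?U (\<lambda>y'. affine_coeff x \<epsilon> (\<lambda>x. a (x, y')) i)"
    using \<epsilon>(1) by (cases i) (auto simp: affine_coeff_def intro!: continuous_intros cont mem)
  then have "continuous (at y within ?U) (\<lambda>y'. affine_coeff x \<epsilon> (\<lambda>x. a (x, y')) i)"
    using y \<epsilon>(2) by (simp add: continuous_on_eq_continuous_within)
  moreover have "at y within ?U = at y within Y"
    by (rule at_within_nhd[of _ "ball y d"]) (use \<epsilon>(2) in auto)
  ultimately have "continuous (at y within Y) (\<lambda>y'. affine_coeff x \<epsilon> (\<lambda>x. a (x, y')) i)"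
    by (simp only:)
  then show "continuous (at y within Y) (\<lambda>y'. coef a y' i)"
    by (rule continuous_transform_within[OF _ \<epsilon>(2) y])
      (use coef_eq_affine_coeff[OF a \<epsilon>(1) ball i] in simp)
qed

lemma coef_diff:
  assumes "a \<in> carrier A" "b \<in> carrier A" "y \<in> Y" "i \<le> CARD('n)"
  shows "coef (\<lambda>p\<in>K. a p - b p) y i = coef a y i - coef b y i"
proof (rule coef_unique[OF diff_closed[OF assms(1,2)] assms(3) _ assms(4)])
  fix x assume "(x, y) \<in> K"
  then show "(\<lambda>p\<in>K. a p - b p) (x, y) = affine_comb (\<lambda>i. coef a y i - coef b y i) x"
    using coef_spec[OF assms(1), of x y] coef_spec[OF assms(2), of x y]
    by (simp add: affine_comb_def left_diff_distrib sum_subtractf)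
qed

lemma abs_affine_gen_le:
  fixes x :: "real ^ 'd"
  assumes "0 \<le> R" "norm x \<le> R"
  shows "\<bar>affine_gen i x\<bar> \<le> 1 + R"
proof (cases i)
  case (Suc j)
  have "\<bar>x $ coord j\<bar> \<le> R"
    using component_le_norm_cart assms(2) by (rule order.trans)
  then show ?thesis
    using Suc by (simp add: affine_gen_def)
qed (use assms(1) in \<open>simp add: affine_gen_def\<close>)

lemma fibre_bounded_by:
  obtains R where "0 \<le> R" "\<And>x y. (x, y) \<in> K \<Longrightarrow> norm x \<le> R"
proof -
  have "bounded (fst ` K)"
    using compact_K by (intro compact_imp_bounded compact_continuous_image continuous_intros)
  then obtain R where "0 < R" "\<And>x. x \<in> fst ` K \<Longrightarrow> norm x \<le> R"
    unfolding bounded_pos by auto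
  then show ?thesis
    by (intro that[of R]) force+
qed

text \<open>
  The bound \<open>r\<close> refers to one fibre only, so that the lemma controls coefficients both by the norm of
  the whole space and by the norms of the quotients.
\<close>

lemma coef_bound:
  obtains C where "0 \<le> C"
    "\<And>a y i r. a \<in> carrier A \<Longrightarrow> y \<in> Y \<Longrightarrow> i \<le> CARD('n) \<Longrightarrow> (\<And>x. (x, y) \<in> K \<Longrightarrow> \<bar>a (x, y)\<bar> \<le> r)
      \<Longrightarrow> \<bar>coef a y i\<bar> \<le> C * r"
proof -
  obtain R where R: "0 \<le> R" "\<And>x y. (x, y) \<in> K \<Longrightarrow> norm x \<le> R"
    using fibre_bounded_by by blast
  obtain \<delta> where \<delta>: "0 < \<delta>" "\<And>y. y \<in> Y \<Longrightarrow> \<exists>x. cball x \<delta> \<subseteq> fibre K y"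
    using fibres_contain_uniform_ball by blast
  show ?thesis
  proof (rule that)
    show "0 \<le> 1 + 2 / \<delta> * (1 + real CARD('n) * R)"
      using R(1) \<delta>(1) by simp
    fix a y i r
    assume a: "a \<in> carrier A" and y: "y \<in> Y" and i: "i \<le> CARD('n)"
      and r: "\<And>x. (x, y) \<in> K \<Longrightarrow> \<bar>a (x, y)\<bar> \<le> r"
    obtain x where x: "cball x \<delta> \<subseteq> fibre K y"
      using \<delta>(2)[OF y] by blast
    then have "(x, y) \<in> K"
      using \<delta>(1) by (auto simp: mem_fibre_iff dest: subsetD[of _ _ x])
    then show "\<bar>coef a y i\<bar> \<le> (1 + 2 / \<delta> * (1 + real CARD('n) * R)) * r"
      unfolding coef_eq_affine_coeff[OF a \<delta>(1) x i]
      using R(2) r x by (intro abs_affine_coeff_le[OF \<delta>(1)]) (auto simp: mem_fibre_iff)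
  qed
qed

definition gen :: "nat \<Rightarrow> (real ^ 'n) \<times> (real ^ 'm) \<Rightarrow> real" where
  "gen i = (\<lambda>p\<in>K. affine_gen i (fst p))"

definition coef_comb :: "(nat \<Rightarrow> real ^ 'm \<Rightarrow> real) \<Rightarrow> (real ^ 'n) \<times> (real ^ 'm) \<Rightarrow> real" where
  "coef_comb f = (\<lambda>p\<in>K. affine_comb (\<lambda>i. f i (snd p)) (fst p))"

lemma continuous_on_affine_gen: "continuous_on S (affine_gen i)"
  unfolding affine_gen_def by (cases i) (auto intro!: continuous_intros)

lemma coef_comb_closed:
  assumes "\<And>i. i \<le> CARD('n) \<Longrightarrow> continuous_on Y (f i)"
  shows "coef_comb f \<in> carrier A"
  unfolding coef_comb_def
proof (rule carrier_CaffI)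
  have "continuous_on K (\<lambda>p. f i (snd p))" if "i \<le> CARD('n)" for i
    by (rule continuous_on_compose2[OF assms[OF that]]) (auto intro!: continuous_intros)
  moreover have "continuous_on K (\<lambda>p. affine_gen i (fst p))" for i
    by (rule continuous_on_compose2[OF continuous_on_affine_gen[of UNIV]]) (auto intro!: continuous_intros)
  ultimately show "continuous_on K (\<lambda>p. affine_comb (\<lambda>i. f i (snd p)) (fst p))"
    unfolding affine_comb_def by (intro continuous_on_sum continuous_on_mult) auto
  show "affine_fun_on (fibre K y) (\<lambda>x. affine_comb (\<lambda>i. f i (snd (x, y))) (fst (x, y)))" for y
    using affine_fun_on_affine_comb by simp
qed

lemma coef_coef_comb:
  assumes "\<And>i. i \<le> CARD('n) \<Longrightarrow> continuous_on Y (f i)" "y \<in> Y" "i \<le> CARD('n)"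
  shows "coef (coef_comb f) y i = f i y"
  by (rule coef_unique[OF coef_comb_closed[OF assms(1)] assms(2) _ assms(3)]) (simp_all add: coef_comb_def)

lemma coef_comb_coef:
  assumes "a \<in> carrier A"
  shows "coef_comb (\<lambda>i y. coef a y i) = a"
  using carrier_CaffD(1)[OF assms] coef_spec[OF assms]
  by (intro extensionalityI[of _ K]) (auto simp: coef_comb_def)

lemma coef_comb_cong:
  "(\<And>i y. i \<le> CARD('n) \<Longrightarrow> y \<in> Y \<Longrightarrow> f i y = g i y) \<Longrightarrow> coef_comb f = coef_comb g"
  unfolding coef_comb_def affine_comb_def by (intro restrict_ext sum.cong) auto

lemma gen_closed: "gen i \<in> carrier A"
proof -
  have "affine_fun_on S (affine_gen i)" for S :: "(real ^ 'n) set"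
    by (cases i) (auto simp: affine_fun_on_def affine_gen_def algebra_simps)
  then show ?thesis
    unfolding gen_def
    by (intro carrier_CaffI continuous_on_compose2[OF continuous_on_affine_gen[of UNIV]])
      (auto intro!: continuous_intros)
qed

lemma finsum_gen:
  assumes "c \<in> {..CARD('n)} \<rightarrow> D.mult_dom"
  shows "(\<Oplus>\<^bsub>D.dom_module\<^esub>i\<in>{..CARD('n)}. c i \<odot>\<^bsub>D.dom_module\<^esub> gen i) = coef_comb (\<lambda>i. base (c i))"
proof -
  have c: "c i \<in> D.mult_dom" if "i \<le> CARD('n)" for i
    using assms that by auto
  have "(\<Oplus>\<^bsub>D.dom_module\<^esub>i\<in>{..CARD('n)}. c i \<odot>\<^bsub>D.dom_module\<^esub> gen i)
      = (\<lambda>p\<in>K. \<Sum>i\<le>CARD('n). (c i \<odot>\<^bsub>D.dom_module\<^esub> gen i) p)"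
    by (rule finsum_dom_module) (auto simp: dom_module_ops c gen_closed mult_domD)
  also have "(c i \<odot>\<^bsub>D.dom_module\<^esub> gen i) p = base (c i) (snd p) * affine_gen i (fst p)"
    if "i \<le> CARD('n)" "p \<in> K" for i p
    using that by (simp add: dom_module_ops(4)[OF c gen_closed] base_eq[OF c]) (simp add: gen_def)
  then have "(\<lambda>p\<in>K. \<Sum>i\<le>CARD('n). (c i \<odot>\<^bsub>D.dom_module\<^esub> gen i) p) = coef_comb (\<lambda>i. base (c i))"
    unfolding coef_comb_def affine_comb_def by (intro restrict_ext sum.cong) auto
  finally show ?thesis .
qed

definition coef_elem :: "((real ^ 'n) \<times> (real ^ 'm) \<Rightarrow> real) \<Rightarrow> nat \<Rightarrow> (real ^ 'n) \<times> (real ^ 'm) \<Rightarrow> real" where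
  "coef_elem a = (\<lambda>i\<in>{..CARD('n)}. \<lambda>p\<in>K. coef a (snd p) i)"

lemma coef_elem_closed:
  assumes "a \<in> carrier A" "i \<le> CARD('n)"
  shows "coef_elem a i \<in> D.mult_dom"
  using mult_domI[OF continuous_on_coef[OF assms]] assms(2) by (simp add: coef_elem_def)

lemma base_coef_elem:
  assumes "a \<in> carrier A" "i \<le> CARD('n)" "y \<in> Y"
  shows "base (coef_elem a i) y = coef a y i"
  using base_unique[OF coef_elem_closed[OF assms(1,2)] assms(3)] assms(2) by (auto simp: coef_elem_def)

lemma basis_representation_iff:
  assumes "a \<in> carrier A"
  shows "c \<in> {..CARD('n)} \<rightarrow>\<^sub>E carrier D.dom_alg \<and>
      a = (\<Oplus>\<^bsub>D.dom_module\<^esub>i\<in>{..CARD('n)}. c i \<odot>\<^bsub>D.dom_module\<^esub> gen i) \<longleftrightarrow> c = coef_elem a"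
proof
  assume c: "c \<in> {..CARD('n)} \<rightarrow>\<^sub>E carrier D.dom_alg \<and>
      a = (\<Oplus>\<^bsub>D.dom_module\<^esub>i\<in>{..CARD('n)}. c i \<odot>\<^bsub>D.dom_module\<^esub> gen i)"
  then have c_dom: "c i \<in> D.mult_dom" if "i \<le> CARD('n)" for i
    using that by (auto simp: dom_alg_ops(1))
  have a_eq: "a = coef_comb (\<lambda>i. base (c i))"
    using c finsum_gen[of c] c_dom by auto
  show "c = coef_elem a"
  proof (rule extensionalityI[of _ "{..CARD('n)}"])
    fix i assume "i \<in> {..CARD('n)}"
    then have i: "i \<le> CARD('n)"
      by simp
    show "c i = coef_elem a i"
    proof (rule mult_dom_eqI[OF c_dom[OF i] coef_elem_closed[OF assms i]])
      fix p assume p: "p \<in> K"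
      then have "coef a (snd p) i = base (c i) (snd p)"
        unfolding a_eq using coef_coef_comb[of "\<lambda>i. base (c i)"] c_dom base_continuous i by auto
      then show "c i p = coef_elem a i p"
        using p i base_eq[OF c_dom[OF i] p] by (simp add: coef_elem_def)
    qed
  qed (use c in \<open>auto simp: coef_elem_def PiE_def\<close>)
next
  assume c: "c = coef_elem a"
  have "coef_comb (\<lambda>i. base (coef_elem a i)) = a"
    using coef_comb_cong[of "\<lambda>i. base (coef_elem a i)" "\<lambda>i y. coef a y i"]
      base_coef_elem[OF assms] coef_comb_coef[OF assms] by simp
  then show "c \<in> {..CARD('n)} \<rightarrow>\<^sub>E carrier D.dom_alg \<and>
      a = (\<Oplus>\<^bsub>D.dom_module\<^esub>i\<in>{..CARD('n)}. c i \<odot>\<^bsub>D.dom_module\<^esub> gen i)"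
    unfolding c using finsum_gen[of "coef_elem a"] coef_elem_closed[OF assms]
    by (auto simp: dom_alg_ops(1) coef_elem_def)
qed

lemma free_basis_gen: "free_basis D.dom_alg D.dom_module {..CARD('n)} gen"
  unfolding free_basis_def using gen_closed
  by (auto simp: basis_representation_iff dom_module_ops(1))

lemma gen_0: "gen 0 = u"
  by (simp add: gen_def affine_gen_def)

lemma gelfand_coordinates:
  assumes "a \<in> carrier A" "i \<le> CARD('n)"
  shows "D.gelfand (coordinates D.dom_alg D.dom_module {..CARD('n)} gen a i) = (\<lambda>y\<in>Y. coef a y i)"
proof -
  have "coordinates D.dom_alg D.dom_module {..CARD('n)} gen a = coef_elem a"
    unfolding coordinates_def basis_representation_iff[OF assms(1)] by simp
  then have "D.gelfand (coordinates D.dom_alg D.dom_module {..CARD('n)} gen a i) = base (coef_elem a i)"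
    using gelfand_eq_base coef_elem_closed[OF assms] by simp
  also have "\<dots> = (\<lambda>y\<in>Y. coef a y i)"
  proof (rule extensionalityI[of _ Y])
    show "base (coef_elem a i) \<in> extensional Y"
      by (simp add: base_def)
  qed (simp_all add: base_coef_elem[OF assms])
  finally show ?thesis .
qed

lemma a_minus_Caff_ball: "\<forall>a\<in>carrier A. \<forall>b\<in>carrier A. a \<ominus>\<^bsub>A\<^esub> b = (\<lambda>p\<in>K. a p - b p)"
  using a_minus_Caff by blast

lemmas Caff_norm_metric = norm_metric_eq[OF subset_refl refl a_minus_Caff_ball]

lemma mspace_cont_metric_Y: "mspace (cont_metric Y) = carrier (cont_alg Y)"
  by (simp add: cont_alg_def)

text \<open>
  Passing to the coefficients is Lipschitz by the uniform bound on them. The inverse is a finite sum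
  of products with the basis elements, which are bounded because \<open>K\<close> is.
\<close>

lemma coordinates_homeomorphism:
  "homeomorphic_map (mtopology_of (norm_metric A (ou_norm A P u)))
     (product_topology (\<lambda>_. mtopology_of (cont_metric Y)) {..CARD('n)})
     (\<lambda>a. \<lambda>i\<in>{..CARD('n)}. D.gelfand (coordinates D.dom_alg D.dom_module {..CARD('n)} gen a i))"
proof -
  let ?m = "norm_metric A (ou_norm A P u)"
  let ?I = "{..CARD('n)}"
  let ?Z = "product_topology (\<lambda>_. mtopology_of (cont_metric Y)) ?I"
  define \<Phi> where "\<Phi> a = (\<lambda>i\<in>?I. \<lambda>y\<in>Y. coef a y i)" for a
  have cf: "(\<lambda>y\<in>Y. coef a y i) \<in> carrier (cont_alg Y)" if "a \<in> carrier A" "i \<in> ?I" for a i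
    using continuous_on_coef[OF that(1), of i] that(2) by (simp add: mem_cont_alg_iff cong: continuous_on_cong)
  have top_Z: "topspace ?Z = ?I \<rightarrow>\<^sub>E carrier (cont_alg Y)"
    by (simp add: mspace_cont_metric_Y del: mspace_cfunspace)
  obtain C where C: "0 \<le> C"
    "\<And>a y i r. a \<in> carrier A \<Longrightarrow> y \<in> Y \<Longrightarrow> i \<le> CARD('n) \<Longrightarrow> (\<And>x. (x, y) \<in> K \<Longrightarrow> \<bar>a (x, y)\<bar> \<le> r)
      \<Longrightarrow> \<bar>coef a y i\<bar> \<le> C * r"
    using coef_bound by blast
  have "continuous_map (mtopology_of ?m) (mtopology_of (cont_metric Y)) (\<lambda>a. \<lambda>y\<in>Y. coef a y i)"
    if i: "i \<in> ?I" for i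
  proof (rule Lipschitz_continuous_imp_continuous_map)
    have "mdist (cont_metric Y) (\<lambda>y\<in>Y. coef a y i) (\<lambda>y\<in>Y. coef b y i) \<le> C * mdist ?m a b"
      if ab: "a \<in> carrier A" "b \<in> carrier A" for a b
    proof -
      note diff = diff_closed[OF ab]
      have r: "bound_norm K (\<lambda>p\<in>K. a p - b p) = mdist ?m a b"
        unfolding Caff_norm_metric(2)[OF ab] by (rule bound_norm_cong) simp
      have "0 \<le> mdist ?m a b"
        using bound_norm_nonneg[OF carrier_CaffD(4)[OF diff]] unfolding r .
      then have "bound_norm Y (\<lambda>y. (\<lambda>y\<in>Y. coef a y i) y - (\<lambda>y\<in>Y. coef b y i) y) \<le> C * mdist ?m a b"
      proof (intro bound_norm_le)
        fix y assume y: "y \<in> Y"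
        have "\<bar>coef (\<lambda>p\<in>K. a p - b p) y i\<bar> \<le> C * mdist ?m a b"
          using i le_bound_norm[OF carrier_CaffD(4)[OF diff]] unfolding r
          by (intro C(2)[OF diff y]) auto
        then show "\<bar>(\<lambda>y\<in>Y. coef a y i) y - (\<lambda>y\<in>Y. coef b y i) y\<bar> \<le> C * mdist ?m a b"
          using coef_diff[OF ab y, of i] i y by simp
      qed (use C(1) in simp)
      then show ?thesis
        unfolding mdist_cont_metric[OF compact_Y cf[OF ab(1) i, folded mspace_cont_metric_Y]
            cf[OF ab(2) i, folded mspace_cont_metric_Y]] .
    qed
    then show "Lipschitz_continuous_map ?m (cont_metric Y) (\<lambda>a. \<lambda>y\<in>Y. coef a y i)"
      unfolding Lipschitz_continuous_map_def mspace_cont_metric_Y Caff_norm_metric(1)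
      using cf[OF _ i] by blast
  qed
  then have cont_\<Phi>: "continuous_map (mtopology_of ?m) ?Z \<Phi>"
    unfolding continuous_map_componentwise by (auto simp: \<Phi>_def)
  obtain R where R: "0 \<le> R" "\<And>x y. (x, y) \<in> K \<Longrightarrow> norm x \<le> R"
    using fibre_bounded_by by blast
  have gen_bound: "\<bar>affine_gen i (fst p)\<bar> \<le> 1 + R" if "p \<in> K" for i p
    using R(2)[of "fst p" "snd p"] that by (intro abs_affine_gen_le R(1)) simp
  interpret N: Metric_space "mspace ?m" "mdist ?m"
    by (rule Metric_space_mspace_mdist)
  interpret C: Metric_space "mspace (cont_metric Y)" "mdist (cont_metric Y)"
    by (rule Metric_space_mspace_mdist)
  have \<Psi>_closed: "coef_comb f \<in> carrier A" if "f \<in> topspace ?Z" for f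
    using that unfolding top_Z by (intro coef_comb_closed) (auto simp: mem_cont_alg_iff PiE_def Pi_def)
  have "continuous_map ?Z N.mtopology coef_comb"
    unfolding N.continuous_map_to_metric
  proof (intro ballI allI impI)
    fix f and e :: real
    assume f: "f \<in> topspace ?Z" and "0 < e"
    \<comment> \<open>A bound for the sum of the absolute values of the basis elements.\<close>
    define M where "M = real (Suc CARD('n)) * (1 + R)"
    have "0 < M"
      using R(1) by (simp add: M_def)
    define \<eta> where "\<eta> = e / (2 * M)"
    have \<eta>: "0 < \<eta>"
      using \<open>0 < e\<close> \<open>0 < M\<close> by (simp add: \<eta>_def)
    define U where "U = (\<Pi>\<^sub>E i\<in>?I. C.mball (f i) \<eta>)"
    have "openin ?Z U"
      unfolding U_def openin_PiE[OF finite_atMost] mtopology_of_def using C.openin_mball by blast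
    moreover have "f \<in> U"
    proof -
      have "f i \<in> C.mball (f i) \<eta>" if "i \<in> ?I" for i
        unfolding C.centre_in_mball_iff unfolding mspace_cont_metric_Y
        using f that \<eta> unfolding top_Z by blast
      then show ?thesis
        unfolding U_def using f unfolding top_Z by (auto simp: PiE_def)
    qed
    moreover have "coef_comb h \<in> N.mball (coef_comb f) e" if h: "h \<in> U" for h
    proof -
      have h_top: "h \<in> topspace ?Z"
        using openin_subset[OF \<open>openin ?Z U\<close>] h by blast
      have close: "\<bar>f i y - h i y\<bar> \<le> \<eta>" if "i \<in> ?I" "y \<in> Y" for i y
      proof -
        have "f i \<in> mspace (cont_metric Y)" "h i \<in> mspace (cont_metric Y)" "mdist (cont_metric Y) (f i) (h i) \<le> \<eta>"
          using h \<open>i \<in> ?I\<close> unfolding U_def by (auto simp: PiE_def Pi_def C.in_mball simp del: mspace_cfunspace)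
        then show ?thesis
          using mdist_cfunspace_imp_mdist_le[of "f i" "top_of_set Y" euclidean_metric "h i" \<eta> y] \<open>y \<in> Y\<close>
          by (simp add: dist_real_def del: mspace_cfunspace)
      qed
      have "bound_norm K (\<lambda>p. coef_comb f p - coef_comb h p) \<le> e / 2"
      proof (rule bound_norm_le)
        fix p assume p: "p \<in> K"
        have "\<bar>(f i (snd p) - h i (snd p)) * affine_gen i (fst p)\<bar> \<le> \<eta> * (1 + R)" if "i \<in> ?I" for i
          unfolding abs_mult using close[OF that, of "snd p"] gen_bound[OF p] p \<eta> by (intro mult_mono) auto
        then have "\<bar>\<Sum>i\<in>?I. (f i (snd p) - h i (snd p)) * affine_gen i (fst p)\<bar> \<le> (\<Sum>i\<in>?I. \<eta> * (1 + R))"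
          by (intro order.trans[OF sum_abs] sum_mono)
        also have "\<dots> = M * \<eta>"
          by (simp add: M_def)
        also have "\<dots> = e / 2"
          using \<open>0 < M\<close> by (simp add: \<eta>_def)
        finally show "\<bar>coef_comb f p - coef_comb h p\<bar> \<le> e / 2"
          using p by (simp add: coef_comb_def affine_comb_def left_diff_distrib sum_subtractf)
      qed (use \<open>0 < e\<close> in simp)
      then show ?thesis
        unfolding N.in_mball unfolding Caff_norm_metric(1)
        using Caff_norm_metric(2)[OF \<Psi>_closed[OF f] \<Psi>_closed[OF h_top]] \<Psi>_closed[OF f] \<Psi>_closed[OF h_top] \<open>0 < e\<close>
        by simp
    qed
    ultimately show "\<exists>U. openin ?Z U \<and> f \<in> U \<and> (\<forall>h\<in>U. coef_comb h \<in> N.mball (coef_comb f) e)"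
      by blast
  qed
  then have cont_\<Psi>: "continuous_map ?Z (mtopology_of ?m) coef_comb"
    by (simp add: mtopology_of_def)
  have "coef_comb (\<Phi> a) = a" if "a \<in> carrier A" for a
    using coef_comb_cong[of "\<Phi> a" "\<lambda>i y. coef a y i"] coef_comb_coef[OF that] by (simp add: \<Phi>_def)
  moreover have "\<Phi> (coef_comb f) = f" if "f \<in> ?I \<rightarrow>\<^sub>E carrier (cont_alg Y)" for f
  proof (rule PiE_ext[OF _ that])
    have f: "f i \<in> carrier (cont_alg Y)" if "i \<le> CARD('n)" for i
      using \<open>f \<in> _\<close> that by auto
    show "\<Phi> (coef_comb f) \<in> ?I \<rightarrow>\<^sub>E carrier (cont_alg Y)"
      using cf[OF \<Psi>_closed] that unfolding top_Z by (auto simp: \<Phi>_def)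
    fix i assume i: "i \<in> ?I"
    show "\<Phi> (coef_comb f) i = f i"
    proof (rule extensionalityI[of _ Y])
      show "\<Phi> (coef_comb f) i y = f i y" if "y \<in> Y" for y
        using coef_coef_comb[of f y i] f i that by (simp add: \<Phi>_def mem_cont_alg_iff)
    qed (use f[of i] i in \<open>auto simp: \<Phi>_def mem_cont_alg_iff\<close>)
  qed
  ultimately have "homeomorphic_maps (mtopology_of ?m) ?Z \<Phi> coef_comb"
    unfolding homeomorphic_maps_def using cont_\<Phi> cont_\<Psi> by (simp only: top_Z topspace_mtopology_of Caff_norm_metric) blast
  then have "homeomorphic_map (mtopology_of ?m) ?Z \<Phi>"
    by (rule homeomorphic_maps_imp_map)
  then show ?thesis
  proof (rule homeomorphic_map_eq)
    fix a assume "a \<in> topspace (mtopology_of ?m)"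
    then have "a \<in> carrier A"
      by (simp add: Caff_norm_metric)
    then show "\<Phi> a = (\<lambda>i\<in>?I. D.gelfand (coordinates D.dom_alg D.dom_module ?I gen a i))"
      unfolding \<Phi>_def by (intro restrict_ext) (simp add: gelfand_coordinates)
  qed
qed

section \<open>The quotient over a point\<close>

lemma ball_fibre: "(\<forall>x\<in>fibre K y. Q x) \<longleftrightarrow> (\<forall>x. (x, y) \<in> K \<longrightarrow> Q x)"
  by (simp add: fibre_def)

text \<open>
  It will turn out that the closed order ideal over \<open>y\<close> consists of the functions that vanish on the
  fibre over \<open>y\<close>, so that the quotient is the space of affine functions on this fibre.
\<close>

definition vanishing :: "real ^ 'm \<Rightarrow> ((real ^ 'n) \<times> (real ^ 'm) \<Rightarrow> real) set" where
  "vanishing y = {a \<in> carrier A. \<forall>x\<in>fibre K y. a (x, y) = 0}"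

lemma vanishing_order_ideal: "order_ideal A P (vanishing y)"
proof -
  interpret M: Module.module real_ring A
    by (rule module_Caff)
  have "submodule (vanishing y) real_ring A"
    by (rule M.submoduleI)
      (auto simp: vanishing_def a_inv_Caff Caff_ops const_closed uminus_closed add_closed smult_closed mem_fibre_iff)
  moreover have "a \<in> vanishing y" if "a \<in> P" "j \<in> vanishing y" "j \<ominus>\<^bsub>A\<^esub> a \<in> P" for a j
  proof -
    have "a \<in> carrier A" "j \<in> carrier A"
      using that by (auto simp: mem_Caff_pos_iff vanishing_def)
    then show ?thesis
      using that by (force simp: mem_Caff_pos_iff vanishing_def a_minus_Caff mem_fibre_iff)
  qed
  ultimately show ?thesis
    unfolding order_ideal_def by blast
qed

lemma vanishing_closed: "closedin (mtopology_of (norm_metric A (ou_norm A P u))) (vanishing y)"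
  unfolding closedin_norm_metric_iff[OF subset_refl refl a_minus_Caff_ball]
proof (intro conjI ballI)
  fix a assume "a \<in> carrier A - vanishing y"
  then obtain x where a: "a \<in> carrier A" and x: "(x, y) \<in> K" "a (x, y) \<noteq> 0"
    by (auto simp: vanishing_def mem_fibre_iff)
  have "\<bar>a (x, y)\<bar> \<le> bound_norm K (\<lambda>p. a p - b p)" if "b \<in> vanishing y" for b
  proof -
    have b: "b \<in> carrier A" "b (x, y) = 0"
      using that x by (auto simp: vanishing_def mem_fibre_iff)
    have "bounded ((\<lambda>p. a p - b p) ` K)"
      using carrier_CaffD(2)[OF a] carrier_CaffD(2)[OF b(1)] compact_K
      by (intro bounded_image_of_continuous continuous_intros)
    from le_bound_norm[OF this x(1)] show ?thesis
      using b(2) by simp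
  qed
  then show "\<exists>r>0. \<forall>b\<in>vanishing y. r \<le> bound_norm K (\<lambda>p. a p - b p)"
    using x(2) by (intro exI[of _ "\<bar>a (x, y)\<bar>"]) auto
qed (auto simp: vanishing_def)

text \<open>
  A function that vanishes on one fibre is dominated by a function of \<open>y\<close> that vanishes at the same
  point. This is used with the absolute value of \<open>a\<close> to identify the ideal, and with the
  negative part of \<open>a\<close> to identify the positive cone of the quotient.
\<close>

lemma base_majorant:
  assumes F: "continuous_on K F" and y: "y \<in> Y" and zero: "\<And>x. (x, y) \<in> K \<Longrightarrow> F (x, y) = 0"
  obtains G where "G \<in> D.mult_dom" "base G y = 0" "\<And>x. (x, y) \<in> K \<Longrightarrow> G (x, y) = 0"
    "\<And>p. p \<in> K \<Longrightarrow> F p \<le> G p"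
proof -
  let ?G = "\<lambda>p\<in>K. fibre_sup F (snd p)"
  have sup_zero: "fibre_sup F y = 0"
    using fibre_sup_attained[OF F y] zero by metis
  have G: "?G \<in> D.mult_dom"
    by (rule mult_domI[OF continuous_on_fibre_sup[OF F]]) simp
  have "base ?G y = 0"
    by (rule base_unique[OF G y]) (simp add: sup_zero)
  moreover have "F p \<le> ?G p" if "p \<in> K" for p
    using fibre_sup_upper[OF F, of "fst p" "snd p"] that by simp
  ultimately show ?thesis
    using G sup_zero by (intro that[of ?G]) auto
qed

text \<open>
  Only the inclusion of the functions \<open>a\<close> vanishing on the fibre needs an argument: if \<open>G\<close> is a
  function of \<open>y\<close> in the ideal with \<open>\<bar>a\<bar> \<le> G\<close>, then \<open>0 \<le> a + G \<le> 2 G\<close>.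
\<close>

lemma fibre_ideal_eq:
  assumes y: "y \<in> Y"
  shows "D.fibre_ideal y = vanishing y"
proof
  have "{z \<in> D.mult_dom. D.gelfand z y = 0} \<subseteq> vanishing y"
    using base_eq mult_domD(1) by (fastforce simp: vanishing_def gelfand_eq_base mem_fibre_iff)
  then show "D.fibre_ideal y \<subseteq> vanishing y"
    unfolding D.fibre_ideal_def closed_order_ideal_def
    using vanishing_order_ideal vanishing_closed by (intro Inter_lower) blast
  show "vanishing y \<subseteq> D.fibre_ideal y"
    unfolding D.fibre_ideal_def closed_order_ideal_def
  proof (intro subsetI InterI)
    fix a J assume "a \<in> vanishing y" and "J \<in> {J. order_ideal A P J \<and>
      closedin (mtopology_of (norm_metric A (ou_norm A P u))) J \<and> {z \<in> D.mult_dom. D.gelfand z y = 0} \<subseteq> J}"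
    then have a: "a \<in> carrier A" "\<And>x. (x, y) \<in> K \<Longrightarrow> a (x, y) = 0" and J: "order_ideal A P J"
      and I: "\<And>z. z \<in> D.mult_dom \<Longrightarrow> D.gelfand z y = 0 \<Longrightarrow> z \<in> J"
      by (auto simp: vanishing_def mem_fibre_iff)
    interpret M: Module.module real_ring A
      by (rule module_Caff)
    note sub = M.submoduleE[OF conjunct1[OF J[unfolded order_ideal_def]]]
    have cont: "continuous_on K (\<lambda>p. \<bar>a p\<bar>)"
      using carrier_CaffD(2)[OF a(1)] by (intro continuous_intros)
    have zero: "\<bar>a (x, y)\<bar> = 0" if "(x, y) \<in> K" for x
      using a(2)[OF that] by simp
    obtain G where G: "G \<in> D.mult_dom" "base G y = 0" "\<And>x. (x, y) \<in> K \<Longrightarrow> G (x, y) = 0"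
        "\<And>p. p \<in> K \<Longrightarrow> \<bar>a p\<bar> \<le> G p"
      using base_majorant[OF cont y zero] by blast
    have "G \<in> J"
      using I G(1,2) by (simp add: gelfand_eq_base)
    define b where "b = (\<lambda>p\<in>K. a p + G p)"
    define j where "j = (\<lambda>p\<in>K. 2 * G p)"
    have "j \<in> J"
      using sub(4)[of 2 G] \<open>G \<in> J\<close> by (simp add: j_def Caff_ops)
    have closed: "b \<in> carrier A" "j \<in> carrier A"
      using add_closed[OF a(1) mult_domD(1)[OF G(1)]] smult_closed[OF mult_domD(1)[OF G(1)]]
      by (simp_all only: b_def j_def)
    have "b \<in> P" "j \<ominus>\<^bsub>A\<^esub> b \<in> P"
      using closed diff_closed[OF closed(2,1)] G(4)
      by (force simp: mem_Caff_pos_iff a_minus_Caff b_def j_def abs_le_iff)+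
    then have "b \<in> J"
      using J \<open>j \<in> J\<close> unfolding order_ideal_def by blast
    moreover have "\<ominus>\<^bsub>A\<^esub> G \<in> J"
      using sub(3)[OF \<open>G \<in> J\<close>] .
    ultimately have "b \<oplus>\<^bsub>A\<^esub> (\<ominus>\<^bsub>A\<^esub> G) \<in> J"
      by (rule sub(5))
    moreover have "b \<oplus>\<^bsub>A\<^esub> (\<ominus>\<^bsub>A\<^esub> G) = a"
      using carrier_CaffD(1)[OF a(1)] mult_domD(1)[OF G(1)]
      by (intro extensionalityI[of _ K]) (auto simp: a_inv_Caff Caff_ops b_def)
    ultimately show "a \<in> J"
      by (simp only:)
  qed
qed

lemma fibre_class_eq:
  assumes "y \<in> Y" "a \<in> carrier A"
  shows "D.fibre_class y a = {b \<in> carrier A. \<forall>x\<in>fibre K y. b (x, y) = a (x, y)}"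
proof -
  have "D.fibre_class y a = (\<lambda>h. h \<oplus>\<^bsub>A\<^esub> a) ` vanishing y"
    unfolding D.fibre_class_def fibre_ideal_eq[OF assms(1)] a_r_coset_def' by blast
  also have "\<dots> = {b \<in> carrier A. \<forall>x\<in>fibre K y. b (x, y) = a (x, y)}"
  proof (intro equalityI subsetI)
    fix b assume "b \<in> (\<lambda>h. h \<oplus>\<^bsub>A\<^esub> a) ` vanishing y"
    then show "b \<in> {b \<in> carrier A. \<forall>x\<in>fibre K y. b (x, y) = a (x, y)}"
      using assms(2) by (auto simp: vanishing_def Caff_ops add_closed mem_fibre_iff)
  next
    fix b assume b: "b \<in> {b \<in> carrier A. \<forall>x\<in>fibre K y. b (x, y) = a (x, y)}"
    then have "(\<lambda>p\<in>K. b p - a p) \<in> vanishing y"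
      using diff_closed assms(2) by (auto simp: vanishing_def mem_fibre_iff)
    moreover have "b = (\<lambda>p\<in>K. b p - a p) \<oplus>\<^bsub>A\<^esub> a"
      using b carrier_CaffD(1) by (intro extensionalityI[of _ K]) (auto simp: Caff_ops)
    ultimately show "b \<in> (\<lambda>h. h \<oplus>\<^bsub>A\<^esub> a) ` vanishing y"
      by blast
  qed
  finally show ?thesis .
qed

lemma fibre_class_eq_iff:
  assumes "y \<in> Y" "a \<in> carrier A" "b \<in> carrier A"
  shows "D.fibre_class y a = D.fibre_class y b \<longleftrightarrow> (\<forall>x\<in>fibre K y. a (x, y) = b (x, y))"
  unfolding fibre_class_eq[OF assms(1,2)] fibre_class_eq[OF assms(1,3)] using assms(2) by force

lemma fibre_space_ops:
  assumes y: "y \<in> Y" and a: "a \<in> carrier A"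
  shows "D.fibre_class y a \<in> carrier (D.fibre_space y)"
    "\<zero>\<^bsub>D.fibre_space y\<^esub> = D.fibre_class y (\<lambda>p\<in>K. 0)"
    "b \<in> carrier A \<Longrightarrow> D.fibre_class y a \<oplus>\<^bsub>D.fibre_space y\<^esub> D.fibre_class y b = D.fibre_class y (\<lambda>p\<in>K. a p + b p)"
    "r \<odot>\<^bsub>D.fibre_space y\<^esub> D.fibre_class y a = D.fibre_class y (\<lambda>p\<in>K. r * a p)"
proof -
  show "D.fibre_class y a \<in> carrier (D.fibre_space y)"
    using a by (auto simp: D.fibre_space_def quotient_space_def D.fibre_class_def A_RCOSETS_def')
  show "\<zero>\<^bsub>D.fibre_space y\<^esub> = D.fibre_class y (\<lambda>p\<in>K. 0)"
    unfolding fibre_class_eq[OF y const_closed]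
    by (auto simp: D.fibre_space_def quotient_space_def fibre_ideal_eq[OF y] vanishing_def mem_fibre_iff)
  show "D.fibre_class y a \<oplus>\<^bsub>D.fibre_space y\<^esub> D.fibre_class y b = D.fibre_class y (\<lambda>p\<in>K. a p + b p)"
    if b: "b \<in> carrier A"
  proof -
    have "D.fibre_class y a \<oplus>\<^bsub>D.fibre_space y\<^esub> D.fibre_class y b
        = (\<Union>s\<in>D.fibre_class y a. \<Union>t\<in>D.fibre_class y b. {\<lambda>p\<in>K. s p + t p})"
      by (simp add: D.fibre_space_def quotient_space_def set_add_def' Caff_ops)
    also have "\<dots> = D.fibre_class y (\<lambda>p\<in>K. a p + b p)"
      unfolding fibre_class_eq[OF y a] fibre_class_eq[OF y b] fibre_class_eq[OF y add_closed[OF a b]]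
    proof (intro equalityI subsetI)
      fix c assume "c \<in> {c \<in> carrier A. \<forall>x\<in>fibre K y. c (x, y) = (\<lambda>p\<in>K. a p + b p) (x, y)}"
      then have c: "c \<in> carrier A" "\<And>x. (x, y) \<in> K \<Longrightarrow> c (x, y) = a (x, y) + b (x, y)"
        by (auto simp: mem_fibre_iff)
      have "c = (\<lambda>p\<in>K. a p + (\<lambda>p\<in>K. c p - a p) p)"
        using carrier_CaffD(1)[OF c(1)] by (intro extensionalityI[of _ K]) auto
      moreover have "(\<lambda>p\<in>K. c p - a p) \<in> {s \<in> carrier A. \<forall>x\<in>fibre K y. s (x, y) = b (x, y)}"
        using c diff_closed[OF c(1) a] by (auto simp: mem_fibre_iff)
      ultimately show "c \<in> (\<Union>s\<in>{s \<in> carrier A. \<forall>x\<in>fibre K y. s (x, y) = a (x, y)}.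
          \<Union>t\<in>{t \<in> carrier A. \<forall>x\<in>fibre K y. t (x, y) = b (x, y)}. {\<lambda>p\<in>K. s p + t p})"
        using a by blast
    qed (auto simp: mem_fibre_iff add_closed)
    finally show ?thesis .
  qed
  show "r \<odot>\<^bsub>D.fibre_space y\<^esub> D.fibre_class y a = D.fibre_class y (\<lambda>p\<in>K. r * a p)"
  proof -
    have "r \<odot>\<^bsub>D.fibre_space y\<^esub> D.fibre_class y a
        = (\<Union>s\<in>vanishing y. \<Union>t\<in>D.fibre_class y a. {\<lambda>p\<in>K. s p + (\<lambda>p\<in>K. r * t p) p})"
      by (simp add: D.fibre_space_def quotient_space_def set_add_def' Caff_ops fibre_ideal_eq[OF y])
    also have "\<dots> = D.fibre_class y (\<lambda>p\<in>K. r * a p)"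
      unfolding fibre_class_eq[OF y a] fibre_class_eq[OF y smult_closed[OF a]]
    proof (intro equalityI subsetI)
      fix c assume "c \<in> {c \<in> carrier A. \<forall>x\<in>fibre K y. c (x, y) = (\<lambda>p\<in>K. r * a p) (x, y)}"
      then have c: "c \<in> carrier A" "\<And>x. (x, y) \<in> K \<Longrightarrow> c (x, y) = r * a (x, y)"
        by (auto simp: mem_fibre_iff)
      have "c = (\<lambda>p\<in>K. (\<lambda>p\<in>K. c p - (\<lambda>p\<in>K. r * a p) p) p + (\<lambda>p\<in>K. r * a p) p)"
        using carrier_CaffD(1)[OF c(1)] by (intro extensionalityI[of _ K]) auto
      moreover have "(\<lambda>p\<in>K. c p - (\<lambda>p\<in>K. r * a p) p) \<in> vanishing y"
        using c diff_closed[OF c(1) smult_closed[OF a]] unfolding vanishing_def by (auto simp: mem_fibre_iff)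
      ultimately show "c \<in> (\<Union>s\<in>vanishing y. \<Union>t\<in>{t \<in> carrier A. \<forall>x\<in>fibre K y. t (x, y) = a (x, y)}.
          {\<lambda>p\<in>K. s p + (\<lambda>p\<in>K. r * t p) p})"
        using a by blast
    next
      fix c assume "c \<in> (\<Union>s\<in>vanishing y. \<Union>t\<in>{t \<in> carrier A. \<forall>x\<in>fibre K y. t (x, y) = a (x, y)}.
          {\<lambda>p\<in>K. s p + (\<lambda>p\<in>K. r * t p) p})"
      then obtain s t where "s \<in> vanishing y" "t \<in> carrier A" "\<forall>x\<in>fibre K y. t (x, y) = a (x, y)"
          "c = (\<lambda>p\<in>K. s p + (\<lambda>p\<in>K. r * t p) p)"
        by blast
      then show "c \<in> {c \<in> carrier A. \<forall>x\<in>fibre K y. c (x, y) = (\<lambda>p\<in>K. r * a p) (x, y)}"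
        using add_closed[of s "\<lambda>p\<in>K. r * t p"] smult_closed[of t r] by (auto simp: vanishing_def mem_fibre_iff)
    qed
    finally show ?thesis .
  qed
qed

lemma carrier_fibre_space: "carrier (D.fibre_space y) = D.fibre_class y ` carrier A"
  by (auto simp: D.fibre_space_def quotient_space_def D.fibre_class_def A_RCOSETS_def')

lemma abelian_group_fibre_space:
  assumes y: "y \<in> Y"
  shows "abelian_group (D.fibre_space y)"
proof (rule abelian_groupI)
  note ops = fibre_space_ops[OF y]
  show "\<zero>\<^bsub>D.fibre_space y\<^esub> \<in> carrier (D.fibre_space y)"
    using ops(1,2) const_closed by metis
  fix S assume "S \<in> carrier (D.fibre_space y)"
  then obtain a where a: "a \<in> carrier A" "S = D.fibre_class y a"
    unfolding carrier_fibre_space by blast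
  show "\<zero>\<^bsub>D.fibre_space y\<^esub> \<oplus>\<^bsub>D.fibre_space y\<^esub> S = S"
    unfolding a(2) ops(2)[OF a(1)] using a(1) by (simp add: ops const_closed restrict_Caff cong: restrict_cong)
  show "\<exists>T\<in>carrier (D.fibre_space y). T \<oplus>\<^bsub>D.fibre_space y\<^esub> S = \<zero>\<^bsub>D.fibre_space y\<^esub>"
  proof (rule bexI)
    show "D.fibre_class y (\<lambda>p\<in>K. - a p) \<oplus>\<^bsub>D.fibre_space y\<^esub> S = \<zero>\<^bsub>D.fibre_space y\<^esub>"
      unfolding a(2) ops(2)[OF a(1)] using a(1) by (simp add: ops uminus_closed cong: restrict_cong)
  qed (rule ops(1)[OF uminus_closed[OF a(1)]])
  fix T assume "T \<in> carrier (D.fibre_space y)"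
  then obtain b where b: "b \<in> carrier A" "T = D.fibre_class y b"
    unfolding carrier_fibre_space by blast
  show "S \<oplus>\<^bsub>D.fibre_space y\<^esub> T \<in> carrier (D.fibre_space y)"
    unfolding a(2) b(2) ops(3)[OF a(1) b(1)] by (rule ops(1)[OF add_closed[OF a(1) b(1)]])
  show "S \<oplus>\<^bsub>D.fibre_space y\<^esub> T = T \<oplus>\<^bsub>D.fibre_space y\<^esub> S"
    unfolding a(2) b(2) ops(3)[OF a(1) b(1)] ops(3)[OF b(1) a(1)] by (simp add: add.commute)
  fix V assume "V \<in> carrier (D.fibre_space y)"
  then obtain c where c: "c \<in> carrier A" "V = D.fibre_class y c"
    unfolding carrier_fibre_space by blast
  show "S \<oplus>\<^bsub>D.fibre_space y\<^esub> T \<oplus>\<^bsub>D.fibre_space y\<^esub> V = S \<oplus>\<^bsub>D.fibre_space y\<^esub> (T \<oplus>\<^bsub>D.fibre_space y\<^esub> V)"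
    using a b c by (simp add: ops add_closed add.assoc cong: restrict_cong)
qed

lemma module_fibre_space:
  assumes y: "y \<in> Y"
  shows "Module.module real_ring (D.fibre_space y)"
proof (rule moduleI[OF cring_real_ring abelian_group_fibre_space[OF y]])
  note ops = fibre_space_ops[OF y]
  fix r s :: real and S assume "S \<in> carrier (D.fibre_space y)"
  then obtain a where a: "a \<in> carrier A" "S = D.fibre_class y a"
    unfolding carrier_fibre_space by blast
  show "r \<odot>\<^bsub>D.fibre_space y\<^esub> S \<in> carrier (D.fibre_space y)"
    unfolding a(2) ops(4)[OF a(1)] by (rule ops(1)[OF smult_closed[OF a(1)]])
  show "(r \<oplus>\<^bsub>real_ring\<^esub> s) \<odot>\<^bsub>D.fibre_space y\<^esub> S = r \<odot>\<^bsub>D.fibre_space y\<^esub> S \<oplus>\<^bsub>D.fibre_space y\<^esub> s \<odot>\<^bsub>D.fibre_space y\<^esub> S"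
    using a by (simp add: ops smult_closed distrib_right cong: restrict_cong)
  show "(r \<otimes>\<^bsub>real_ring\<^esub> s) \<odot>\<^bsub>D.fibre_space y\<^esub> S = r \<odot>\<^bsub>D.fibre_space y\<^esub> (s \<odot>\<^bsub>D.fibre_space y\<^esub> S)"
    using a by (simp add: ops smult_closed mult.assoc cong: restrict_cong)
  show "\<one>\<^bsub>real_ring\<^esub> \<odot>\<^bsub>D.fibre_space y\<^esub> S = S"
    using a by (simp add: ops restrict_Caff)
  fix T assume "T \<in> carrier (D.fibre_space y)"
  then obtain b where b: "b \<in> carrier A" "T = D.fibre_class y b"
    unfolding carrier_fibre_space by blast
  show "r \<odot>\<^bsub>D.fibre_space y\<^esub> (S \<oplus>\<^bsub>D.fibre_space y\<^esub> T) = r \<odot>\<^bsub>D.fibre_space y\<^esub> S \<oplus>\<^bsub>D.fibre_space y\<^esub> r \<odot>\<^bsub>D.fibre_space y\<^esub> T"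
    using a b by (simp add: ops smult_closed add_closed distrib_left cong: restrict_cong)
qed

lemma a_inv_fibre_space:
  assumes "y \<in> Y" "a \<in> carrier A"
  shows "\<ominus>\<^bsub>D.fibre_space y\<^esub> D.fibre_class y a = D.fibre_class y (\<lambda>p\<in>K. - a p)"
  by (rule abelian_group.minus_equality[OF abelian_group_fibre_space[OF assms(1)]])
    (simp_all add: fibre_space_ops[OF assms(1)] fibre_space_ops(2)[OF assms] uminus_closed assms(2) cong: restrict_cong)

lemma a_minus_fibre_space:
  assumes "y \<in> Y" "a \<in> carrier A" "b \<in> carrier A"
  shows "D.fibre_class y a \<ominus>\<^bsub>D.fibre_space y\<^esub> D.fibre_class y b = D.fibre_class y (\<lambda>p\<in>K. a p - b p)"
  using assms by (simp add: a_minus_def a_inv_fibre_space fibre_space_ops(3) uminus_closed cong: restrict_cong)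

text \<open>
  The cone of the quotient is defined by globally positive representatives. Positivity on the fibre
  suffices, since the negative part of \<open>a\<close> elsewhere can be compensated by a function of \<open>y\<close> that
  vanishes at the given point. In particular the cone is Archimedean.
\<close>

lemma mem_fibre_pos_iff:
  assumes y: "y \<in> Y" and a: "a \<in> carrier A"
  shows "D.fibre_class y a \<in> D.fibre_pos y \<longleftrightarrow> (\<forall>x\<in>fibre K y. 0 \<le> a (x, y))"
proof
  assume "D.fibre_class y a \<in> D.fibre_pos y"
  then obtain b where "b \<in> P" "D.fibre_class y a = D.fibre_class y b"
    by (auto simp: D.fibre_pos_def)
  then show "\<forall>x\<in>fibre K y. 0 \<le> a (x, y)"
    using fibre_class_eq_iff[OF y a] by (auto simp: mem_Caff_pos_iff mem_fibre_iff)
next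
  assume pos: "\<forall>x\<in>fibre K y. 0 \<le> a (x, y)"
  have cont: "continuous_on K (\<lambda>p. max 0 (- a p))"
    using carrier_CaffD(2)[OF a] by (intro continuous_intros)
  have zero: "max 0 (- a (x, y)) = 0" if "(x, y) \<in> K" for x
    using pos that by (simp add: mem_fibre_iff)
  obtain G where G: "G \<in> D.mult_dom" "base G y = 0" "\<And>x. (x, y) \<in> K \<Longrightarrow> G (x, y) = 0"
      "\<And>p. p \<in> K \<Longrightarrow> max 0 (- a p) \<le> G p"
    using base_majorant[OF cont y zero] by blast
  define b where "b = (\<lambda>p\<in>K. a p + G p)"
  have b: "b \<in> carrier A"
    unfolding b_def by (rule add_closed[OF a mult_domD(1)[OF G(1)]])
  have "0 \<le> b p" if "p \<in> K" for p
    using G(4)[OF that] that by (simp add: b_def)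
  then have "b \<in> P"
    using b by (simp add: mem_Caff_pos_iff)
  moreover have "D.fibre_class y a = D.fibre_class y b"
    unfolding fibre_class_eq_iff[OF y a b] using G(3) by (simp add: b_def mem_fibre_iff)
  ultimately show "D.fibre_class y a \<in> D.fibre_pos y"
    unfolding D.fibre_pos_def by (simp only: imageI)
qed

lemma fibre_unit_interval_iff:
  assumes y: "y \<in> Y" and a: "a \<in> carrier A"
  shows "D.fibre_class y a \<oplus>\<^bsub>D.fibre_space y\<^esub> r \<odot>\<^bsub>D.fibre_space y\<^esub> D.fibre_class y u \<in> D.fibre_pos y \<and>
    r \<odot>\<^bsub>D.fibre_space y\<^esub> D.fibre_class y u \<ominus>\<^bsub>D.fibre_space y\<^esub> D.fibre_class y a \<in> D.fibre_pos y
    \<longleftrightarrow> (\<forall>x\<in>fibre K y. \<bar>a (x, y)\<bar> \<le> r)"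
proof -
  have unit: "r \<odot>\<^bsub>D.fibre_space y\<^esub> D.fibre_class y u = D.fibre_class y (\<lambda>p\<in>K. r)"
    by (simp add: fibre_space_ops(4)[OF y const_closed] cong: restrict_cong)
  have upper: "D.fibre_class y a \<oplus>\<^bsub>D.fibre_space y\<^esub> r \<odot>\<^bsub>D.fibre_space y\<^esub> D.fibre_class y u = D.fibre_class y (\<lambda>p\<in>K. a p + r)"
    unfolding unit by (simp add: fibre_space_ops(3)[OF y a const_closed] cong: restrict_cong)
  have lower: "r \<odot>\<^bsub>D.fibre_space y\<^esub> D.fibre_class y u \<ominus>\<^bsub>D.fibre_space y\<^esub> D.fibre_class y a = D.fibre_class y (\<lambda>p\<in>K. r - a p)"
    unfolding unit by (simp add: a_minus_fibre_space[OF y const_closed a] cong: restrict_cong)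
  have "D.fibre_class y (\<lambda>p\<in>K. a p + r) \<in> D.fibre_pos y \<longleftrightarrow> (\<forall>x\<in>fibre K y. 0 \<le> a (x, y) + r)"
    unfolding mem_fibre_pos_iff[OF y add_const_closed[OF a]] by (simp add: ball_fibre)
  moreover have "D.fibre_class y (\<lambda>p\<in>K. r - a p) \<in> D.fibre_pos y \<longleftrightarrow> (\<forall>x\<in>fibre K y. 0 \<le> r - a (x, y))"
    unfolding mem_fibre_pos_iff[OF y const_diff_closed[OF a]] by (simp add: ball_fibre)
  moreover have "\<bar>a (x, y)\<bar> \<le> r \<longleftrightarrow> 0 \<le> a (x, y) + r \<and> 0 \<le> r - a (x, y)" for x
    by linarith
  ultimately show ?thesis
    unfolding upper lower by blast
qed

lemma fibre_pos_cases:
  assumes "S \<in> D.fibre_pos y"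
  obtains a where "a \<in> P" "a \<in> carrier A" "S = D.fibre_class y a"
  using assms by (auto simp: D.fibre_pos_def mem_Caff_pos_iff)

lemma aou_space_fibre:
  assumes y: "y \<in> Y"
  shows "aou_space (D.fibre_space y) (D.fibre_pos y) (D.fibre_class y u)"
proof (intro aou_space.intro aou_space_axioms.intro module_fibre_space[OF y])
  note ops = fibre_space_ops[OF y]
  have P_pos: "D.fibre_class y a \<in> D.fibre_pos y" if "a \<in> P" for a
    using that by (simp add: D.fibre_pos_def)
  show "D.fibre_pos y \<subseteq> carrier (D.fibre_space y)"
    unfolding carrier_fibre_space D.fibre_pos_def by (auto simp: mem_Caff_pos_iff)
  show "\<zero>\<^bsub>D.fibre_space y\<^esub> \<in> D.fibre_pos y"
    unfolding ops(2)[OF const_closed] by (rule P_pos) (simp add: mem_Caff_pos_iff const_closed)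
  show "D.fibre_class y u \<in> carrier (D.fibre_space y)"
    by (rule ops(1)[OF const_closed])
  show "S \<oplus>\<^bsub>D.fibre_space y\<^esub> T \<in> D.fibre_pos y" if ST: "S \<in> D.fibre_pos y" "T \<in> D.fibre_pos y" for S T
  proof -
    obtain a b where a: "a \<in> P" "a \<in> carrier A" "S = D.fibre_class y a"
      and b: "b \<in> P" "b \<in> carrier A" "T = D.fibre_class y b"
      using ST fibre_pos_cases by metis
    show ?thesis
      unfolding a(3) b(3) ops(3)[OF a(2) b(2)]
      by (rule P_pos) (use a(1) b(1) in \<open>simp add: mem_Caff_pos_iff add_closed\<close>)
  qed
  show "r \<odot>\<^bsub>D.fibre_space y\<^esub> S \<in> D.fibre_pos y" if rS: "0 \<le> r" "S \<in> D.fibre_pos y" for r S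
  proof -
    obtain a where a: "a \<in> P" "a \<in> carrier A" "S = D.fibre_class y a"
      using rS(2) fibre_pos_cases by metis
    show ?thesis
      unfolding a(3) ops(4)[OF a(2)]
      by (rule P_pos) (use a(1) rS(1) in \<open>simp add: mem_Caff_pos_iff smult_closed\<close>)
  qed
  show "S = \<zero>\<^bsub>D.fibre_space y\<^esub>" if S: "S \<in> D.fibre_pos y" "\<ominus>\<^bsub>D.fibre_space y\<^esub> S \<in> D.fibre_pos y" for S
  proof -
    obtain a where a: "a \<in> P" "a \<in> carrier A" "S = D.fibre_class y a"
      using S(1) fibre_pos_cases by metis
    have "\<forall>x\<in>fibre K y. 0 \<le> (\<lambda>p\<in>K. - a p) (x, y)"
      using S(2) unfolding a(3) a_inv_fibre_space[OF y a(2)] mem_fibre_pos_iff[OF y uminus_closed[OF a(2)]] .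
    then show ?thesis
      unfolding a(3) ops(2)[OF a(2)] fibre_class_eq_iff[OF y a(2) const_closed]
      using a(1) by (force simp: mem_Caff_pos_iff mem_fibre_iff)
  qed
  fix S assume "S \<in> carrier (D.fibre_space y)"
  then obtain a where a: "a \<in> carrier A" "S = D.fibre_class y a"
    unfolding carrier_fibre_space by blast
  obtain r where "0 < r" "\<forall>p\<in>K. \<bar>a p\<bar> \<le> r"
    using carrier_CaffD(4)[OF a(1)] unfolding bounded_pos by auto
  then show "\<exists>r>0. S \<oplus>\<^bsub>D.fibre_space y\<^esub> r \<odot>\<^bsub>D.fibre_space y\<^esub> D.fibre_class y u \<in> D.fibre_pos y \<and>
      r \<odot>\<^bsub>D.fibre_space y\<^esub> D.fibre_class y u \<ominus>\<^bsub>D.fibre_space y\<^esub> S \<in> D.fibre_pos y"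
    unfolding a(2) fibre_unit_interval_iff[OF y a(1)] by (auto simp: mem_fibre_iff)
  show "S \<in> D.fibre_pos y"
    if pos: "\<And>r. 0 < r \<Longrightarrow> S \<oplus>\<^bsub>D.fibre_space y\<^esub> r \<odot>\<^bsub>D.fibre_space y\<^esub> D.fibre_class y u \<in> D.fibre_pos y"
  proof -
    have "D.fibre_class y (\<lambda>p\<in>K. a p + r) \<in> D.fibre_pos y" if "0 < r" for r
      using pos[OF that] unfolding a(2) ops(4)[OF const_closed]
      by (simp add: ops(3)[OF a(1)] const_closed cong: restrict_cong)
    then have "0 \<le> a (x, y) + r" if "0 < r" "x \<in> fibre K y" for r x
      using mem_fibre_pos_iff[OF y add_const_closed[OF a(1), of r]] that by (auto simp: mem_fibre_iff)
    then show ?thesis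
      unfolding a(2) mem_fibre_pos_iff[OF y a(1)] by (auto intro: field_le_epsilon)
  qed
qed

lemma fibre_norm_eq:
  assumes "y \<in> Y" "a \<in> carrier A"
  shows "D.fibre_norm y (D.fibre_class y a) = bound_norm (fibre K y) (\<lambda>x. a (x, y))"
  unfolding D.fibre_norm_def ou_norm_def bound_norm_def fibre_unit_interval_iff[OF assms] by simp

lemma finsum_fibre_space:
  assumes y: "y \<in> Y" and "finite I" "h \<in> I \<rightarrow> carrier A"
  shows "(\<Oplus>\<^bsub>D.fibre_space y\<^esub>i\<in>I. D.fibre_class y (h i)) = D.fibre_class y (\<Oplus>\<^bsub>A\<^esub>i\<in>I. h i)"
  using assms(2,3)
proof (induction I rule: finite_induct)
  interpret F: abelian_group "D.fibre_space y"
    by (rule abelian_group_fibre_space[OF y])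
  interpret M: abelian_group A
    by (rule abelian_group_Caff)
  note ops = fibre_space_ops[OF y]
  {
    case empty
    show "(\<Oplus>\<^bsub>D.fibre_space y\<^esub>i\<in>{}. D.fibre_class y (h i)) = D.fibre_class y (\<Oplus>\<^bsub>A\<^esub>i\<in>{}. h i)"
      by (simp only: F.finsum_empty M.finsum_empty ops(2)[OF const_closed] Caff_ops)
  next
    case (insert j I)
    then have "(\<Oplus>\<^bsub>D.fibre_space y\<^esub>i\<in>insert j I. D.fibre_class y (h i))
        = D.fibre_class y (h j) \<oplus>\<^bsub>D.fibre_space y\<^esub> (\<Oplus>\<^bsub>D.fibre_space y\<^esub>i\<in>I. D.fibre_class y (h i))"
      by (intro F.finsum_insert) (auto intro!: ops(1))
    also have "\<dots> = D.fibre_class y (h j \<oplus>\<^bsub>A\<^esub> (\<Oplus>\<^bsub>A\<^esub>i\<in>I. h i))"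
    proof -
      have "(\<Oplus>\<^bsub>D.fibre_space y\<^esub>i\<in>I. D.fibre_class y (h i)) = D.fibre_class y (\<Oplus>\<^bsub>A\<^esub>i\<in>I. h i)"
        by (rule insert.IH) (use insert.prems in auto)
      moreover have "h j \<in> carrier A" "(\<Oplus>\<^bsub>A\<^esub>i\<in>I. h i) \<in> carrier A"
        using insert.prems by (auto intro!: M.finsum_closed)
      ultimately show ?thesis
        by (simp only: ops(3) Caff_ops)
    qed
    also have "h j \<oplus>\<^bsub>A\<^esub> (\<Oplus>\<^bsub>A\<^esub>i\<in>I. h i) = (\<Oplus>\<^bsub>A\<^esub>i\<in>insert j I. h i)"
      using insert by (intro M.finsum_insert[symmetric]) auto
    finally show "(\<Oplus>\<^bsub>D.fibre_space y\<^esub>i\<in>insert j I. D.fibre_class y (h i)) = D.fibre_class y (\<Oplus>\<^bsub>A\<^esub>i\<in>insert j I. h i)" .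
  }
qed

lemma finsum_Caff: "(\<Oplus>\<^bsub>A\<^esub>i\<in>I. h i) = (\<Oplus>\<^bsub>D.dom_module\<^esub>i\<in>I. h i)"
  by (simp add: finsum_def finprod_def D.dom_module_def)

lemma fibre_class_gen_comb:
  assumes y: "y \<in> Y"
  shows "(\<Oplus>\<^bsub>D.fibre_space y\<^esub>i\<in>{..<CARD('n) + 1}. k i \<odot>\<^bsub>D.fibre_space y\<^esub> D.fibre_class y (gen i))
    = D.fibre_class y (coef_comb (\<lambda>i _. k i))"
proof -
  have I: "{..<CARD('n) + 1} = {..CARD('n)}"
    by auto
  have "(\<Oplus>\<^bsub>D.fibre_space y\<^esub>i\<in>{..CARD('n)}. k i \<odot>\<^bsub>D.fibre_space y\<^esub> D.fibre_class y (gen i))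
      = (\<Oplus>\<^bsub>D.fibre_space y\<^esub>i\<in>{..CARD('n)}. D.fibre_class y (\<lambda>p\<in>K. k i * gen i p))"
    by (simp only: fibre_space_ops(4)[OF y gen_closed])
  also have "\<dots> = D.fibre_class y (\<Oplus>\<^bsub>D.dom_module\<^esub>i\<in>{..CARD('n)}. (\<lambda>p\<in>K. k i * gen i p))"
    unfolding finsum_Caff[symmetric]
    by (rule finsum_fibre_space[OF y]) (auto simp: smult_closed gen_closed)
  also have "(\<Oplus>\<^bsub>D.dom_module\<^esub>i\<in>{..CARD('n)}. (\<lambda>p\<in>K. k i * gen i p))
      = (\<lambda>p\<in>K. \<Sum>i\<le>CARD('n). (\<lambda>p\<in>K. k i * gen i p) p)"
    by (rule finsum_dom_module) (auto simp: smult_closed gen_closed)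
  also have "\<dots> = coef_comb (\<lambda>i _. k i)"
    unfolding coef_comb_def affine_comb_def by (intro restrict_ext sum.cong) (auto simp: gen_def)
  finally show ?thesis
    unfolding I .
qed

lemma has_dimension_fibre_space:
  assumes y: "y \<in> Y"
  shows "has_dimension (D.fibre_space y) (CARD('n) + 1)"
  unfolding has_dimension_def free_basis_def
proof (intro exI[of _ "\<lambda>i. D.fibre_class y (gen i)"] conjI ballI)
  show "(\<lambda>i. D.fibre_class y (gen i)) \<in> {..<CARD('n) + 1} \<rightarrow> carrier (D.fibre_space y)"
    using fibre_space_ops(1)[OF y gen_closed] by blast
  fix S assume "S \<in> carrier (D.fibre_space y)"
  then obtain a where a: "a \<in> carrier A" "S = D.fibre_class y a"
    unfolding carrier_fibre_space by blast
  have eq_iff: "S = (\<Oplus>\<^bsub>D.fibre_space y\<^esub>i\<in>{..<CARD('n) + 1}. k i \<odot>\<^bsub>D.fibre_space y\<^esub> D.fibre_class y (gen i))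
      \<longleftrightarrow> (\<forall>i\<le>CARD('n). coef a y i = k i)" for k
  proof -
    have k: "coef_comb (\<lambda>i _. k i) \<in> carrier A"
      by (rule coef_comb_closed) simp
    have "S = (\<Oplus>\<^bsub>D.fibre_space y\<^esub>i\<in>{..<CARD('n) + 1}. k i \<odot>\<^bsub>D.fibre_space y\<^esub> D.fibre_class y (gen i))
        \<longleftrightarrow> (\<forall>x\<in>fibre K y. a (x, y) = affine_comb k x)"
      unfolding fibre_class_gen_comb[OF y] a(2) fibre_class_eq_iff[OF y a(1) k]
      by (simp add: coef_comb_def mem_fibre_iff)
    also have "\<dots> \<longleftrightarrow> (\<forall>i\<le>CARD('n). coef a y i = k i)"
    proof
      assume "\<forall>x\<in>fibre K y. a (x, y) = affine_comb k x"
      then show "\<forall>i\<le>CARD('n). coef a y i = k i"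
        using coef_unique[OF a(1) y] by (simp add: mem_fibre_iff)
    next
      assume "\<forall>i\<le>CARD('n). coef a y i = k i"
      then show "\<forall>x\<in>fibre K y. a (x, y) = affine_comb k x"
        using coef_spec[OF a(1)] by (simp add: mem_fibre_iff affine_comb_def)
    qed
    finally show ?thesis .
  qed
  show "\<exists>!c. c \<in> {..<CARD('n) + 1} \<rightarrow>\<^sub>E carrier real_ring \<and>
      S = (\<Oplus>\<^bsub>D.fibre_space y\<^esub>i\<in>{..<CARD('n) + 1}. c i \<odot>\<^bsub>D.fibre_space y\<^esub> D.fibre_class y (gen i))"
    unfolding eq_iff
  proof (rule ex1I[of _ "\<lambda>i\<in>{..<CARD('n) + 1}. coef a y i"])
    fix c assume "c \<in> {..<CARD('n) + 1} \<rightarrow>\<^sub>E carrier real_ring \<and> (\<forall>i\<le>CARD('n). coef a y i = c i)"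
    then show "c = (\<lambda>i\<in>{..<CARD('n) + 1}. coef a y i)"
      by (intro extensionalityI[of _ "{..<CARD('n) + 1}"]) (auto simp: PiE_def)
  qed auto
qed

lemma pos_iff_fibrewise:
  assumes "a \<in> carrier A"
  shows "a \<in> P \<longleftrightarrow> (\<forall>y\<in>Y. D.fibre_class y a \<in> D.fibre_pos y)"
  using assms mem_fibre_pos_iff[OF _ assms] by (force simp: mem_Caff_pos_iff mem_fibre_iff)

text \<open>
  In coefficients the sequence is bounded in \<open>\<real>\<^sup>n\<^sup>+\<^sup>1\<close>, so a subsequence converges, and the function
  with constant coefficients equal to the limit is the required \<open>a\<close>. It is positive on the limit
  fibre because every interior point of that fibre is a limit of points of the fibres over \<open>y\<^sub>k\<close>.
\<close>

lemma fibre_sequence_limit: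
  assumes y0: "y0 \<in> Y" and ys: "\<And>k. ys k \<in> Y" "ys \<longlonglongrightarrow> y0"
    and v: "\<And>k. v k \<in> D.fibre_pos (ys k)" and B: "\<And>k. D.fibre_norm (ys k) (v k) \<le> B"
  shows "\<exists>\<sigma> :: nat \<Rightarrow> nat. strict_mono \<sigma> \<and>
    (\<exists>v0\<in>D.fibre_pos y0. \<exists>a\<in>carrier A. D.fibre_class y0 a = v0 \<and>
      (\<lambda>j. D.fibre_norm (ys (\<sigma> j))
        (v (\<sigma> j) \<ominus>\<^bsub>D.fibre_space (ys (\<sigma> j))\<^esub> D.fibre_class (ys (\<sigma> j)) a)) \<longlonglongrightarrow> 0)"
proof -
  have "\<forall>k. \<exists>a. a \<in> P \<and> a \<in> carrier A \<and> v k = D.fibre_class (ys k) a"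
    using v fibre_pos_cases by metis
  then obtain b where b: "\<And>k. b k \<in> P" "\<And>k. b k \<in> carrier A" "\<And>k. v k = D.fibre_class (ys k) (b k)"
    by metis
  obtain C where C: "0 \<le> C"
    "\<And>a y i r. a \<in> carrier A \<Longrightarrow> y \<in> Y \<Longrightarrow> i \<le> CARD('n) \<Longrightarrow> (\<And>x. (x, y) \<in> K \<Longrightarrow> \<bar>a (x, y)\<bar> \<le> r)
      \<Longrightarrow> \<bar>coef a y i\<bar> \<le> C * r"
    using coef_bound by blast
  define q where "q i k = coef (b k) (ys k) i" for i k
  have fibre_bdd: "bounded ((\<lambda>x. a (x, y)) ` fibre K y)" if "a \<in> carrier A" for a y
    by (rule bounded_subset[OF carrier_CaffD(4)[OF that]]) (auto simp: mem_fibre_iff)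
  have "\<bar>b k (x, ys k)\<bar> \<le> B" if "(x, ys k) \<in> K" for k x
    using le_bound_norm[OF fibre_bdd[OF b(2)], of x "ys k" k] B[of k] that
    unfolding b(3) fibre_norm_eq[OF ys(1) b(2)] mem_fibre_iff by linarith
  then have "\<bar>q i k\<bar> \<le> C * B" if "i \<in> {..CARD('n)}" for i k
    unfolding q_def using that by (intro C(2) b(2) ys(1)) auto
  then have "bounded (range (q i))" if "i \<in> {..CARD('n)}" for i
    using that unfolding bounded_iff by auto
  then obtain \<sigma> l where \<sigma>: "strict_mono \<sigma>" and l: "\<And>i. i \<in> {..CARD('n)} \<Longrightarrow> (\<lambda>k. q i (\<sigma> k)) \<longlonglongrightarrow> l i"
    using finite_family_convergent_subsequence[of "{..CARD('n)}" q] by blast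
  define a where "a = coef_comb (\<lambda>i _. l i)"
  have a: "a \<in> carrier A"
    unfolding a_def by (rule coef_comb_closed) simp
  have ys_\<sigma>: "(\<lambda>k. ys (\<sigma> k)) \<longlonglongrightarrow> y0"
    using LIMSEQ_subseq_LIMSEQ[OF ys(2) \<sigma>] by (simp add: o_def)
  have interior_pos: "interior (fibre K y0) \<subseteq> {x. 0 \<le> affine_comb l x}"
  proof
    fix x assume x: "x \<in> interior (fibre K y0)"
    obtain xs where xs: "\<And>k. xs k \<in> interior (fibre K (ys (\<sigma> k)))" "xs \<longlonglongrightarrow> x"
      using interior_fibre_lhc[OF y0 _ ys_\<sigma> x] ys(1) by blast
    have "(\<lambda>k. affine_comb (\<lambda>i. q i (\<sigma> k)) (xs k)) \<longlonglongrightarrow> affine_comb l x"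
      unfolding affine_comb_def
    proof (intro tendsto_sum tendsto_mult l)
      show "(\<lambda>k. affine_gen i (xs k)) \<longlonglongrightarrow> affine_gen i x" for i
        using continuous_on_tendsto_compose[OF continuous_on_affine_gen[of UNIV i] xs(2)] by simp
    qed
    moreover have "0 \<le> affine_comb (\<lambda>i. q i (\<sigma> k)) (xs k)" for k
    proof -
      have mem: "(xs k, ys (\<sigma> k)) \<in> K"
        using xs(1) interior_subset mem_fibre_iff by blast
      have "0 \<le> b (\<sigma> k) (xs k, ys (\<sigma> k))"
        using b(1)[of "\<sigma> k"] mem by (simp add: mem_Caff_pos_iff)
      then show ?thesis
        using coef_spec[OF b(2) mem] by (simp add: q_def)
    qed
    ultimately have "0 \<le> affine_comb l x"
      by (intro LIMSEQ_le_const) auto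
    then show "x \<in> {x. 0 \<le> affine_comb l x}"
      by simp
  qed
  have "continuous_on UNIV (affine_comb l)"
    unfolding affine_comb_def by (intro continuous_intros continuous_on_affine_gen)
  then have "closed {x. 0 \<le> affine_comb l x}"
    by (intro closed_Collect_le continuous_on_const)
  then have "fibre K y0 \<subseteq> {x. 0 \<le> affine_comb l x}"
    using closure_minimal[OF interior_pos] fibre_subset_closure_interior[OF y0] by blast
  then have pos: "D.fibre_class y0 a \<in> D.fibre_pos y0"
    unfolding mem_fibre_pos_iff[OF y0 a] by (auto simp: a_def coef_comb_def mem_fibre_iff)
  obtain R where R: "0 \<le> R" "\<And>x y. (x, y) \<in> K \<Longrightarrow> norm x \<le> R"
    using fibre_bounded_by by blast
  have norm_bound: "\<bar>D.fibre_norm (ys k) (v k \<ominus>\<^bsub>D.fibre_space (ys k)\<^esub> D.fibre_class (ys k) a)\<bar>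
      \<le> (\<Sum>i\<le>CARD('n). \<bar>q i k - l i\<bar> * (1 + R))" for k
  proof -
    have diff: "(\<lambda>p\<in>K. b k p - a p) \<in> carrier A"
      by (rule diff_closed[OF b(2) a])
    have "D.fibre_norm (ys k) (v k \<ominus>\<^bsub>D.fibre_space (ys k)\<^esub> D.fibre_class (ys k) a)
        = bound_norm (fibre K (ys k)) (\<lambda>x. (\<lambda>p\<in>K. b k p - a p) (x, ys k))"
      unfolding b(3) a_minus_fibre_space[OF ys(1) b(2) a] by (rule fibre_norm_eq[OF ys(1) diff])
    moreover have "0 \<le> bound_norm (fibre K (ys k)) (\<lambda>x. (\<lambda>p\<in>K. b k p - a p) (x, ys k))"
      by (rule bound_norm_nonneg[OF fibre_bdd[OF diff]])
    moreover have "bound_norm (fibre K (ys k)) (\<lambda>x. (\<lambda>p\<in>K. b k p - a p) (x, ys k))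
        \<le> (\<Sum>i\<le>CARD('n). \<bar>q i k - l i\<bar> * (1 + R))"
    proof (rule bound_norm_le)
      show "0 \<le> (\<Sum>i\<le>CARD('n). \<bar>q i k - l i\<bar> * (1 + R))"
        using R(1) by (intro sum_nonneg) simp
      fix x assume "x \<in> fibre K (ys k)"
      then have x: "(x, ys k) \<in> K"
        by (simp add: mem_fibre_iff)
      have "b k (x, ys k) - a (x, ys k) = (\<Sum>i\<le>CARD('n). (q i k - l i) * affine_gen i x)"
        using x coef_spec[OF b(2) x, of k]
        by (simp add: a_def coef_comb_def q_def affine_comb_def left_diff_distrib sum_subtractf)
      also have "\<bar>\<dots>\<bar> \<le> (\<Sum>i\<le>CARD('n). \<bar>q i k - l i\<bar> * (1 + R))"
        using abs_affine_gen_le[OF R(1) R(2)[OF x]]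
        by (intro order.trans[OF sum_abs] sum_mono) (simp add: abs_mult mult_left_mono)
      finally show "\<bar>(\<lambda>p\<in>K. b k p - a p) (x, ys k)\<bar> \<le> (\<Sum>i\<le>CARD('n). \<bar>q i k - l i\<bar> * (1 + R))"
        using x by simp
    qed
    ultimately show ?thesis
      by simp
  qed
  have "(\<lambda>j. \<Sum>i\<le>CARD('n). \<bar>q i (\<sigma> j) - l i\<bar> * (1 + R)) \<longlonglongrightarrow> (\<Sum>i\<le>CARD('n). \<bar>l i - l i\<bar> * (1 + R))"
    by (intro tendsto_intros l)
  then have "(\<lambda>j. \<Sum>i\<le>CARD('n). \<bar>q i (\<sigma> j) - l i\<bar> * (1 + R)) \<longlonglongrightarrow> 0"
    by simp
  then have "(\<lambda>j. D.fibre_norm (ys (\<sigma> j))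
      (v (\<sigma> j) \<ominus>\<^bsub>D.fibre_space (ys (\<sigma> j))\<^esub> D.fibre_class (ys (\<sigma> j)) a)) \<longlonglongrightarrow> 0"
    by (rule Lim_null_comparison[rotated]) (simp only: real_norm_def norm_bound eventually_True)
  then show ?thesis
    using \<sigma> pos a by blast
qed

section \<open>The evaluation functionals\<close>

lemma evaluations_subset_states: "evaluations K \<subseteq> states A P u"
  by (auto simp: evaluations_def states_def linear_functionals_def Caff_ops add_closed smult_closed
      const_closed mem_Caff_pos_iff)

lemma evaluations_compact: "compactin (weak_star A) (evaluations K)"
proof -
  have "continuous_map (top_of_set K) (weak_star A) ev"
    unfolding weak_star_def continuous_map_componentwise using carrier_CaffD(2) by auto
  moreover have "compactin (top_of_set K) K"
    using compact_K by (simp add: compactin_subtopology)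
  ultimately show ?thesis
    unfolding evaluations_def by (rule image_compactin[rotated])
qed

lemma evaluations_order_determining:
  assumes "a \<in> carrier A" "\<And>\<phi>. \<phi> \<in> evaluations K \<Longrightarrow> 0 \<le> \<phi> a"
  shows "a \<in> P"
proof -
  have "0 \<le> a p" if "p \<in> K" for p
    using assms(2)[of "ev p"] assms(1) that by (simp add: evaluations_def)
  then show ?thesis
    using assms(1) by (simp add: mem_Caff_pos_iff)
qed

theorem free_order_unit_module_Caff:
  "free_order_unit_module A P u (evaluations K) (coordinate_gens K) Y CARD('n)"
proof (intro free_order_unit_module.intro free_order_unit_module_axioms.intro aou_space_Caff)
  show "D.gelfand \<in> ring_iso D.dom_alg (cont_alg Y)"
    by (rule gelfand_ring_iso)
  show "\<exists>e. free_basis D.dom_alg D.dom_module {..CARD('n)} e \<and> e 0 = u \<and>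
      homeomorphic_map (mtopology_of (norm_metric A (ou_norm A P u)))
        (product_topology (\<lambda>_. mtopology_of (cont_metric Y)) {..CARD('n)})
        (\<lambda>a. \<lambda>i\<in>{..CARD('n)}. D.gelfand (coordinates D.dom_alg D.dom_module {..CARD('n)} e a i))"
    using free_basis_gen gen_0 coordinates_homeomorphism by blast
qed (fact evaluations_subset_states evaluations_compact evaluations_order_determining
      module_dom_module comm_real_cstar_algebra_dom_alg cstar_generated_coordinate_gens
      char_map_embedding char_map_image compact_Y gelfand_smult gelfand_isometric aou_space_fibre
      has_dimension_fibre_space pos_iff_fibrewise fibre_sequence_limit
    | use coordinate_gens_mult_dom in blast)+

end

theorem proposition4p13:
  fixes K :: "((real ^ 'n) \<times> (real ^ 'm)) set"
  assumes "compact K" and "regular_partially_convex K"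
  shows "free_order_unit_module (Caff K) (Caff_pos K) (\<lambda>p\<in>K. 1) (evaluations K)
           (coordinate_gens K) (snd ` K) CARD('n) \<and>
         (\<forall>f\<in>carrier (cont_alg (snd ` K)).
           pullback K f \<in> order_unit_module_data.mult_dom (Caff K) (evaluations K) \<and>
           order_unit_module_data.gelfand (Caff K) (\<lambda>p\<in>K. 1) (evaluations K)
             (coordinate_gens K) (snd ` K) (pullback K f) = f) \<and>
         (\<forall>f\<in>carrier (Caff K). ou_norm (Caff K) (Caff_pos K) (\<lambda>p\<in>K. 1) f = sup_norm K f)"
proof (intro conjI ballI)
  interpret compact_regular K
    using assms by unfold_locales
  show "free_order_unit_module (Caff K) (Caff_pos K) (\<lambda>p\<in>K. 1) (evaluations K)
      (coordinate_gens K) (snd ` K) CARD('n)"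
    by (rule free_order_unit_module_Caff)
  fix f assume f: "f \<in> carrier (cont_alg (snd ` K))"
  show "pullback K f \<in> D.mult_dom"
    by (rule pullback_closed[OF f])
  then show "D.gelfand (pullback K f) = f"
    by (simp add: gelfand_eq_base base_pullback[OF f])
next
  interpret compact_regular K
    using assms by unfold_locales
  fix f assume f: "f \<in> carrier (Caff K)"
  then show "ou_norm (Caff K) (Caff_pos K) (\<lambda>p\<in>K. 1) f = sup_norm K f"
    by (simp add: ou_norm_Caff sup_norm_eq_bound_norm[OF compact_K] carrier_CaffD)
qed

end
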